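(* Let $(M,g)$ be a compact Riemannian surface without boundary, let $\gamma$ be a closed embedded geodesic in $M$ of length $|\gamma|$, and let $n\ge 1$ be an integer. Assume that the Gauss curvature $K_g$ is positive along $\gamma$ and that $$|\gamma|^2\,\sup_\gamma K_g<\pi^2 n^2 .$$ Then there exists a Bouncing Jacobi Field along $\gamma$ which has $n$ minimums and for which the sum of the nullity and the index is equal to $n$.
   Context: $\gamma$ is parameterized by arc-length $s$ and identified with $\mathbf R/|\gamma|\mathbf Z$. The Jacobi operator is $\mathfrak J_\gamma:=-(\partial_s^2+K_g)$, with $K_g$ the Gauss curvature of $(M,g)$ along $\gamma$. Points $s_1,\dots,s_n$ of $\gamma$ are represented so that $0\le s_1<\dots<s_n<|\gamma|$, with $s_0:=s_n-|\gamma|$ and $s_{n+1}:=s_1+|\gamma|$. $f(s_j^+)$ and $f(s_j^-)$ denote the limits of $f$ at $s_j$ from the right and from the left. Bouncing Jacobi Field with $n\ge1$ minimums: a function $\Phi:\gamma\to\mathbf R$ for which there exist $n$ distinct points $s_1,\dots,s_n\in\gamma$ such that $\Phi$ is continuous on $\gamma$, smooth on $\gamma-\{s_1,\dots,s_n\}$, $\mathfrak J_\gamma\Phi=0$ and $\Phi>1$ on $\gamma-\{s_1,\dots,s_n\}$, and $\Phi(s_j)=1$, $\partial_s\Phi(s_j^+)=-\partial_s\Phi(s_j^-)>0$ for all $j=1,\dots,n$. Define $$\mathcal H_n(s_1,\dots,s_n):=\sum_{j=1}^n\ \inf_{\phi-1\in H^1_0(s_j,s_{j+1})}\int_{s_j}^{s_{j+1}}\left(|\partial_s\phi|^2-K_g\,\phi^2\right)ds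 .$$ The points where a Bouncing Jacobi Field $\Phi$ is minimal form a critical point of $\mathcal H_n$. The index of $\Phi$ is the number of negative eigenvalues of the Hessian matrix of $\mathcal H_n$ at $(s_1,\dots,s_n)$, and the nullity of $\Phi$ is the dimension of the null-space of this Hessian matrix. *)

theory Defs
  imports
    "Jordan_Normal_Form.Char_Poly"
    "Jordan_Normal_Form.Matrix_Kernel"
    "HOL-Analysis.Analysis"
begin

no_notation Matrix.vec_index (infixl "$" 100)
no_notation Matrix.scalar_prod (infix "\<bullet>" 70)

section \<open>Smooth functions on open sets\<close>

primrec times_differentiable_on ::
    "nat \<Rightarrow> 'a::real_normed_vector set \<Rightarrow> ('a \<Rightarrow> 'b::real_normed_vector) \<Rightarrow> bool" where
  "times_differentiable_on 0 S f \<longleftrightarrow> continuous_on S f"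
| "times_differentiable_on (Suc k) S f \<longleftrightarrow>
     (\<forall>x\<in>S. f differentiable (at x)) \<and>
     (\<forall>v. times_differentiable_on k S (\<lambda>x. frechet_derivative f (at x) v))"

text \<open>Only used for open \<open>S\<close>.\<close>

definition smooth_on :: "'a::real_normed_vector set \<Rightarrow> ('a \<Rightarrow> 'b::real_normed_vector) \<Rightarrow> bool" where
  "smooth_on S f \<longleftrightarrow> (\<forall>k. times_differentiable_on k S f)"


section \<open>Riemannian surfaces\<close>

text \<open>
  A chart \<open>(U, \<phi>)\<close> is an open set of the surface with a homeomorphism onto an open subset of the
  plane. A Riemannian metric is given by its Gram matrix in each chart of the atlas, as a
  matrix-valued function \<open>g c\<close> on the image of the chart \<open>c\<close>.
\<close>

type_synonym 'a chart = "'a set \<times> ('a \<Rightarrow> real ^ 2)"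
type_synonym 'a metric_coeffs = "'a chart \<Rightarrow> real ^ 2 \<Rightarrow> real ^ 2 ^ 2"

definition transition :: "'a chart \<Rightarrow> 'a chart \<Rightarrow> real ^ 2 \<Rightarrow> real ^ 2" where
  "transition c d = snd d \<circ> inv_into (fst c) (snd c)"

definition smooth_surface :: "'a topology \<Rightarrow> 'a chart set \<Rightarrow> bool" where
  "smooth_surface X A \<longleftrightarrow>
     Hausdorff_space X \<and> second_countable X \<and>
     topspace X = (\<Union>c\<in>A. fst c) \<and>
     (\<forall>(U, \<phi>)\<in>A. openin X U \<and> open (\<phi> ` U) \<and>
        homeomorphic_map (subtopology X U) (top_of_set (\<phi> ` U)) \<phi>) \<and>
     (\<forall>c\<in>A. \<forall>d\<in>A. smooth_on (snd c ` (fst c \<inter> fst d)) (transition c d))"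

definition riemannian_metric :: "'a chart set \<Rightarrow> 'a metric_coeffs \<Rightarrow> bool" where
  "riemannian_metric A g \<longleftrightarrow>
     (\<forall>c\<in>A. smooth_on (snd c ` fst c) (g c) \<and>
        (\<forall>x\<in>snd c ` fst c.
           (\<forall>i j. g c x $ i $ j = g c x $ j $ i) \<and>
           (\<forall>v. v \<noteq> 0 \<longrightarrow> v \<bullet> (g c x *v v) > 0))) \<and>
     (\<forall>c\<in>A. \<forall>d\<in>A. \<forall>x\<in>snd c ` (fst c \<inter> fst d). \<forall>v w.
        let T = transition c d; D = frechet_derivative T (at x)
        in v \<bullet> (g c x *v w) = D v \<bullet> (g d (T x) *v D w))"

definition compact_riemannian_surface ::
    "'a topology \<Rightarrow> 'a chart set \<Rightarrow> 'a metric_coeffs \<Rightarrow> bool" where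
  "compact_riemannian_surface X A g \<longleftrightarrow>
     compact_space X \<and> smooth_surface X A \<and> riemannian_metric A g"


subsection \<open>Christoffel symbols and Gauss curvature\<close>

definition pderiv2 :: "2 \<Rightarrow> (real ^ 2 \<Rightarrow> real) \<Rightarrow> real ^ 2 \<Rightarrow> real" where
  "pderiv2 i f x = frechet_derivative f (at x) (axis i 1)"

text \<open>\<open>christoffel h k i j\<close> is the symbol with upper index \<open>k\<close> and lower indices \<open>i\<close>, \<open>j\<close>.\<close>

definition christoffel ::
    "(real ^ 2 \<Rightarrow> real ^ 2 ^ 2) \<Rightarrow> 2 \<Rightarrow> 2 \<Rightarrow> 2 \<Rightarrow> real ^ 2 \<Rightarrow> real" where
  "christoffel h k i j x = 1 / 2 * (\<Sum>l\<in>UNIV. matrix_inv (h x) $ k $ l *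
     (pderiv2 i (\<lambda>y. h y $ j $ l) x + pderiv2 j (\<lambda>y. h y $ i $ l) x
        - pderiv2 l (\<lambda>y. h y $ i $ j) x))"

text \<open>
  With \<open>R(X,Y)Z = \<nabla>\<^sub>X \<nabla>\<^sub>Y Z - \<nabla>\<^sub>Y \<nabla>\<^sub>X Z - \<nabla>\<^bsub>[X,Y]\<^esub> Z\<close>, \<open>curvature_coeff h l i j k\<close> is the coefficient
  of \<open>\<partial>\<^sub>l\<close> in \<open>R(\<partial>\<^sub>i,\<partial>\<^sub>j)\<partial>\<^sub>k\<close>, and the Gauss curvature is \<open>\<langle>R(\<partial>\<^sub>1,\<partial>\<^sub>2)\<partial>\<^sub>2, \<partial>\<^sub>1\<rangle> / det h\<close>.
\<close>

definition curvature_coeff ::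
    "(real ^ 2 \<Rightarrow> real ^ 2 ^ 2) \<Rightarrow> 2 \<Rightarrow> 2 \<Rightarrow> 2 \<Rightarrow> 2 \<Rightarrow> real ^ 2 \<Rightarrow> real" where
  "curvature_coeff h l i j k x =
     pderiv2 i (christoffel h l j k) x - pderiv2 j (christoffel h l i k) x +
     (\<Sum>m\<in>UNIV. christoffel h m j k x * christoffel h l i m x
               - christoffel h m i k x * christoffel h l j m x)"

definition gauss_curvature_in_coords :: "(real ^ 2 \<Rightarrow> real ^ 2 ^ 2) \<Rightarrow> real ^ 2 \<Rightarrow> real" where
  "gauss_curvature_in_coords h x =
     (\<Sum>l\<in>UNIV. curvature_coeff h l 1 2 2 x * h x $ l $ 1) / Determinants.det (h x)"

text \<open>
  The Gauss curvature is the function on the surface with this coordinate expression in every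
  chart. It is unique because the charts cover the surface, and it exists because the coordinate
  expression is invariant under changes of charts.
\<close>

definition is_gauss_curvature ::
    "'a chart set \<Rightarrow> 'a metric_coeffs \<Rightarrow> ('a \<Rightarrow> real) \<Rightarrow> bool" where
  "is_gauss_curvature A g K \<longleftrightarrow>
     (\<forall>c\<in>A. \<forall>p\<in>fst c. K p = gauss_curvature_in_coords (g c) (snd c p))"


subsection \<open>Closed embedded geodesics\<close>

text \<open>
  A closed curve of length \<open>L\<close> is a curve on the whole line, parameterized by arc length, of
  period \<open>L\<close>; it is embedded if it is injective on one period.
\<close>

definition closed_embedded_geodesic ::
    "'a topology \<Rightarrow> 'a chart set \<Rightarrow> 'a metric_coeffs \<Rightarrow> real \<Rightarrow> (real \<Rightarrow> 'a) \<Rightarrow> bool" where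
  "closed_embedded_geodesic X A g L \<gamma> \<longleftrightarrow>
     0 < L \<and> (\<forall>s. \<gamma> (s + L) = \<gamma> s) \<and> inj_on \<gamma> {0..<L} \<and>
     continuous_map euclideanreal X \<gamma> \<and>
     (\<forall>c\<in>A. let S = {s. \<gamma> s \<in> fst c}; u = (\<lambda>k s. snd c (\<gamma> s) $ k) in
        smooth_on S (snd c \<circ> \<gamma>) \<and>
        (\<forall>s\<in>S.
           (\<Sum>i\<in>UNIV. \<Sum>j\<in>UNIV. g c (snd c (\<gamma> s)) $ i $ j * deriv (u i) s * deriv (u j) s) = 1 \<and>
           (\<forall>k. deriv (deriv (u k)) s +
              (\<Sum>i\<in>UNIV. \<Sum>j\<in>UNIV. christoffel (g c) k i j (snd c (\<gamma> s)) *
                 deriv (u i) s * deriv (u j) s) = 0)))"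


section \<open>Bouncing Jacobi fields\<close>

text \<open>
  From here on \<open>\<kappa> s\<close> is the Gauss curvature at the point of arc-length parameter \<open>s\<close>, and functions
  on the curve are functions on the line of period \<open>L\<close>.
\<close>

definition jacobi_operator :: "(real \<Rightarrow> real) \<Rightarrow> (real \<Rightarrow> real) \<Rightarrow> real \<Rightarrow> real" where
  "jacobi_operator \<kappa> f s = - (deriv (deriv f) s + \<kappa> s * f s)"

text \<open>The minimum points are \<open>s 1 < \<dots> < s n\<close>; the values of \<open>s\<close> at other indices are irrelevant.\<close>

definition bouncing_jacobi_field ::
    "(real \<Rightarrow> real) \<Rightarrow> real \<Rightarrow> nat \<Rightarrow> (real \<Rightarrow> real) \<Rightarrow> (nat \<Rightarrow> real) \<Rightarrow> bool" where
  "bouncing_jacobi_field \<kappa> L n \<Phi> s \<longleftrightarrow>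
     (\<forall>j\<in>{1..n}. 0 \<le> s j \<and> s j < L) \<and> strict_mono_on {1..n} s \<and>
     (\<forall>t. \<Phi> (t + L) = \<Phi> t) \<and> continuous_on UNIV \<Phi> \<and>
     (let G = - {s j + of_int m * L | j m. j \<in> {1..n}} in
        smooth_on G \<Phi> \<and> (\<forall>t\<in>G. jacobi_operator \<kappa> \<Phi> t = 0 \<and> \<Phi> t > 1)) \<and>
     (\<forall>j\<in>{1..n}. \<Phi> (s j) = 1 \<and>
        (\<exists>d>0. (deriv \<Phi> \<longlongrightarrow> d) (at_right (s j)) \<and> (deriv \<Phi> \<longlongrightarrow> - d) (at_left (s j))))"


subsection \<open>The space \<open>H\<^sup>1\<^sub>0\<close> of an open interval\<close>

definition test_function :: "real set \<Rightarrow> (real \<Rightarrow> real) \<Rightarrow> bool" where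
  "test_function I \<psi> \<longleftrightarrow>
     smooth_on UNIV \<psi> \<and> compact (closure {x. \<psi> x \<noteq> 0}) \<and> closure {x. \<psi> x \<noteq> 0} \<subseteq> I"

definition square_integrable_on :: "real set \<Rightarrow> (real \<Rightarrow> real) \<Rightarrow> bool" where
  "square_integrable_on I u \<longleftrightarrow>
     u \<in> borel_measurable (lebesgue_on I) \<and> integrable (lebesgue_on I) (\<lambda>x. (u x)\<^sup>2)"

definition weak_derivative_on :: "real set \<Rightarrow> (real \<Rightarrow> real) \<Rightarrow> (real \<Rightarrow> real) \<Rightarrow> bool" where
  "weak_derivative_on I u v \<longleftrightarrow>
     (\<forall>\<psi>. test_function I \<psi> \<longrightarrow>
        (LINT x|lebesgue_on I. u x * deriv \<psi> x) = - (LINT x|lebesgue_on I. v x * \<psi> x))"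

text \<open>
  \<open>H10 I u v\<close>: the function \<open>u\<close> belongs to \<open>H\<^sup>1\<^sub>0(I)\<close>, the closure of the test functions in \<open>H\<^sup>1(I)\<close>,
  and \<open>v\<close> is its weak derivative (unique up to null sets).
\<close>

definition H10 :: "real set \<Rightarrow> (real \<Rightarrow> real) \<Rightarrow> (real \<Rightarrow> real) \<Rightarrow> bool" where
  "H10 I u v \<longleftrightarrow>
     square_integrable_on I u \<and> square_integrable_on I v \<and> weak_derivative_on I u v \<and>
     (\<exists>\<psi>. (\<forall>k::nat. test_function I (\<psi> k)) \<and>
        (\<lambda>k. LINT x|lebesgue_on I. (\<psi> k x - u x)\<^sup>2 + (deriv (\<psi> k) x - v x)\<^sup>2) \<longlonglongrightarrow> 0)"


subsection \<open>The function \<open>H\<^sub>n\<close>\<close>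

text \<open>The infimum is \<open>-\<infinity>\<close> on intervals that are too long, hence the extended reals.\<close>

definition gap_energy :: "(real \<Rightarrow> real) \<Rightarrow> real \<Rightarrow> real \<Rightarrow> ereal" where
  "gap_energy \<kappa> a b =
     (INF (\<phi>, v) \<in> {(\<phi>, v). H10 {a<..<b} (\<lambda>x. \<phi> x - 1) v}.
        ereal (LINT x|lebesgue_on {a<..<b}. (v x)\<^sup>2 - \<kappa> x * (\<phi> x)\<^sup>2))"

definition Hn :: "(real \<Rightarrow> real) \<Rightarrow> real \<Rightarrow> nat \<Rightarrow> (nat \<Rightarrow> real) \<Rightarrow> ereal" where
  "Hn \<kappa> L n s =
     (\<Sum>j\<in>{1..n}. gap_energy \<kappa> (s j) (if j = n then s 1 + L else s (Suc j)))"


subsection \<open>Index and nullity\<close>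

definition partial_deriv :: "nat \<Rightarrow> ((nat \<Rightarrow> real) \<Rightarrow> real) \<Rightarrow> (nat \<Rightarrow> real) \<Rightarrow> real" where
  "partial_deriv i F s = deriv (\<lambda>t. F (s(i := t))) (s i)"

text \<open>Matrix indices start at \<open>0\<close>, those of the points at \<open>1\<close>.\<close>

definition hessian :: "nat \<Rightarrow> ((nat \<Rightarrow> real) \<Rightarrow> real) \<Rightarrow> (nat \<Rightarrow> real) \<Rightarrow> real mat" where
  "hessian n F s =
     Matrix.mat n n (\<lambda>(i, j). partial_deriv (Suc i) (partial_deriv (Suc j) F) s)"

text \<open>
  Near the minimum points of a bouncing Jacobi field \<open>Hn\<close> is finite, so that the conversion to the
  reals is harmless there.
\<close>

definition hessian_Hn :: "(real \<Rightarrow> real) \<Rightarrow> real \<Rightarrow> nat \<Rightarrow> (nat \<Rightarrow> real) \<Rightarrow> real mat" where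
  "hessian_Hn \<kappa> L n s = hessian n (\<lambda>s. real_of_ereal (Hn \<kappa> L n s)) s"

text \<open>Negative eigenvalues are counted with multiplicity.\<close>

definition bjf_index :: "(real \<Rightarrow> real) \<Rightarrow> real \<Rightarrow> nat \<Rightarrow> (nat \<Rightarrow> real) \<Rightarrow> nat" where
  "bjf_index \<kappa> L n s =
     (let A = hessian_Hn \<kappa> L n s in
        \<Sum>\<mu>\<in>{\<mu>. eigenvalue A \<mu> \<and> \<mu> < 0}. Polynomial.order \<mu> (char_poly A))"

definition bjf_nullity :: "(real \<Rightarrow> real) \<Rightarrow> real \<Rightarrow> nat \<Rightarrow> (nat \<Rightarrow> real) \<Rightarrow> nat" where
  "bjf_nullity \<kappa> L n s = kernel_dim (hessian_Hn \<kappa> L n s)"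

end

theory Submission
  imports Defs
    "Jordan_Normal_Form.Jordan_Normal_Form_Uniqueness"
    "Jordan_Normal_Form.Jordan_Normal_Form_Existence"
begin

no_notation Matrix.vec_index (infixl "$" 100)
no_notation Matrix.scalar_prod (infix "\<bullet>" 70)

text \<open>
  The bouncing field sits at a global maximum of \<open>H\<^sub>n\<close> over all cyclic configurations whose gaps contain
  no conjugate points; there the Hessian is negative semidefinite, so that nullity and index add up
  to \<open>n\<close>. Equidistant points are such a configuration by Sturm comparison. With a fundamental system
  \<open>C\<close>, \<open>S\<close> of \<open>u'' = - \<kappa> u\<close> and \<open>D a b = C a S b - S a C b\<close>, a gap has the energy
  \<open>E a b = (\<partial>\<^sub>2 D - \<partial>\<^sub>1 D - 2) / D\<close>. It is nonpositive and tends to \<open>-\<infinity>\<close> at the first conjugate point,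
  where \<open>\<partial>\<^sub>1 D \<partial>\<^sub>2 D = -1\<close>; hence the maximum is attained. Positive curvature makes the minimisers
  strictly concave, and inserting a point \<open>c\<close> into a gap raises the energy by
  \<open>(D a b - D a c - D c b)\<^sup>2 / (D a b D a c D c b) > 0\<close>, so that no two points coalesce. Finally
  \<open>\<partial>E/\<partial>a = (\<phi>' a)\<^sup>2 + \<kappa> a\<close> and \<open>\<partial>E/\<partial>b = - ((\<phi>' b)\<^sup>2 + \<kappa> b)\<close> for the minimiser \<open>\<phi>\<close>, so that
  criticality is the law of reflection.
\<close>

section \<open>Symmetric negative semidefinite matrices\<close>

text \<open>Two failures of compactness shape the proof. The set of configurations is closed only if
  points may coincide, and \<open>E\<close> is unbounded below near conjugate points. Both are tamed
  by the sign of \<open>E\<close>. As no gap contributes a positive energy, along a maximising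
  sequence every single gap energy stays bounded below, which excludes conjugate points in the
  limit; and where points coincide, \<open>E\<close> is 0, so only an upper bound on the nearby
  energies is needed. The Hessian differentiates infima over \<open>H10\<close>, not the explicit
  \<open>E\<close>, so the two must agree on a whole neighbourhood of the maximiser; this holds
  because having positive gaps without conjugate points is an open condition. Finally, the index
  counts algebraic multiplicities while the nullity is the dimension of a kernel. Their sum is
  \<open>n\<close> because the two kinds of multiplicity agree at 0 for symmetric matrices.\<close>

lemma mult_mat_vec_nth:
  assumes "A \<in> carrier_mat n n" "v \<in> carrier_vec n" "i < n"
  shows "vec_index (A *\<^sub>v v) i = (\<Sum>j<n. A $$ (i, j) * vec_index v j)"
  using assms by (auto simp: scalar_prod_def lessThan_atLeast0 intro!: sum.cong)

text \<open>For an eigenvector \<open>x\<close>, the Hermitian form of \<open>A\<close> at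
  \<open>x\<close> is its own conjugate by symmetry, and it is also \<open>z\<close> times the
  positive number |x|^2.\<close>

lemma symmetric_eigenvalue_real:
  fixes A :: "real mat"
  assumes A: "A \<in> carrier_mat n n"
    and sym: "\<forall>i<n. \<forall>j<n. A $$ (i, j) = A $$ (j, i)"
    and ev: "eigenvalue (map_mat complex_of_real A) z"
  shows "z \<in> \<real>"
proof -
  let ?B = "map_mat complex_of_real A"
  have B: "?B \<in> carrier_mat n n" using A by simp
  obtain v where v: "v \<in> carrier_vec n" "v \<noteq> 0\<^sub>v n" "?B *\<^sub>v v = z \<cdot>\<^sub>v v"
    using ev A unfolding eigenvalue_def eigenvector_def by auto
  define x where "x = vec_index v"
  have eq: "z * x i = (\<Sum>j<n. complex_of_real (A $$ (i, j)) * x j)" if "i < n" for i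
    using mult_mat_vec_nth[OF B v(1) that] v(1,3) A that by (simp add: x_def)
  obtain i0 where i0: "i0 < n" "x i0 \<noteq> 0"
    using v(1,2) unfolding x_def
    by (metis carrier_vecD eq_vecI index_zero_vec(1) index_zero_vec(2))
  define N where "N = (\<Sum>i<n. (cmod (x i))\<^sup>2)"
  have N: "N > 0"
    unfolding N_def using i0 by (intro sum_pos2[of _ i0]) auto
  define Q where "Q = (\<Sum>i<n. \<Sum>j<n. cnj (x i) * of_real (A $$ (i, j)) * x j)"
  have "cnj Q = (\<Sum>i<n. \<Sum>j<n. x i * of_real (A $$ (i, j)) * cnj (x j))"
    unfolding Q_def by simp
  also have "\<dots> = (\<Sum>j<n. \<Sum>i<n. x i * of_real (A $$ (i, j)) * cnj (x j))"
    by (rule sum.swap)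
  also have "\<dots> = Q"
    unfolding Q_def by (intro sum.cong refl) (simp add: sym mult.commute mult.left_commute)
  finally have Qr: "cnj Q = Q" .
  have "Q = (\<Sum>i<n. cnj (x i) * (z * x i))"
    unfolding Q_def by (intro sum.cong refl) (simp add: eq sum_distrib_left mult.assoc)
  also have "\<dots> = z * of_real N"
    unfolding N_def of_real_sum sum_distrib_left
    by (intro sum.cong refl) (simp only: complex_norm_square mult.commute mult.left_commute mult.assoc)
  finally have "z * of_real N = Q" by simp
  then have "cnj z * of_real N = z * of_real N"
    using Qr by (metis complex_cnj_complex_of_real complex_cnj_mult)
  then have "cnj z = z" using N by simp
  then show ?thesis by (simp add: Reals_cnj_iff)
qed

text \<open>The complex factorisation has only real roots, so it can be pulled back along the
  injective map of coefficients. This splitting is what gives a Jordan normal form over the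
  reals.\<close>

lemma symmetric_char_poly_splits:
  fixes A :: "real mat"
  assumes A: "A \<in> carrier_mat n n"
    and sym: "\<forall>i<n. \<forall>j<n. A $$ (i, j) = A $$ (j, i)"
  shows "\<exists>as. char_poly A = (\<Prod>a\<leftarrow>as. [:- a, 1:]) \<and> length as = n"
proof -
  let ?B = "map_mat complex_of_real A"
  have B: "?B \<in> carrier_mat n n" using A by simp
  obtain as where as: "char_poly ?B = (\<Prod>a\<leftarrow>as. [:- a, 1:])" "length as = n"
    using char_poly_factorized[OF B] by blast
  have re: "a \<in> \<real>" if "a \<in> set as" for a
  proof -
    have "poly (char_poly ?B) a = 0"
      unfolding as(1) poly_prod_list using that by (auto simp: prod_list_zero_iff)
    then have "eigenvalue ?B a" using eigenvalue_root_char_poly[OF B] by simp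
    then show ?thesis by (rule symmetric_eigenvalue_real[OF A sym])
  qed
  define bs where "bs = map Re as"
  have as_bs: "as = map complex_of_real bs"
    unfolding bs_def by (simp add: map_idI re)
  interpret h: map_poly_inj_idom_hom "of_real :: real \<Rightarrow> complex" ..
  have "map_poly complex_of_real (char_poly A) = char_poly ?B"
    using of_real_hom.char_poly_hom[OF A, where 'a=complex] by simp
  also have "\<dots> = map_poly complex_of_real (\<Prod>a\<leftarrow>bs. [:- a, 1:])"
    unfolding as(1) as_bs h.hom_prod_list by (simp add: o_def map_poly_pCons)
  finally have "char_poly A = (\<Prod>a\<leftarrow>bs. [:- a, 1:])" by (rule h.injectivity)
  moreover have "length bs = n" using as(2) by (simp add: bs_def)
  ultimately show ?thesis by blast
qed

lemma order_linear_factors: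
  fixes as :: "'a::field list"
  shows "Polynomial.order a (\<Prod>b\<leftarrow>as. [:- b, 1:]) = count_list as a"
proof (induction as)
  case (Cons b as)
  have "(\<Prod>b\<leftarrow>as. [:- b, 1:]) \<noteq> 0" by (auto simp: prod_list_zero_iff)
  then have "[:- b, 1:] * (\<Prod>b\<leftarrow>as. [:- b, 1:]) \<noteq> 0" by (subst mult_eq_0_iff) auto
  from order_mult[OF this, of a] show ?case
    using Cons by (simp only: list.map prod_list.Cons) (simp add: order_linear')
qed simp

text \<open>If \<open>A (A v) = 0\<close>, then |A v|^2 = <v, A (A v)> = 0. In terms of the Jordan
  form: no block at 0 has size above 1.\<close>

lemma symmetric_kernel_square:
  fixes A :: "real mat"
  assumes A: "A \<in> carrier_mat n n"
    and sym: "\<forall>i<n. \<forall>j<n. A $$ (i, j) = A $$ (j, i)"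
  shows "mat_kernel (A * A) = mat_kernel A"
proof
  show "mat_kernel A \<subseteq> mat_kernel (A * A)"
    by (rule mat_kernel_mult_subset[OF A A])
  show "mat_kernel (A * A) \<subseteq> mat_kernel A"
  proof
    fix v assume "v \<in> mat_kernel (A * A)"
    then have v: "v \<in> carrier_vec n" and z: "A *\<^sub>v (A *\<^sub>v v) = 0\<^sub>v n"
      using mat_kernelD[of "A * A" n n v] A by auto
    define w where "w = A *\<^sub>v v"
    have w: "w \<in> carrier_vec n" unfolding w_def by (rule mult_mat_vec_carrier[OF A v])
    have wi: "vec_index w i = (\<Sum>j<n. A $$ (i, j) * vec_index v j)" if "i < n" for i
      unfolding w_def by (rule mult_mat_vec_nth[OF A v that])
    have zi: "(\<Sum>j<n. A $$ (i, j) * vec_index w j) = 0" if "i < n" for i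
      using mult_mat_vec_nth[OF A w that] z that by (simp add: w_def)
    have "(\<Sum>i<n. (vec_index w i)\<^sup>2) = (\<Sum>i<n. \<Sum>j<n. vec_index w i * (A $$ (i, j) * vec_index v j))"
      by (intro sum.cong refl) (simp add: power2_eq_square wi sum_distrib_left)
    also have "\<dots> = (\<Sum>j<n. \<Sum>i<n. vec_index w i * (A $$ (i, j) * vec_index v j))"
      by (rule sum.swap)
    also have "\<dots> = (\<Sum>j<n. vec_index v j * (\<Sum>i<n. A $$ (j, i) * vec_index w i))"
      by (intro sum.cong refl) (simp add: sum_distrib_left sym mult.commute mult.left_commute)
    also have "\<dots> = 0" by (simp add: zi)
    finally have "vec_index w i = 0" if "i < n" for i
      using that by (simp add: sum_nonneg_eq_0_iff)
    then have "w = 0\<^sub>v n" using w by auto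
    then show "v \<in> mat_kernel A"
      using v A unfolding w_def by (intro mat_kernelI[OF A])
  qed
qed

text \<open>Geometric against algebraic multiplicity of 0. If \<open>m\<close> runs over the sizes
  of the Jordan blocks at 0, the kernels of \<open>A\<close> and \<open>A * A\<close> have the
  dimensions sum of \<open>min 1 m\<close> and sum of \<open>min 2 m\<close>; their equality forces
  every \<open>m\<close> to be at most 1.\<close>

lemma symmetric_kernel_dim_eq_order:
  fixes A :: "real mat"
  assumes A: "A \<in> carrier_mat n n"
    and sym: "\<forall>i<n. \<forall>j<n. A $$ (i, j) = A $$ (j, i)"
  shows "kernel_dim A = Polynomial.order 0 (char_poly A)"
proof -
  obtain n_as where jnf: "jordan_nf A n_as"
    using symmetric_char_poly_splits[OF A sym] jordan_nf_exists[OF A] by blast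
  define ms where "ms = map fst [(n, e)\<leftarrow>n_as . e = 0]"
  have cm: "char_matrix A 0 = A"
    unfolding char_matrix_def using A by (intro eq_matI) auto
  have "dim_gen_eigenspace A 0 1 = kernel_dim A"
    unfolding dim_gen_eigenspace_def cm using A by (simp add: numeral_2_eq_2)
  then have k1: "kernel_dim A = (\<Sum>m\<leftarrow>ms. min 1 m)"
    using dim_gen_eigenspace[OF jnf, of 0 1] by (simp add: ms_def)
  have "dim_gen_eigenspace A 0 2 = kernel_dim (A * A)"
    unfolding dim_gen_eigenspace_def cm using A by (simp add: numeral_2_eq_2)
  also have "\<dots> = kernel_dim A"
    unfolding kernel_dim_def using A symmetric_kernel_square[OF A sym] by simp
  finally have eq12: "(\<Sum>m\<leftarrow>ms. min 2 m) = (\<Sum>m\<leftarrow>ms. min 1 m)"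
    using k1 dim_gen_eigenspace[OF jnf, of 0 2] by (simp add: ms_def)
  have small: "(\<Sum>m\<leftarrow>ms. min 1 m) = sum_list ms"
    if "(\<Sum>m\<leftarrow>ms. min 2 m) = (\<Sum>m\<leftarrow>ms. min 1 m)" for ms :: "nat list"
    using that
  proof (induction ms)
    case (Cons m ms)
    have "(\<Sum>m\<leftarrow>ms. min 1 m) \<le> (\<Sum>m\<leftarrow>ms. min 2 m)"
      by (intro sum_list_mono) auto
    then show ?case using Cons by (simp add: min_def split: if_splits)
  qed simp
  have "kernel_dim A = sum_list ms" unfolding k1 by (rule small[OF eq12])
  also have "\<dots> = Polynomial.order 0 (char_poly A)"
    unfolding jordan_nf_order[OF jnf] ms_def
    by (intro arg_cong[where f = sum_list] arg_cong[where f = "map fst"] filter_cong) auto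
  finally show ?thesis .
qed

text \<open>There are \<open>n\<close> real roots with multiplicity, none positive by the Rayleigh
  quotient. The root 0 is counted by the nullity, the others by the sum.\<close>

lemma negative_semidefinite_nullity_plus_index:
  fixes A :: "real mat"
  assumes A: "A \<in> carrier_mat n n"
    and sym: "\<forall>i<n. \<forall>j<n. A $$ (i, j) = A $$ (j, i)"
    and neg: "\<And>x. (\<Sum>i<n. \<Sum>j<n. x i * A $$ (i, j) * x j) \<le> 0"
  shows "kernel_dim A + (\<Sum>\<mu>\<in>{\<mu>. eigenvalue A \<mu> \<and> \<mu> < 0}. Polynomial.order \<mu> (char_poly A)) = n"
proof -
  obtain as where as: "char_poly A = (\<Prod>a\<leftarrow>as. [:- a, 1:])" "length as = n"
    using symmetric_char_poly_splits[OF A sym] by blast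
  have ev: "eigenvalue A \<mu> \<longleftrightarrow> \<mu> \<in> set as" for \<mu>
    unfolding eigenvalue_root_char_poly[OF A] as(1) poly_prod_list
    by (auto simp: prod_list_zero_iff)
  have le: "\<mu> \<le> 0" if e: "eigenvalue A \<mu>" for \<mu>
  proof -
    obtain v where v: "v \<in> carrier_vec n" "v \<noteq> 0\<^sub>v n" "A *\<^sub>v v = \<mu> \<cdot>\<^sub>v v"
      using e A unfolding eigenvalue_def eigenvector_def by auto
    define x where "x = vec_index v"
    have eq: "\<mu> * x i = (\<Sum>j<n. A $$ (i, j) * x j)" if "i < n" for i
      using mult_mat_vec_nth[OF A v(1) that] v(1,3) that by (simp add: x_def)
    obtain i0 where i0: "i0 < n" "x i0 \<noteq> 0"
      using v(1,2) unfolding x_def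
      by (metis carrier_vecD eq_vecI index_zero_vec(1) index_zero_vec(2))
    have N: "(\<Sum>i<n. (x i)\<^sup>2) > 0" using i0 by (intro sum_pos2[of _ i0]) auto
    have "(\<Sum>i<n. \<Sum>j<n. x i * A $$ (i, j) * x j) = (\<Sum>i<n. x i * (\<mu> * x i))"
      by (intro sum.cong refl) (simp add: eq sum_distrib_left mult.assoc)
    also have "\<dots> = \<mu> * (\<Sum>i<n. (x i)\<^sup>2)"
      by (simp add: sum_distrib_left power2_eq_square mult.commute mult.left_commute)
    finally show ?thesis using neg[of x] N by (simp add: mult_le_0_iff)
  qed
  have "(\<Sum>\<mu>\<in>set as. count_list as \<mu>) = n"
    using sum_count_set[of as "set as"] as(2) by simp
  moreover have "(\<Sum>\<mu>\<in>set as. count_list as \<mu>)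
      = (\<Sum>\<mu>\<in>set as \<inter> {\<mu>. \<mu> < 0}. count_list as \<mu>) + (\<Sum>\<mu>\<in>set as - {\<mu>. \<mu> < 0}. count_list as \<mu>)"
    by (rule sum.Int_Diff) simp
  moreover have "set as - {\<mu>. \<mu> < 0} = set as \<inter> {0}"
    using le ev by force
  moreover have "(\<Sum>\<mu>\<in>set as \<inter> {0}. count_list as \<mu>) = count_list as 0"
    by (cases "0 \<in> set as") auto
  moreover have "set as \<inter> {\<mu>. \<mu> < 0} = {\<mu>. eigenvalue A \<mu> \<and> \<mu> < 0}"
    using ev by auto
  ultimately show ?thesis
    using symmetric_kernel_dim_eq_order[OF A sym] by (simp add: as(1) order_linear_factors)
qed


section \<open>Calculus of smooth functions\<close>

lemma times_differentiable_cong: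
  assumes "open S" "\<And>x. x \<in> S \<Longrightarrow> f x = g x" "times_differentiable_on k S f"
  shows "times_differentiable_on k S g"
  using assms(2,3)
proof (induction k arbitrary: f g)
  case 0
  then show ?case using continuous_on_cong by fastforce
next
  case (Suc k)
  have d: "(g has_derivative frechet_derivative f (at x)) (at x)" if "x \<in> S" for x
  proof (rule has_derivative_transform_within_open[OF _ \<open>open S\<close> that])
    show "(f has_derivative frechet_derivative f (at x)) (at x)"
      using Suc.prems(2) that by (simp add: frechet_derivative_works[symmetric])
  qed (use Suc.prems(1) in auto)
  have e: "frechet_derivative g (at x) = frechet_derivative f (at x)" if "x \<in> S" for x
    using frechet_derivative_at[OF d[OF that]] by simp
  show ?case
    unfolding times_differentiable_on.simps
  proof (intro conjI ballI allI)
    show "g differentiable at x" if "x \<in> S" for x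
      using d[OF that] by (auto simp: differentiable_def)
    show "times_differentiable_on k S (\<lambda>x. frechet_derivative g (at x) v)" for v
      by (rule Suc.IH[of "\<lambda>x. frechet_derivative f (at x) v"]) (use e Suc.prems(2) in auto)
  qed
qed

lemma times_differentiable_SucI:
  assumes "open S" "\<And>x. x \<in> S \<Longrightarrow> (f has_derivative f' x) (at x)"
    and "\<And>v. times_differentiable_on k S (\<lambda>x. f' x v)"
  shows "times_differentiable_on (Suc k) S f"
  unfolding times_differentiable_on.simps
proof (intro conjI ballI allI)
  show "f differentiable at x" if "x \<in> S" for x
    using assms(2)[OF that] by (auto simp: differentiable_def)
  show "times_differentiable_on k S (\<lambda>x. frechet_derivative f (at x) v)" for v
    by (rule times_differentiable_cong[OF \<open>open S\<close> _ assms(3)[of v]])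
       (metis assms(2) frechet_derivative_at)
qed

lemma times_differentiable_SucD:
  assumes "times_differentiable_on (Suc k) S f"
  shows "\<And>x. x \<in> S \<Longrightarrow> (f has_derivative frechet_derivative f (at x)) (at x)"
    and "\<And>v. times_differentiable_on k S (\<lambda>x. frechet_derivative f (at x) v)"
  using assms by (auto simp: frechet_derivative_works[symmetric])

lemma times_differentiable_Suc_imp:
  "times_differentiable_on (Suc k) S f \<Longrightarrow> times_differentiable_on k S f"
proof (induction k arbitrary: f)
  case 0
  then show ?case
    by (auto intro!: continuous_at_imp_continuous_on differentiable_imp_continuous_within)
next
  case (Suc k)
  then show ?case by (metis times_differentiable_on.simps(2))
qed

lemma times_differentiable_const: "open S \<Longrightarrow> times_differentiable_on k S (\<lambda>_. c)"
proof (induction k arbitrary: c)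
  case (Suc k)
  show ?case
    by (rule times_differentiable_SucI[where f' = "\<lambda>_ _. 0"]) (use Suc in auto)
qed simp

lemma times_differentiable_bounded_linear:
  assumes "open S" "bounded_linear h" "times_differentiable_on k S f"
  shows "times_differentiable_on k S (\<lambda>x. h (f x))"
  using assms(3)
proof (induction k arbitrary: f)
  case 0
  then show ?case by (simp add: bounded_linear.continuous_on[OF assms(2)])
next
  case (Suc k)
  show ?case
  proof (rule times_differentiable_SucI[OF \<open>open S\<close>])
    show "((\<lambda>x. h (f x)) has_derivative (\<lambda>v. h (frechet_derivative f (at x) v))) (at x)"
      if "x \<in> S" for x
      by (rule bounded_linear.has_derivative[OF assms(2) times_differentiable_SucD(1)[OF Suc.prems that]])
  qed (rule Suc.IH[OF times_differentiable_SucD(2)[OF Suc.prems]])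
qed

lemma times_differentiable_add:
  assumes "open S" "times_differentiable_on k S f" "times_differentiable_on k S g"
  shows "times_differentiable_on k S (\<lambda>x. f x + g x)"
  using assms(2,3)
proof (induction k arbitrary: f g)
  case 0
  then show ?case by (auto intro: continuous_intros)
next
  case (Suc k)
  show ?case
    by (rule times_differentiable_SucI[OF \<open>open S\<close> has_derivative_add[OF times_differentiable_SucD(1)[OF Suc.prems(1)] times_differentiable_SucD(1)[OF Suc.prems(2)]]
        Suc.IH[OF times_differentiable_SucD(2)[OF Suc.prems(1)] times_differentiable_SucD(2)[OF Suc.prems(2)]]])
qed

lemma times_differentiable_sum:
  assumes "open S" "finite I" "\<And>i. i \<in> I \<Longrightarrow> times_differentiable_on k S (f i)"
  shows "times_differentiable_on k S (\<lambda>x. \<Sum>i\<in>I. f i x)"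
  using assms(2,3) by (induction I rule: finite_induct) (auto intro: times_differentiable_add times_differentiable_const assms(1))

lemma times_differentiable_mult:
  fixes f g :: "'a::real_normed_vector \<Rightarrow> real"
  assumes "open S" "times_differentiable_on k S f" "times_differentiable_on k S g"
  shows "times_differentiable_on k S (\<lambda>x. f x * g x)"
  using assms(2,3)
proof (induction k arbitrary: f g)
  case 0
  then show ?case by (auto intro: continuous_intros)
next
  case (Suc k)
  show ?case
  proof (rule times_differentiable_SucI[OF \<open>open S\<close>])
    show "((\<lambda>x. f x * g x) has_derivative
        (\<lambda>v. f x * frechet_derivative g (at x) v + frechet_derivative f (at x) v * g x)) (at x)"
      if "x \<in> S" for x
      by (rule has_derivative_mult[OF times_differentiable_SucD(1)[OF Suc.prems(1) that] times_differentiable_SucD(1)[OF Suc.prems(2) that]])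
  qed (intro times_differentiable_add[OF \<open>open S\<close>] Suc.IH times_differentiable_SucD(2)[OF Suc.prems(1)] times_differentiable_SucD(2)[OF Suc.prems(2)]
      times_differentiable_Suc_imp[OF Suc.prems(1)] times_differentiable_Suc_imp[OF Suc.prems(2)])
qed

lemma times_differentiable_uminus:
  fixes f :: "'a::real_normed_vector \<Rightarrow> real"
  assumes "open S" "times_differentiable_on k S f"
  shows "times_differentiable_on k S (\<lambda>x. - f x)"
  using times_differentiable_bounded_linear[OF assms(1) bounded_linear_minus[OF bounded_linear_ident] assms(2)] .

lemma times_differentiable_diff:
  fixes f g :: "'a::real_normed_vector \<Rightarrow> real"
  assumes "open S" "times_differentiable_on k S f" "times_differentiable_on k S g"
  shows "times_differentiable_on k S (\<lambda>x. f x - g x)"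
  using times_differentiable_add[OF assms(1,2) times_differentiable_uminus[OF assms(1,3)]] by simp

lemma times_differentiable_inverse:
  fixes f :: "'a::real_normed_vector \<Rightarrow> real"
  assumes "open S" "\<And>x. x \<in> S \<Longrightarrow> f x \<noteq> 0" "times_differentiable_on k S f"
  shows "times_differentiable_on k S (\<lambda>x. inverse (f x))"
  using assms(3)
proof (induction k)
  case 0
  then show ?case using assms(2) by (auto intro: continuous_intros)
next
  case (Suc k)
  show ?case
  proof (rule times_differentiable_SucI[OF \<open>open S\<close>])
    show "((\<lambda>x. inverse (f x)) has_derivative
        (\<lambda>v. - (inverse (f x) * frechet_derivative f (at x) v * inverse (f x)))) (at x)"
      if "x \<in> S" for x
      by (rule Deriv.has_derivative_inverse[OF assms(2)[OF that] times_differentiable_SucD(1)[OF Suc.prems that]])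
  qed (intro times_differentiable_uminus times_differentiable_mult times_differentiable_SucD(2)[OF Suc.prems] Suc.IH times_differentiable_Suc_imp[OF Suc.prems] \<open>open S\<close>)
qed

lemma times_differentiable_divide:
  fixes f g :: "'a::real_normed_vector \<Rightarrow> real"
  assumes "open S" "\<And>x. x \<in> S \<Longrightarrow> g x \<noteq> 0" "times_differentiable_on k S f" "times_differentiable_on k S g"
  shows "times_differentiable_on k S (\<lambda>x. f x / g x)"
  unfolding divide_inverse by (intro times_differentiable_mult times_differentiable_inverse assms)

text \<open>The induction hypothesis concerns derivatives of \<open>f\<close> in a fixed direction,
  whereas the chain rule differentiates in the direction given by the derivative of
  \<open>c\<close>, which moves with \<open>x\<close>. Expanding that direction in the basis yields
  products of coordinates with derivatives in fixed directions.\<close>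

lemma times_differentiable_compose:
  fixes f :: "'b::euclidean_space \<Rightarrow> real" and c :: "'a::real_normed_vector \<Rightarrow> 'b"
  assumes "open S" "c ` S \<subseteq> U"
    and "times_differentiable_on k S c" "times_differentiable_on k U f"
  shows "times_differentiable_on k S (\<lambda>x. f (c x))"
  using assms(3,4)
proof (induction k arbitrary: f)
  case 0
  then show ?case using assms(2) by (auto intro: continuous_on_compose2)
next
  case (Suc k)
  let ?f = "\<lambda>y. frechet_derivative f (at y)" and ?c = "\<lambda>x. frechet_derivative c (at x)"
  show ?case
  proof (rule times_differentiable_SucI[OF \<open>open S\<close>])
    fix x assume x: "x \<in> S"
    then have "c x \<in> U" using assms(2) by auto
    then have df: "(f has_derivative ?f (c x)) (at (c x))" using times_differentiable_SucD(1)[OF Suc.prems(2)] by simp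
    have "((\<lambda>x. f (c x)) has_derivative (\<lambda>v. ?f (c x) (?c x v))) (at x)"
      using diff_chain_at[OF times_differentiable_SucD(1)[OF Suc.prems(1) x] df] by (simp add: o_def)
    moreover have "?f (c x) (?c x v) = (\<Sum>i\<in>Basis. (?c x v \<bullet> i) * ?f (c x) i)" for v
    proof -
      have l: "linear (?f (c x))" using df has_derivative_linear by blast
      have "?f (c x) (\<Sum>i\<in>Basis. (?c x v \<bullet> i) *\<^sub>R i) = (\<Sum>i\<in>Basis. (?c x v \<bullet> i) * ?f (c x) i)"
        by (simp add: linear_sum[OF l] linear_scale[OF l])
      then show ?thesis by (simp add: euclidean_representation)
    qed
    ultimately show "((\<lambda>x. f (c x)) has_derivative (\<lambda>v. \<Sum>i\<in>Basis. (?c x v \<bullet> i) * ?f (c x) i)) (at x)"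
      by simp
  next
    show "times_differentiable_on k S (\<lambda>x. \<Sum>i\<in>Basis. (?c x v \<bullet> i) * ?f (c x) i)" for v
      by (intro times_differentiable_sum times_differentiable_mult \<open>open S\<close> finite_Basis Suc.IH times_differentiable_SucD(2)[OF Suc.prems(2)]
          times_differentiable_Suc_imp[OF Suc.prems(1)]
          times_differentiable_bounded_linear[OF \<open>open S\<close> bounded_linear_inner_left times_differentiable_SucD(2)[OF Suc.prems(1)]])
  qed
qed

lemma times_differentiable_subset:
  "T \<subseteq> S \<Longrightarrow> times_differentiable_on k S f \<Longrightarrow> times_differentiable_on k T f"
  by (induction k arbitrary: f) (auto intro: continuous_on_subset)

text \<open>Allows smoothness to be checked chart by chart along the geodesic, and gap by gap for
  the glued field.\<close>

lemma times_differentiable_local: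
  assumes "\<And>x. x \<in> S \<Longrightarrow> \<exists>U. open U \<and> x \<in> U \<and> times_differentiable_on k U f"
  shows "times_differentiable_on k S f"
  using assms
proof (induction k arbitrary: f)
  case 0
  show ?case
    unfolding times_differentiable_on.simps
  proof (rule continuous_at_imp_continuous_on, rule)
    fix x assume "x \<in> S"
    then obtain U where "open U" "x \<in> U" "continuous_on U f" using 0 by auto
    then show "isCont f x" using continuous_on_eq_continuous_at by blast
  qed
next
  case (Suc k)
  then show ?case
    unfolding times_differentiable_on.simps by meson
qed

lemma times_differentiable_real_SucI:
  fixes f :: "real \<Rightarrow> real"
  assumes "open S" "\<And>x. x \<in> S \<Longrightarrow> (f has_real_derivative f' x) (at x)"
    and "times_differentiable_on k S f'"
  shows "times_differentiable_on (Suc k) S f"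
  by (rule times_differentiable_SucI[OF assms(1) assms(2)[unfolded has_field_derivative_def]])
     (auto intro!: times_differentiable_mult[OF assms(1)] times_differentiable_const[OF assms(1)] assms(3))

lemma times_differentiable_real_SucD:
  fixes f :: "real \<Rightarrow> real"
  assumes "open S" "times_differentiable_on (Suc k) S f"
  shows "\<And>x. x \<in> S \<Longrightarrow> (f has_real_derivative deriv f x) (at x)"
    and "times_differentiable_on k S (deriv f)"
proof -
  show d: "(f has_real_derivative deriv f x) (at x)" if "x \<in> S" for x
    using assms(2) that
    by (simp add: DERIV_deriv_iff_real_differentiable)
  show "times_differentiable_on k S (deriv f)"
  proof (rule times_differentiable_cong[OF \<open>open S\<close> _ times_differentiable_SucD(2)[OF assms(2), of 1]])
    fix x assume "x \<in> S"
    from frechet_derivative_at[OF d[OF this, unfolded has_field_derivative_def]]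
    show "frechet_derivative f (at x) 1 = deriv f x" by (metis mult.right_neutral)
  qed
qed

lemma smooth_on_imp_times_differentiable: "smooth_on S f \<Longrightarrow> times_differentiable_on k S f"
  by (simp add: smooth_on_def)

lemma smooth_on_continuous: "smooth_on S f \<Longrightarrow> continuous_on S f"
  using smooth_on_imp_times_differentiable[of S f 0] by simp

lemma smooth_on_deriv:
  fixes f :: "real \<Rightarrow> real"
  assumes "open S" "smooth_on S f"
  shows "smooth_on S (deriv f)" "\<And>x. x \<in> S \<Longrightarrow> (f has_real_derivative deriv f x) (at x)"
  using times_differentiable_real_SucD[OF assms(1) smooth_on_imp_times_differentiable[OF assms(2)]] by (auto simp: smooth_on_def)


section \<open>The curvature along a geodesic is smooth\<close>

lemma times_differentiable_pderiv2:
  assumes "smooth_on U f"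
  shows "times_differentiable_on k U (pderiv2 i f)"
  unfolding pderiv2_def using times_differentiable_SucD(2)[OF smooth_on_imp_times_differentiable[OF assms]] .

lemma smooth_on_nth:
  assumes "open U" "smooth_on U h"
  shows "smooth_on U (\<lambda>x. h x $ i)"
  unfolding smooth_on_def
  using times_differentiable_bounded_linear[OF assms(1) bounded_linear_vec_nth smooth_on_imp_times_differentiable[OF assms(2)]] by blast

text \<open>\<open>matrix_inv\<close> is defined by choice. The adjugate formula exhibits its
  entries as rational functions of those of \<open>A\<close>, so that the Christoffel symbols are
  smooth.\<close>

lemma matrix_inv_2:
  fixes A :: "real^2^2"
  assumes "Determinants.det A \<noteq> 0"
  shows "matrix_inv A $ k $ l =
    (if k = l then A $ (if k = 1 then 2 else 1) $ (if k = 1 then 2 else 1) else - A $ k $ l) / Determinants.det A"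
proof -
  define d where "d = Determinants.det A"
  have d: "A $ 1 $ 1 * A $ 2 $ 2 - A $ 1 $ 2 * A $ 2 $ 1 = d"
    by (simp add: d_def det_2)
  define B :: "real^2^2" where
    "B = (\<chi> k l. (if k = l then A $ (if k = 1 then 2 else 1) $ (if k = 1 then 2 else 1) else - A $ k $ l) / d)"
  have "d \<noteq> 0" using assms by (simp add: d_def)
  then have "A ** B = mat 1"
    unfolding B_def
    by (simp add: matrix_matrix_mult_def mat_def vec_eq_iff forall_2 sum_2 diff_divide_distrib[symmetric]
        add_divide_distrib[symmetric] d mult.commute)
  then have "B ** A = mat 1" by (simp add: matrix_left_right_inverse)
  with \<open>A ** B = mat 1\<close> have "A ** matrix_inv A = mat 1 \<and> matrix_inv A ** A = mat 1"
    unfolding matrix_inv_def by (metis (mono_tags, lifting) someI_ex)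
  then have "matrix_inv A = B"
    using \<open>A ** B = mat 1\<close> by (metis matrix_mul_assoc matrix_mul_lid matrix_mul_rid)
  then show ?thesis by (simp add: B_def d_def)
qed

lemma pos_def_det_nz:
  fixes A :: "real^2^2"
  assumes "\<And>v. v \<noteq> 0 \<Longrightarrow> v \<bullet> (A *v v) > 0"
  shows "Determinants.det A \<noteq> 0"
proof
  assume "Determinants.det A = 0"
  then obtain v where "v \<noteq> 0" "A *v v = 0"
    by (metis invertible_det_nz invertible_left_inverse matrix_left_invertible_ker)
  then show False using assms[of v] by simp
qed

lemma smooth_on_gauss_curvature_in_coords:
  assumes "open U" "smooth_on U h" and nz: "\<And>x. x \<in> U \<Longrightarrow> Determinants.det (h x) \<noteq> 0"
  shows "smooth_on U (gauss_curvature_in_coords h)"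
proof -
  have h: "smooth_on U (\<lambda>x. h x $ i $ j)" for i j
    by (rule smooth_on_nth[OF assms(1) smooth_on_nth[OF assms(1,2)]])
  note td_h = smooth_on_imp_times_differentiable[OF h]
  have det: "times_differentiable_on k U (\<lambda>x. Determinants.det (h x))" for k
    unfolding det_2 by (intro times_differentiable_diff times_differentiable_mult td_h assms(1))
  have inv: "times_differentiable_on k U (\<lambda>x. matrix_inv (h x) $ i $ j)" for k i j
  proof (rule times_differentiable_cong[OF assms(1) matrix_inv_2[OF nz, symmetric]])
    show "times_differentiable_on k U (\<lambda>x. (if i = j then h x $ (if i = 1 then 2 else 1) $
        (if i = 1 then 2 else 1) else - h x $ i $ j) / Determinants.det (h x))"
      by (cases "i = j") (auto intro!: times_differentiable_divide times_differentiable_uminus td_h nz det assms(1))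
  qed
  have chr: "smooth_on U (christoffel h k i j)" for k i j
    unfolding smooth_on_def christoffel_def
    by (intro allI times_differentiable_mult times_differentiable_const times_differentiable_sum finite times_differentiable_add times_differentiable_diff inv times_differentiable_pderiv2 h assms(1))
  have "smooth_on U (curvature_coeff h l i j k)" for l i j k
    unfolding smooth_on_def curvature_coeff_def
    by (intro allI times_differentiable_mult times_differentiable_sum finite times_differentiable_add times_differentiable_diff times_differentiable_pderiv2 chr smooth_on_imp_times_differentiable[OF chr] assms(1))
  then show ?thesis
    unfolding smooth_on_def gauss_curvature_in_coords_def
    by (intro allI times_differentiable_divide times_differentiable_sum finite times_differentiable_mult td_h nz det assms(1)) (simp_all add: smooth_on_def)
qed

text \<open>In a chart the function is the coordinate expression of the curvature composed with the
  coordinate curve. Positive definiteness of the metric keeps the determinant in the denominator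
  away from 0.\<close>

lemma smooth_on_curvature_along_geodesic:
  assumes R: "compact_riemannian_surface X A g" and K: "is_gauss_curvature A g K"
    and \<gamma>: "closed_embedded_geodesic X A g L \<gamma>"
  shows "smooth_on UNIV (K \<circ> \<gamma>)"
  unfolding smooth_on_def
proof (intro allI times_differentiable_local)
  fix k s
  have cont: "continuous_map euclideanreal X \<gamma>"
    using \<gamma> unfolding closed_embedded_geodesic_def by blast
  have top: "topspace X = (\<Union>c\<in>A. fst c)"
    using R unfolding compact_riemannian_surface_def smooth_surface_def by blast
  have "\<gamma> s \<in> topspace X"
    using cont by (auto simp: continuous_map_def)
  then obtain c where c: "c \<in> A" "\<gamma> s \<in> fst c" using top by auto
  have "openin X (fst c)" and U: "open (snd c ` fst c)"
    using R c unfolding compact_riemannian_surface_def smooth_surface_def by auto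
  define S where "S = {s. \<gamma> s \<in> fst c}"
  have S: "open S"
    using openin_continuous_map_preimage[OF cont \<open>openin X (fst c)\<close>] by (simp add: S_def)
  have sm: "smooth_on S (snd c \<circ> \<gamma>)"
    using \<gamma> c unfolding closed_embedded_geodesic_def Let_def S_def by blast
  have rm: "riemannian_metric A g"
    using R unfolding compact_riemannian_surface_def by blast
  have g: "smooth_on (snd c ` fst c) (g c)"
    "\<And>x v. x \<in> snd c ` fst c \<Longrightarrow> v \<noteq> 0 \<Longrightarrow> v \<bullet> (g c x *v v) > 0"
    using rm c unfolding riemannian_metric_def by blast+
  have "smooth_on (snd c ` fst c) (gauss_curvature_in_coords (g c))"
    by (rule smooth_on_gauss_curvature_in_coords[OF U g(1) pos_def_det_nz[OF g(2)]])
  then have "times_differentiable_on k S (\<lambda>s. gauss_curvature_in_coords (g c) ((snd c \<circ> \<gamma>) s))"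
    by (intro times_differentiable_compose[OF S, of _ "snd c ` fst c"] smooth_on_imp_times_differentiable sm) (auto simp: S_def)
  then have "times_differentiable_on k S (K \<circ> \<gamma>)"
    by (rule times_differentiable_cong[OF S, rotated]) (use K c in \<open>auto simp: is_gauss_curvature_def S_def\<close>)
  then show "\<exists>U. open U \<and> s \<in> U \<and> times_differentiable_on k U (K \<circ> \<gamma>)"
    using S c by (auto simp: S_def)
qed


section \<open>Smooth cutoff functions\<close>

text \<open>The powers of 1/x make the family closed under differentiation up to linear
  combinations, so that one induction on the order, with \<open>k\<close> arbitrary, proves all
  members smooth.\<close>

definition flat_exp :: "nat \<Rightarrow> real \<Rightarrow> real" where
  "flat_exp k x = (if 0 < x then exp (- inverse x) * inverse x ^ k else 0)"

lemma flat_exp_tendsto: "(flat_exp k \<longlongrightarrow> 0) (at 0)"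
proof (rule filterlim_split_at)
  have "\<forall>\<^sub>F x in at_left 0. flat_exp k x = 0"
    by (auto simp: eventually_at_filter flat_exp_def)
  then show "(flat_exp k \<longlongrightarrow> 0) (at_left 0)"
    by (simp add: tendsto_eventually)
  show "(flat_exp k \<longlongrightarrow> 0) (at_right 0)"
    unfolding filterlim_at_right_to_top
  proof (rule Lim_transform_eventually[OF tendsto_power_div_exp_0[of k]])
    show "\<forall>\<^sub>F x in at_top. x ^ k / exp x = flat_exp k (inverse x)"
      using eventually_gt_at_top[of 0]
      by eventually_elim (simp add: flat_exp_def exp_minus divide_inverse mult.commute)
  qed
qed

lemma flat_exp_has_derivative:
  "(flat_exp k has_real_derivative flat_exp (k + 2) x - of_nat k * flat_exp (k + 1) x) (at x)"
proof -
  consider "x < 0" | "x = 0" | "0 < x" by linarith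
  then show ?thesis
  proof cases
    case 1
    have "((\<lambda>_. 0) has_real_derivative flat_exp (k + 2) x - of_nat k * flat_exp (k + 1) x) (at x)"
      using 1 by (simp add: flat_exp_def)
    then show ?thesis
      by (rule has_field_derivative_transform_within_open[of _ _ _ "{..<0}"])
         (use 1 in \<open>auto simp: flat_exp_def\<close>)
  next
    case 2
    \<comment> \<open>The difference quotient of \<open>flat_exp k\<close> at 0 is
      \<open>flat_exp (Suc k)\<close>.\<close>
    have "((\<lambda>h. (flat_exp k (0 + h) - flat_exp k 0) / h) \<longlongrightarrow> 0) (at 0)"
      by (rule Lim_transform_eventually[OF flat_exp_tendsto[of "Suc k"]])
         (auto simp: eventually_at_filter flat_exp_def divide_inverse)
    then show ?thesis unfolding 2 DERIV_def by (simp add: flat_exp_def)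
  next
    case 3
    have "((\<lambda>x. exp (- inverse x) * inverse x ^ k) has_real_derivative
        flat_exp (k + 2) x - of_nat k * flat_exp (k + 1) x) (at x)"
    proof (cases k)
      case 0
      then show ?thesis using 3
        by (auto intro!: derivative_eq_intros simp: flat_exp_def power2_eq_square)
    next
      case (Suc m)
      then show ?thesis using 3
        by (auto intro!: derivative_eq_intros simp: flat_exp_def power2_eq_square algebra_simps) (cases m; simp)
    qed
    then show ?thesis
      by (rule has_field_derivative_transform_within_open[of _ _ _ "{0<..}"])
         (use 3 in \<open>auto simp: flat_exp_def\<close>)
  qed
qed

lemma flat_exp_smooth: "times_differentiable_on m UNIV (flat_exp k)"
proof (induction m arbitrary: k)
  case 0
  show ?case
    by (auto intro!: continuous_at_imp_continuous_on DERIV_isCont[OF flat_exp_has_derivative])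
next
  case (Suc m)
  show ?case
    by (rule times_differentiable_real_SucI[OF open_UNIV flat_exp_has_derivative])
       (intro times_differentiable_diff times_differentiable_mult times_differentiable_const open_UNIV Suc)
qed

lemma times_differentiable_affine: "times_differentiable_on k UNIV (\<lambda>x::real. c * x + d :: real)"
proof (cases k)
  case 0
  then show ?thesis by (auto intro!: continuous_intros)
next
  case (Suc m)
  show ?thesis
    unfolding Suc by (rule times_differentiable_real_SucI[OF open_UNIV, where f' = "\<lambda>_. c"])
      (auto intro!: derivative_eq_intros times_differentiable_const)
qed

lemma times_differentiable_compose_affine:
  fixes f :: "real \<Rightarrow> real"
  assumes "times_differentiable_on k UNIV f"
  shows "times_differentiable_on k UNIV (\<lambda>x::real. f (c * x + d))"
  by (rule times_differentiable_compose[OF open_UNIV _ times_differentiable_affine assms]) simp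

text \<open>The step starts at 1 and not at 0, so that its rescalings vanish in a neighbourhood of
  an end point of an interval and give compactly supported cutoffs. The bound \<open>B\<close> on
  the slope is for dominated convergence.\<close>

lemma smooth_step_exists:
  obtains \<theta> :: "real \<Rightarrow> real" and B :: real where "smooth_on UNIV \<theta>"
    "\<And>x. x \<le> 1 \<Longrightarrow> \<theta> x = 0" "\<And>x. 2 \<le> x \<Longrightarrow> \<theta> x = 1"
    "\<And>x. 0 \<le> \<theta> x" "\<And>x. \<theta> x \<le> 1" "\<And>x. 2 < x \<Longrightarrow> deriv \<theta> x = 0" "\<And>x. \<bar>deriv \<theta> x\<bar> \<le> B"
proof -
  define e where "e = flat_exp 0"
  have e: "e x = (if 0 < x then exp (- inverse x) else 0)" for x
    by (simp add: e_def flat_exp_def)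
  define \<theta> where "\<theta> x = e (x - 1) / (e (x - 1) + e (2 - x))" for x
  have pos: "0 < e (x - 1) + e (2 - x)" for x
    by (auto simp: e add_pos_pos)
  have e_td: "times_differentiable_on k UNIV (\<lambda>x. e (x - 1))" "times_differentiable_on k UNIV (\<lambda>x. e (2 - x))" for k
    using times_differentiable_compose_affine[of k e 1 "-1"] times_differentiable_compose_affine[of k e "-1" 2] flat_exp_smooth
    by (simp_all add: e_def)
  have sm: "smooth_on UNIV \<theta>"
    unfolding smooth_on_def \<theta>_def
    by (intro allI times_differentiable_divide times_differentiable_add open_UNIV e_td) (simp add: less_imp_neq[OF pos, symmetric])
  have 0: "\<theta> x = 0" if "x \<le> 1" for x using that by (simp add: \<theta>_def e)
  have 1: "\<theta> x = 1" if "2 \<le> x" for x using that by (simp add: \<theta>_def e)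
  have ge: "0 \<le> \<theta> x" for x using pos[of x] by (simp add: \<theta>_def e)
  have le: "\<theta> x \<le> 1" for x using pos[of x] by (simp add: \<theta>_def e)
  have d2: "deriv \<theta> x = 0" if "2 < x" for x
  proof -
    have "(\<theta> has_real_derivative 0) (at x)"
      by (rule has_field_derivative_transform_within_open[of "\<lambda>_. 1" _ _ "{2<..}"])
         (use that 1 in auto)
    then show ?thesis by (rule DERIV_imp_deriv)
  qed
  have d1: "deriv \<theta> x = 0" if "x < 1" for x
  proof -
    have "(\<theta> has_real_derivative 0) (at x)"
      by (rule has_field_derivative_transform_within_open[of "\<lambda>_. 0" _ _ "{..<1}"])
         (use that 0 in auto)
    then show ?thesis by (rule DERIV_imp_deriv)
  qed
  have "continuous_on {1..2} (deriv \<theta>)"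
    using smooth_on_continuous[OF smooth_on_deriv(1)[OF open_UNIV sm]] continuous_on_subset by blast
  then have "bounded (deriv \<theta> ` {1..2})"
    by (intro compact_imp_bounded compact_continuous_image) auto
  then obtain B where B: "\<forall>x\<in>{1..2}. \<bar>deriv \<theta> x\<bar> \<le> B"
    by (auto simp: bounded_iff)
  then have "0 \<le> B" by (metis abs_ge_zero atLeastAtMost_iff dual_order.trans one_le_numeral order_refl)
  then have "\<bar>deriv \<theta> x\<bar> \<le> B" for x
    using B d1[of x] d2[of x] by (cases "x < 1"; cases "2 < x") auto
  then show thesis
    using that sm 0 1 ge le d2 by blast
qed


section \<open>Smooth functions in \<open>H\<^sup>1\<^sub>0\<close> of an interval\<close>

lemma integrable_on_Ioo:
  fixes f :: "real \<Rightarrow> real"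
  assumes "continuous_on {a..b} f"
  shows "integrable (lebesgue_on {a<..<b}) f"
proof -
  have "integrable (lebesgue_on {a..b}) f" by (rule continuous_imp_integrable_real[OF assms])
  then have "f absolutely_integrable_on {a..b}"
    by (simp add: absolutely_integrable_on_def set_integrable_def integrable_restrict_space)
  then have "f absolutely_integrable_on {a<..<b}"
    by (rule set_integrable_subset) auto
  then show ?thesis
    by (simp add: absolutely_integrable_on_def set_integrable_def integrable_restrict_space)
qed

lemma integral_Ioo_FTC:
  fixes F f :: "real \<Rightarrow> real"
  assumes "a \<le> b" "continuous_on {a..b} f"
    and "\<And>x. a \<le> x \<Longrightarrow> x \<le> b \<Longrightarrow> (F has_real_derivative f x) (at x)"
  shows "(LINT x|lebesgue_on {a<..<b}. f x) = F b - F a"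
proof -
  have "(f has_integral F b - F a) {a..b}"
    by (rule fundamental_theorem_of_calculus[OF assms(1)])
       (use assms(3) in \<open>auto simp: has_real_derivative_iff_has_vector_derivative[symmetric]
          intro: has_field_derivative_at_within\<close>)
  moreover have "(LINT x|lebesgue_on {a<..<b}. f x) = integral {a<..<b} f"
    by (rule lebesgue_integral_eq_integral[OF integrable_on_Ioo[OF assms(2)]]) auto
  ultimately show ?thesis
    by (simp add: integral_open_interval_real[symmetric] integral_unique)
qed

lemma integrable_one_Ioo: "integrable (lebesgue_on {a<..<b::real}) (\<lambda>_. c::real)"
  by (rule integrable_on_Ioo) auto

lemma AE_lebesgue_on_I: "S \<in> sets lebesgue \<Longrightarrow> (\<And>x. x \<in> S \<Longrightarrow> P x) \<Longrightarrow> AE x in lebesgue_on S. P x"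
  by (rule AE_I2) (simp add: space_restrict_space)

lemma test_function_vanishes:
  assumes "test_function {a<..<b} \<psi>" "x \<notin> {a<..<b}"
  shows "\<psi> x = 0"
  using assms closure_subset[of "{x. \<psi> x \<noteq> 0}"] by (auto simp: test_function_def)

lemma square_integrable_continuous:
  assumes "continuous_on {a..b} u"
  shows "square_integrable_on {a<..<b} u"
  unfolding square_integrable_on_def
proof
  show "u \<in> borel_measurable (lebesgue_on {a<..<b})"
    using integrable_on_Ioo[OF assms] by (rule borel_measurable_integrable)
  show "integrable (lebesgue_on {a<..<b}) (\<lambda>x. (u x)\<^sup>2)"
    by (rule integrable_on_Ioo) (intro continuous_intros assms)
qed

lemma weak_derivative_smooth:
  assumes "a \<le> b" "smooth_on UNIV u"
  shows "weak_derivative_on {a<..<b} u (deriv u)"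
  unfolding weak_derivative_on_def
proof (intro allI impI)
  fix \<psi> assume \<psi>: "test_function {a<..<b} \<psi>"
  then have sm: "smooth_on UNIV \<psi>" by (simp add: test_function_def)
  note d = smooth_on_deriv(2)[OF open_UNIV assms(2)] smooth_on_deriv(2)[OF open_UNIV sm]
  note c = smooth_on_continuous[OF assms(2)] smooth_on_continuous[OF sm]
    smooth_on_continuous[OF smooth_on_deriv(1)[OF open_UNIV assms(2)]]
    smooth_on_continuous[OF smooth_on_deriv(1)[OF open_UNIV sm]]
  note c' = c[THEN continuous_on_subset, OF subset_UNIV]
  have "(LINT x|lebesgue_on {a<..<b}. u x * deriv \<psi> x + deriv u x * \<psi> x) = u b * \<psi> b - u a * \<psi> a"
    using d by (intro integral_Ioo_FTC[OF assms(1)] continuous_intros c')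
       (auto intro!: derivative_eq_intros)
  also have "\<dots> = 0" using test_function_vanishes[OF \<psi>] by simp
  finally have "(LINT x|lebesgue_on {a<..<b}. u x * deriv \<psi> x + deriv u x * \<psi> x) = 0" .
  moreover have "(LINT x|lebesgue_on {a<..<b}. u x * deriv \<psi> x + deriv u x * \<psi> x)
      = (LINT x|lebesgue_on {a<..<b}. u x * deriv \<psi> x) + (LINT x|lebesgue_on {a<..<b}. deriv u x * \<psi> x)"
    by (intro Bochner_Integration.integral_add integrable_on_Ioo continuous_intros c')
  ultimately show "(LINT x|lebesgue_on {a<..<b}. u x * deriv \<psi> x) = - (LINT x|lebesgue_on {a<..<b}. deriv u x * \<psi> x)"
    by simp
qed

text \<open>\<open>u\<close> is approximated by its products with cutoffs at both ends. The slope of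
  the \<open>n\<close>-th cutoff grows like \<open>n\<close>, but it lives within distance 2/(n+1)
  of an end point, where |u| is at most \<open>M\<close> times that distance. Hence the derivatives
  of the products stay bounded, and dominated convergence applies.\<close>

lemma H10_smooth:
  assumes ab: "a < b" and u: "smooth_on UNIV u" "u a = 0" "u b = 0"
  shows "H10 {a<..<b} u (deriv u)"
proof -
  note du = smooth_on_deriv(2)[OF open_UNIV u(1), OF UNIV_I]
  have cu: "continuous_on A u" and cdu: "continuous_on A (deriv u)" for A
    using smooth_on_continuous[OF u(1)] smooth_on_continuous[OF smooth_on_deriv(1)[OF open_UNIV u(1)]]
    by (auto intro: continuous_on_subset)
  obtain \<theta> :: "real \<Rightarrow> real" and B where \<theta>: "smooth_on UNIV \<theta>"
    "\<And>x. x \<le> 1 \<Longrightarrow> \<theta> x = 0" "\<And>x. 2 \<le> x \<Longrightarrow> \<theta> x = 1"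
    "\<And>x. 0 \<le> \<theta> x" "\<And>x. \<theta> x \<le> 1" "\<And>x. 2 < x \<Longrightarrow> deriv \<theta> x = 0" "\<And>x. \<bar>deriv \<theta> x\<bar> \<le> B"
    using smooth_step_exists by metis
  note d\<theta> = smooth_on_deriv(2)[OF open_UNIV \<theta>(1), OF UNIV_I]
  have B: "0 \<le> B" using \<theta>(7)[of 0] by linarith
  obtain M0 where "\<forall>x\<in>{a..b}. \<bar>u x\<bar> \<le> M0"
    using compact_imp_bounded[OF compact_continuous_image[OF cu[of "{a..b}"]]] by (auto simp: bounded_iff)
  then have M0: "\<And>x. a \<le> x \<Longrightarrow> x \<le> b \<Longrightarrow> \<bar>u x\<bar> \<le> M0" by simp
  obtain M where "\<forall>x\<in>{a..b}. \<bar>deriv u x\<bar> \<le> M"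
    using compact_imp_bounded[OF compact_continuous_image[OF cdu[of "{a..b}"]]] by (auto simp: bounded_iff)
  then have M: "\<And>x. a \<le> x \<Longrightarrow> x \<le> b \<Longrightarrow> \<bar>deriv u x\<bar> \<le> M" by simp
  have M_nn: "0 \<le> M" using M[of a] ab by linarith
  have lip: "\<bar>u x\<bar> \<le> M * (x - a)" "\<bar>u x\<bar> \<le> M * (b - x)" if "a \<le> x" "x \<le> b" for x
    using field_differentiable_bound[of "{a..b}" u "deriv u" M x a]
      field_differentiable_bound[of "{a..b}" u "deriv u" M x b] that M u
    by (auto simp: has_field_derivative_at_within[OF du])
  define l where "l n x = \<theta> (real (Suc n) * (x - a))" for n x
  define r where "r n x = \<theta> (real (Suc n) * (b - x))" for n x
  define l' where "l' n x = deriv \<theta> (real (Suc n) * (x - a)) * real (Suc n)" for n x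
  define r' where "r' n x = - deriv \<theta> (real (Suc n) * (b - x)) * real (Suc n)" for n x
  define \<psi> where "\<psi> n x = l n x * r n x * u x" for n x
  define \<psi>' where "\<psi>' n x = (l' n x * u x) * r n x + (r' n x * u x) * l n x + l n x * r n x * deriv u x" for n x
  have dl: "(l n has_real_derivative l' n x) (at x)" for n x
    unfolding l_def[abs_def] l'_def by (rule DERIV_chain2[OF d\<theta>]) (auto intro!: derivative_eq_intros)
  have dr: "(r n has_real_derivative r' n x) (at x)" for n x
    unfolding r_def[abs_def] r'_def
    by (rule DERIV_cong[OF DERIV_chain2[OF d\<theta>, of _ "- real (Suc n)"]])
       (auto intro!: derivative_eq_intros simp del: of_nat_Suc)
  have d\<psi>: "deriv (\<psi> n) = \<psi>' n" for n
  proof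
    fix x
    have "(\<psi> n has_real_derivative \<psi>' n x) (at x)"
      unfolding \<psi>_def[abs_def] \<psi>'_def
      by (rule derivative_eq_intros dl dr du refl)+ (simp add: algebra_simps)
    then show "deriv (\<psi> n) x = \<psi>' n x" by (rule DERIV_imp_deriv)
  qed
  have sl: "smooth_on UNIV (l n)" "smooth_on UNIV (r n)" for n
    unfolding smooth_on_def l_def r_def
    using times_differentiable_compose_affine[OF smooth_on_imp_times_differentiable[OF \<theta>(1)], of _ "real (Suc n)" "- real (Suc n) * a"]
      times_differentiable_compose_affine[OF smooth_on_imp_times_differentiable[OF \<theta>(1)], of _ "- real (Suc n)" "real (Suc n) * b"]
    by (auto simp: algebra_simps)
  have s\<psi>: "smooth_on UNIV (\<psi> n)" for n
    unfolding smooth_on_def \<psi>_def[abs_def]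
    by (intro allI times_differentiable_mult open_UNIV smooth_on_imp_times_differentiable sl u)
  have test: "test_function {a<..<b} (\<psi> n)" for n
  proof -
    define h where "h = 1 / real (Suc n)"
    have h: "0 < h" by (simp add: h_def)
    have "{x. \<psi> n x \<noteq> 0} \<subseteq> {a + h..b - h}"
    proof
      fix x assume "x \<in> {x. \<psi> n x \<noteq> 0}"
      then have "l n x \<noteq> 0" "r n x \<noteq> 0" by (auto simp: \<psi>_def)
      then have "\<not> real (Suc n) * (x - a) \<le> 1" "\<not> real (Suc n) * (b - x) \<le> 1"
        using \<theta>(2) unfolding l_def r_def by blast+
      then show "x \<in> {a + h..b - h}"
        unfolding h_def by (auto simp: field_simps)
    qed
    then have "closure {x. \<psi> n x \<noteq> 0} \<subseteq> {a + h..b - h}" by (rule closure_minimal) simp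
    moreover from this have "compact (closure {x. \<psi> n x \<noteq> 0})"
      by (meson bounded_closed_interval bounded_subset closed_closure compact_eq_bounded_closed)
    ultimately show ?thesis using h s\<psi> unfolding test_function_def by fastforce
  qed
  let ?M = "lebesgue_on {a<..<b}"
  have bound1: "\<bar>\<psi> n x - u x\<bar> \<le> M0" if "a < x" "x < b" for n x
  proof -
    have "\<psi> n x - u x = - ((1 - l n x * r n x) * u x)" by (simp add: \<psi>_def algebra_simps)
    moreover have "0 \<le> l n x * r n x" "l n x * r n x \<le> 1"
      using \<theta>(4,5) unfolding l_def r_def by (auto intro: mult_le_one)
    moreover from this have "(1 - l n x * r n x) * \<bar>u x\<bar> \<le> 1 * \<bar>u x\<bar>"
      by (intro mult_right_mono) auto
    ultimately have "\<bar>\<psi> n x - u x\<bar> \<le> \<bar>u x\<bar>" by (simp add: abs_mult)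
    then show ?thesis using M0[of x] that by simp
  qed
  have bl: "\<bar>l' n x * u x\<bar> \<le> 2 * M * B" if "a < x" "x < b" for n x
  proof (cases "2 < real (Suc n) * (x - a)")
    case True
    then show ?thesis using \<theta>(6) M_nn B by (simp add: l'_def del: of_nat_Suc)
  next
    case False
    have "\<bar>l' n x * u x\<bar> \<le> (B * real (Suc n)) * (M * (x - a))"
      unfolding l'_def abs_mult using \<theta>(7) lip(1)[of x] that B by (intro mult_mono) auto
    also have "\<dots> = (M * B) * (real (Suc n) * (x - a))" by (simp add: mult_ac)
    also have "\<dots> \<le> (M * B) * 2" using False M_nn B by (intro mult_left_mono) auto
    finally show ?thesis by simp
  qed
  have br: "\<bar>r' n x * u x\<bar> \<le> 2 * M * B" if "a < x" "x < b" for n x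
  proof (cases "2 < real (Suc n) * (b - x)")
    case True
    then show ?thesis using \<theta>(6) M_nn B by (simp add: r'_def del: of_nat_Suc)
  next
    case False
    have "\<bar>r' n x * u x\<bar> \<le> (B * real (Suc n)) * (M * (b - x))"
      unfolding r'_def abs_mult abs_minus_cancel using \<theta>(7) lip(2)[of x] that B by (intro mult_mono) auto
    also have "\<dots> = (M * B) * (real (Suc n) * (b - x))" by (simp add: mult_ac)
    also have "\<dots> \<le> (M * B) * 2" using False M_nn B by (intro mult_left_mono) auto
    finally show ?thesis by simp
  qed
  have bound2: "\<bar>\<psi>' n x - deriv u x\<bar> \<le> 4 * M * B + 2 * M" if "a < x" "x < b" for n x
  proof -
    have 1: "\<bar>(l' n x * u x) * r n x\<bar> \<le> 2 * M * B * 1" "\<bar>(r' n x * u x) * l n x\<bar> \<le> 2 * M * B * 1"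
      using bl[OF that] br[OF that] \<theta>(4,5) M_nn B unfolding abs_mult[of _ "r n x"] abs_mult[of _ "l n x"]
      by (intro mult_mono; simp add: l_def r_def)+
    have "\<bar>l n x * r n x\<bar> \<le> 1" using \<theta>(4,5) unfolding l_def r_def by (auto intro!: mult_le_one)
    then have "\<bar>l n x * r n x * deriv u x\<bar> \<le> 1 * M"
      using M[of x] that unfolding abs_mult[of _ "deriv u x"] by (intro mult_mono) auto
    then show ?thesis using 1 M[of x] that unfolding \<psi>'_def by (simp add: abs_le_iff)
  qed
  have lim: "(\<lambda>n. LINT x|?M. (\<psi> n x - u x)\<^sup>2 + (deriv (\<psi> n) x - deriv u x)\<^sup>2) \<longlonglongrightarrow> (LINT x|?M. 0)"
    unfolding d\<psi>
  proof (rule integral_dominated_convergence[where w = "\<lambda>_. M0\<^sup>2 + (4 * M * B + 2 * M)\<^sup>2"])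
    have "continuous_on {a..b} (\<psi> n)" "continuous_on {a..b} (\<psi>' n)" for n
      using smooth_on_continuous[OF s\<psi>] smooth_on_continuous[OF smooth_on_deriv(1)[OF open_UNIV s\<psi>]]
      by (auto intro: continuous_on_subset simp: d\<psi>)
    then show "(\<lambda>x. (\<psi> n x - u x)\<^sup>2 + (\<psi>' n x - deriv u x)\<^sup>2) \<in> borel_measurable ?M" for n
      by (intro borel_measurable_integrable integrable_on_Ioo continuous_intros cu cdu)
    show "AE x in ?M. norm ((\<psi> n x - u x)\<^sup>2 + (\<psi>' n x - deriv u x)\<^sup>2) \<le> M0\<^sup>2 + (4 * M * B + 2 * M)\<^sup>2" for n
    proof (rule AE_lebesgue_on_I)
      fix x assume "x \<in> {a<..<b}"
      then have "(\<psi> n x - u x)\<^sup>2 \<le> M0\<^sup>2" "(\<psi>' n x - deriv u x)\<^sup>2 \<le> (4 * M * B + 2 * M)\<^sup>2"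
        using bound1[of x n] bound2[of x n] by (auto simp: abs_le_square_iff[symmetric])
      then show "norm ((\<psi> n x - u x)\<^sup>2 + (\<psi>' n x - deriv u x)\<^sup>2) \<le> M0\<^sup>2 + (4 * M * B + 2 * M)\<^sup>2" by simp
    qed simp
    show "AE x in ?M. (\<lambda>n. (\<psi> n x - u x)\<^sup>2 + (\<psi>' n x - deriv u x)\<^sup>2) \<longlonglongrightarrow> 0"
    proof (rule AE_lebesgue_on_I)
      fix x assume x: "x \<in> {a<..<b}"
      have "\<forall>\<^sub>F n in sequentially. c < real (Suc n) * d" if pos: "0 < d" for c d :: real
      proof -
        obtain N where N: "c < real N * d" using reals_Archimedean3[OF pos] by blast
        have "c < real (Suc n) * d" if "N \<le> n" for n
        proof -
          have "real N * d \<le> real (Suc n) * d" using that \<open>0 < d\<close> by (intro mult_right_mono) auto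
          then show ?thesis using N by linarith
        qed
        then show ?thesis unfolding eventually_sequentially by blast
      qed
      \<comment> \<open>At a fixed interior point both rescaled distances eventually exceed 2, where
        the cutoffs are locally constant 1; so the integrand is eventually exactly 0.\<close>
      from this[of "x - a" 2] this[of "b - x" 2] x
      have "\<forall>\<^sub>F n in sequentially. 2 < real (Suc n) * (x - a)" "\<forall>\<^sub>F n in sequentially. 2 < real (Suc n) * (b - x)"
        by auto
      then have "\<forall>\<^sub>F n in sequentially. (\<psi> n x - u x)\<^sup>2 + (\<psi>' n x - deriv u x)\<^sup>2 = 0"
      proof eventually_elim
        case (elim n)
        then have "l n x = 1" "r n x = 1" "l' n x = 0" "r' n x = 0"
          unfolding l_def r_def l'_def r'_def by (simp_all add: \<theta>(3,6) del: of_nat_Suc)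
        then show ?case by (simp add: \<psi>_def \<psi>'_def)
      qed
      then show "(\<lambda>n. (\<psi> n x - u x)\<^sup>2 + (\<psi>' n x - deriv u x)\<^sup>2) \<longlonglongrightarrow> 0"
        by (rule tendsto_eventually)
    qed simp
  qed (auto intro: integrable_one_Ioo)
  show ?thesis
    unfolding H10_def
    using square_integrable_continuous[OF cu] square_integrable_continuous[OF cdu]
      weak_derivative_smooth[OF less_imp_le[OF ab] u(1)] test lim by auto
qed


section \<open>Solutions of the Jacobi equation\<close>

definition primitive :: "(real \<Rightarrow> real) \<Rightarrow> real \<Rightarrow> real" where
  "primitive f = (SOME F. F 0 = 0 \<and> (\<forall>x. (F has_real_derivative f x) (at x)))"

lemma primitive:
  assumes "continuous_on UNIV f"
  shows "primitive f 0 = 0" "(primitive f has_real_derivative f x) (at x)"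
proof -
  have "\<exists>F. \<forall>x. -\<infinity> < ereal x \<longrightarrow> ereal x < \<infinity> \<longrightarrow> (F has_vector_derivative f x) (at x)"
    by (rule einterval_antiderivative) (use assms in \<open>auto simp: continuous_on_eq_continuous_at\<close>)
  then obtain F where F: "\<And>x. (F has_real_derivative f x) (at x)"
    by (auto simp: has_real_derivative_iff_has_vector_derivative)
  have "\<exists>F. F 0 = 0 \<and> (\<forall>x. (F has_real_derivative f x) (at x))"
    by (rule exI[of _ "\<lambda>x. F x - F 0"]) (auto intro!: derivative_eq_intros F)
  from someI_ex[OF this] show "primitive f 0 = 0" "(primitive f has_real_derivative f x) (at x)"
    by (auto simp: primitive_def)
qed

lemma continuous_on_primitive:
  "continuous_on UNIV f \<Longrightarrow> continuous_on UNIV (primitive f)"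
  by (meson DERIV_isCont continuous_at_imp_continuous_on primitive(2))

text \<open>For x at least 0 the difference of the claimed bound and \<open>F\<close> is
  nondecreasing and starts at 0. Applying this to \<open>- F\<close> gives the absolute value, and
  reflecting the argument gives negative x.\<close>

lemma primitive_power_bound:
  fixes F f :: "real \<Rightarrow> real"
  assumes "F 0 = 0" "\<And>x. (F has_real_derivative f x) (at x)"
    and "\<And>x. \<bar>f x\<bar> \<le> c * \<bar>x\<bar> ^ m / fact m"
  shows "\<bar>F x\<bar> \<le> c * \<bar>x\<bar> ^ Suc m / fact (Suc m)"
proof -
  have *: "F x \<le> c * x ^ Suc m / fact (Suc m)"
    if "x \<ge> 0" "F 0 = 0" "\<And>x. (F has_real_derivative f x) (at x)"
      "\<And>x. \<bar>f x\<bar> \<le> c * \<bar>x\<bar> ^ m / fact m" for F f :: "real \<Rightarrow> real" and x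
  proof -
    have d: "((\<lambda>x. c * x ^ Suc m / fact (Suc m) - F x) has_real_derivative c * x ^ m / fact m - f x) (at x)" for x
      by (rule derivative_eq_intros that(3) | simp)+
    have "c * 0 ^ Suc m / fact (Suc m) - F 0 \<le> c * x ^ Suc m / fact (Suc m) - F x"
    proof (rule DERIV_nonneg_imp_nondecreasing[OF that(1)])
      fix t assume "0 \<le> t" "t \<le> x"
      then have "0 \<le> c * t ^ m / fact m - f t" using that(4)[of t] by auto
      then show "\<exists>y. ((\<lambda>x. c * x ^ Suc m / fact (Suc m) - F x) has_real_derivative y) (at t) \<and> 0 \<le> y"
        using d[of t] by blast
    qed
    then show ?thesis using that(2) by simp
  qed
  have pos: "\<bar>F x\<bar> \<le> c * x ^ Suc m / fact (Suc m)"
    if "x \<ge> 0" "F 0 = 0" "\<And>x. (F has_real_derivative f x) (at x)"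
      "\<And>x. \<bar>f x\<bar> \<le> c * \<bar>x\<bar> ^ m / fact m" for F f :: "real \<Rightarrow> real" and x
    using *[OF that] *[of x "\<lambda>x. - F x" "\<lambda>x. - f x"] that
    by (auto intro!: derivative_eq_intros simp: abs_le_iff)
  show ?thesis
  proof (cases "x \<ge> 0")
    case True
    then show ?thesis using pos[OF True assms] by simp
  next
    case False
    have "((\<lambda>x. F (- x)) has_real_derivative - f (- x)) (at x)" for x
      using DERIV_chain2[OF assms(2) DERIV_minus[OF DERIV_ident], of x] by simp
    moreover have "\<bar>- f (- x)\<bar> \<le> c * \<bar>x\<bar> ^ m / fact m" for x
      using assms(3)[of "- x"] by simp
    ultimately show ?thesis
      using pos[of "- x" "\<lambda>x. F (- x)" "\<lambda>x. - f (- x)"] False assms(1) by simp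
  qed
qed

text \<open>The Weierstrass test gives uniform convergence of the derivatives on [-T, T];
  \<open>T\<close> exceeds |x| so that x is an interior point. Convergence of the series itself is
  needed at one point only, and at 0 all terms vanish.\<close>

lemma suminf_has_real_derivative:
  fixes f f' :: "nat \<Rightarrow> real \<Rightarrow> real"
  assumes "\<And>n x. (f n has_real_derivative f' n x) (at x)" "\<And>n. f n 0 = 0"
    and "\<And>n x T. \<bar>x\<bar> \<le> T \<Longrightarrow> \<bar>f' n x\<bar> \<le> M T n" "\<And>T. summable (M T)"
  shows "summable (\<lambda>n. f n x)" "((\<lambda>x. \<Sum>n. f n x) has_real_derivative (\<Sum>n. f' n x)) (at x)"
proof -
  define T where "T = \<bar>x\<bar> + 1"
  have *: "uniformly_convergent_on {-T..T} (\<lambda>n x. \<Sum>i<n. f' i x)"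
    unfolding uniformly_convergent_on_def by (rule exI, rule Weierstrass_m_test[where M = "M T"])
       (use assms(3,4) in \<open>auto simp: abs_le_iff\<close>)
  have x: "x \<in> interior {-T..T}" by (auto simp: T_def)
  have 0: "0 \<in> {-T..T}" by (auto simp: T_def)
  note s = has_field_derivative_series'[OF convex_real_interval(5) has_field_derivative_at_within[OF assms(1)] * 0 _ x]
  show "summable (\<lambda>n. f n x)" "((\<lambda>x. \<Sum>n. f n x) has_real_derivative (\<Sum>n. f' n x)) (at x)"
    by (rule s; simp add: assms(2))+
qed

text \<open>The \<open>m\<close>-th pair is the \<open>m\<close>-th increment of the Picard
  iteration for u' = v, v' = - \<kappa> u, not the iterate itself; the solution is the sum of all
  increments.\<close>

primrec jacobi_iterates ::
    "(real \<Rightarrow> real) \<Rightarrow> real \<Rightarrow> real \<Rightarrow> nat \<Rightarrow> (real \<Rightarrow> real) \<times> (real \<Rightarrow> real)" where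
  "jacobi_iterates \<kappa> x0 y0 0 = (\<lambda>_. x0, \<lambda>_. y0)"
| "jacobi_iterates \<kappa> x0 y0 (Suc m) =
    (primitive (snd (jacobi_iterates \<kappa> x0 y0 m)),
     primitive (\<lambda>t. - \<kappa> t * fst (jacobi_iterates \<kappa> x0 y0 m) t))"

lemma jacobi_equation_solvable:
  fixes \<kappa> :: "real \<Rightarrow> real"
  assumes cont: "continuous_on UNIV \<kappa>" and bound: "\<And>t. \<bar>\<kappa> t\<bar> \<le> A"
  shows "\<exists>u u'. u 0 = x0 \<and> u' 0 = y0 \<and>
    (\<forall>t. (u has_real_derivative u' t) (at t) \<and> (u' has_real_derivative - \<kappa> t * u t) (at t))"
proof -
  \<comment> \<open>At least 1 as well as a bound of |\<kappa>|: the step from \<open>v\<close> to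
    \<open>u\<close> multiplies the estimate by at most 1 and the step from \<open>u\<close> to
    \<open>v\<close> by at most \<open>A\<close>, so one \<open>a\<close> serves both
    components.\<close>
  define a where "a = max 1 A"
  define B where "B = max \<bar>x0\<bar> \<bar>y0\<bar>"
  have a: "a \<ge> 1" "\<bar>\<kappa> t\<bar> \<le> a" for t using bound[of t] by (auto simp: a_def)
  define u where "u m = fst (jacobi_iterates \<kappa> x0 y0 m)" for m
  define v where "v m = snd (jacobi_iterates \<kappa> x0 y0 m)" for m
  have 0: "u 0 = (\<lambda>_. x0)" "v 0 = (\<lambda>_. y0)" by (auto simp: u_def v_def)
  have uv_Suc: "u (Suc m) = primitive (v m)" "v (Suc m) = primitive (\<lambda>t. - \<kappa> t * u m t)" for m
    by (auto simp: u_def v_def)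
  have c: "continuous_on UNIV (u m) \<and> continuous_on UNIV (v m)" for m
  proof (induction m)
    case (Suc m)
    then show ?case unfolding uv_Suc
      by (intro conjI continuous_on_primitive continuous_intros cont) auto
  qed (auto simp: 0)
  have cu: "continuous_on UNIV (\<lambda>t. - \<kappa> t * u m t)" for m
    using c by (intro continuous_intros cont) auto
  have du: "(u (Suc m) has_real_derivative v m t) (at t)" for m t
    unfolding uv_Suc using primitive(2) c by blast
  have dv: "(v (Suc m) has_real_derivative - \<kappa> t * u m t) (at t)" for m t
    unfolding uv_Suc by (rule primitive(2)[OF cu])
  have zero: "u (Suc m) 0 = 0" "v (Suc m) 0 = 0" for m
    unfolding uv_Suc using primitive(1) c cu by blast+
  have bd: "(\<forall>t. \<bar>u m t\<bar> \<le> B * a ^ m * \<bar>t\<bar> ^ m / fact m) \<and> (\<forall>t. \<bar>v m t\<bar> \<le> B * a ^ m * \<bar>t\<bar> ^ m / fact m)" for m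
  proof (induction m)
    case (Suc m)
    have "\<bar>v m t\<bar> \<le> B * a ^ Suc m * \<bar>t\<bar> ^ m / fact m" for t
    proof -
      have "\<bar>v m t\<bar> \<le> 1 * (B * a ^ m * \<bar>t\<bar> ^ m / fact m)" using Suc by simp
      also have "\<dots> \<le> a * (B * a ^ m * \<bar>t\<bar> ^ m / fact m)"
        using a by (intro mult_right_mono) (auto simp: B_def)
      finally show ?thesis by (simp add: mult_ac)
    qed
    then have 1: "\<bar>u (Suc m) t\<bar> \<le> B * a ^ Suc m * \<bar>t\<bar> ^ Suc m / fact (Suc m)" for t
      by (rule primitive_power_bound[OF zero(1) du])
    have "\<bar>- \<kappa> t * u m t\<bar> \<le> B * a ^ Suc m * \<bar>t\<bar> ^ m / fact m" for t
    proof -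
      have "\<bar>- \<kappa> t * u m t\<bar> \<le> a * (B * a ^ m * \<bar>t\<bar> ^ m / fact m)"
        unfolding abs_mult abs_minus_cancel using Suc a by (intro mult_mono) auto
      then show ?thesis by (simp add: mult_ac)
    qed
    then have "\<bar>v (Suc m) t\<bar> \<le> B * a ^ Suc m * \<bar>t\<bar> ^ Suc m / fact (Suc m)" for t
      by (rule primitive_power_bound[OF zero(2) dv])
    with 1 show ?case by blast
  qed (auto simp: 0 B_def)
  define M where "M T m = B * a * (\<bar>a * T\<bar> ^ m / fact m)" for T :: real and m :: nat
  have M: "summable (M T)" for T
    unfolding M_def using summable_exp_generic[of "\<bar>a * T\<bar>"]
    by (intro summable_mult) (simp add: divide_inverse mult.commute)
  have le: "B * a ^ m * \<bar>t\<bar> ^ m / fact m \<le> B * (\<bar>a * T\<bar> ^ m / fact m)" if "\<bar>t\<bar> \<le> T" for t T m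
  proof -
    have "(a * \<bar>t\<bar>) ^ m \<le> \<bar>a * T\<bar> ^ m"
      using that a by (intro power_mono) (auto simp: abs_mult intro!: mult_left_mono)
    then show ?thesis
      by (auto simp: B_def power_mult_distrib[symmetric] mult.assoc intro!: mult_left_mono divide_right_mono)
  qed
  have nn: "B * (\<bar>a * T\<bar> ^ m / fact m) \<ge> 0" for T m by (simp add: B_def)
  have vM: "\<bar>v m t\<bar> \<le> M T m" and uM: "\<bar>- \<kappa> t * u m t\<bar> \<le> M T m" if "\<bar>t\<bar> \<le> T" for t T m
  proof -
    have "\<bar>v m t\<bar> \<le> 1 * (B * (\<bar>a * T\<bar> ^ m / fact m))" using bd le[OF that, of m] by (smt (verit))
    also have "\<dots> \<le> a * (B * (\<bar>a * T\<bar> ^ m / fact m))" using a nn by (intro mult_right_mono) auto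
    finally show "\<bar>v m t\<bar> \<le> M T m" by (simp add: M_def mult_ac)
    have "\<bar>u m t\<bar> \<le> B * (\<bar>a * T\<bar> ^ m / fact m)" using bd le[OF that, of m] by (smt (verit))
    then have "\<bar>- \<kappa> t * u m t\<bar> \<le> a * (B * (\<bar>a * T\<bar> ^ m / fact m))"
      unfolding abs_mult abs_minus_cancel using a by (intro mult_mono) auto
    then show "\<bar>- \<kappa> t * u m t\<bar> \<le> M T m" by (simp add: M_def mult_ac)
  qed
  \<comment> \<open>The terms from index 1 on vanish at 0, as the differentiation of series
    requires. The terms of index 0 are the constants \<open>x0\<close> and \<open>y0\<close> and are
    added back below.\<close>
  note U = suminf_has_real_derivative[of "\<lambda>m. u (Suc m)" v, OF du zero(1) vM M]
  note V = suminf_has_real_derivative[of "\<lambda>m. v (Suc m)" "\<lambda>m t. - \<kappa> t * u m t", OF dv zero(2) uM M]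
  have su: "summable (\<lambda>m. u m t)" "summable (\<lambda>m. v m t)" for t
    by (rule summable_Suc_iff[THEN iffD1, OF U(1)], assumption?) (rule summable_Suc_iff[THEN iffD1, OF V(1)], assumption?)
  have hu: "(\<Sum>m. u m t) = (\<Sum>m. u (Suc m) t) + x0" and hv: "(\<Sum>m. v m t) = (\<Sum>m. v (Suc m) t) + y0" for t
    using suminf_split_head[OF su(1)[of t]] suminf_split_head[OF su(2)[of t]] by (auto simp: 0)
  have ku: "(\<Sum>m. - \<kappa> t * u m t) = - \<kappa> t * (\<Sum>m. u m t)" for t
    by (rule suminf_mult[OF su(1)])
  have "((\<lambda>t. \<Sum>m. u m t) has_real_derivative (\<Sum>m. v m t)) (at t)" for t
    unfolding hu[abs_def] using DERIV_add[OF U(2)[where x=t] DERIV_const[of x0]] by simp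
  moreover have "((\<lambda>t. \<Sum>m. v m t) has_real_derivative - \<kappa> t * (\<Sum>m. u m t)) (at t)" for t
    unfolding hv[abs_def] ku[symmetric] using DERIV_add[OF V(2)[where x=t] DERIV_const[of y0]] by simp
  moreover have "(\<Sum>m. u m 0) = x0" "(\<Sum>m. v m 0) = y0"
    unfolding hu hv by (auto simp: zero)
  ultimately show ?thesis
    by (intro exI[of _ "\<lambda>t. \<Sum>m. u m t"] exI[of _ "\<lambda>t. \<Sum>m. v m t"] conjI allI)
qed


section \<open>The two-point function of the Jacobi equation\<close>

locale jacobi =
  fixes \<kappa> :: "real \<Rightarrow> real" and L :: real and C C' S S' :: "real \<Rightarrow> real"
  assumes L_pos: "0 < L"
    and \<kappa>_pos: "\<And>t. 0 < \<kappa> t"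
    and \<kappa>_periodic: "\<And>t. \<kappa> (t + L) = \<kappa> t"
    and \<kappa>_smooth: "smooth_on UNIV \<kappa>"
    and dC: "\<And>t. (C has_real_derivative C' t) (at t)"
    and dC': "\<And>t. (C' has_real_derivative - \<kappa> t * C t) (at t)"
    and dS: "\<And>t. (S has_real_derivative S' t) (at t)"
    and dS': "\<And>t. (S' has_real_derivative - \<kappa> t * S t) (at t)"
    and init: "C 0 = 1" "C' 0 = 0" "S 0 = 0" "S' 0 = 1"
begin

text \<open>For fixed \<open>a\<close>, \<open>D a\<close> is the solution that vanishes at
  \<open>a\<close> with slope 1, so its other zeros are the points conjugate to \<open>a\<close>.
  \<open>D1\<close>, \<open>D2\<close> and \<open>D12\<close> are the partial derivatives of
  \<open>D\<close>.\<close>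

definition D :: "real \<Rightarrow> real \<Rightarrow> real" where "D a b = C a * S b - S a * C b"
definition D1 :: "real \<Rightarrow> real \<Rightarrow> real" where "D1 a b = C' a * S b - S' a * C b"
definition D2 :: "real \<Rightarrow> real \<Rightarrow> real" where "D2 a b = C a * S' b - S a * C' b"
definition D12 :: "real \<Rightarrow> real \<Rightarrow> real" where "D12 a b = C' a * S' b - S' a * C' b"

lemma d\<kappa>: "(\<kappa> has_real_derivative deriv \<kappa> t) (at t)"
  using smooth_on_deriv(2)[OF open_UNIV \<kappa>_smooth] by simp

text \<open>Both left-hand sides are Wronskians of two solutions, hence constant; their values are
  read off at 0.\<close>

lemma solution_representation:
  assumes du: "\<And>t. (u has_real_derivative u' t) (at t)"
    and du': "\<And>t. (u' has_real_derivative - \<kappa> t * u t) (at t)"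
  shows "S' t * u t - S t * u' t = u 0" "C t * u' t - C' t * u t = u' 0"
proof -
  have "((\<lambda>t. S' t * u t - S t * u' t) has_real_derivative 0) (at t)" for t
    by (rule derivative_eq_intros dS dS' du du' refl)+ (simp add: algebra_simps)
  from DERIV_isconst_all[of "\<lambda>t. S' t * u t - S t * u' t" t 0] this
  show "S' t * u t - S t * u' t = u 0" using init by auto
  have "((\<lambda>t. C t * u' t - C' t * u t) has_real_derivative 0) (at t)" for t
    by (rule derivative_eq_intros dC dC' du du' refl)+ (simp add: algebra_simps)
  from DERIV_isconst_all[of "\<lambda>t. C t * u' t - C' t * u t" t 0] this
  show "C t * u' t - C' t * u t = u' 0" using init by auto
qed

lemma wronskian: "C t * S' t - S t * C' t = 1"
  using solution_representation(2)[OF dS dS', of t] init by (simp add: mult.commute)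

lemma solution_eq:
  assumes du: "\<And>t. (u has_real_derivative u' t) (at t)"
    and du': "\<And>t. (u' has_real_derivative - \<kappa> t * u t) (at t)"
  shows "u t = u 0 * C t + u' 0 * S t" "u' t = u 0 * C' t + u' 0 * S' t"
proof -
  have "u 0 * C t + u' 0 * S t = (C t * S' t - S t * C' t) * u t"
    unfolding solution_representation[OF du du', of t, symmetric] by (simp add: algebra_simps)
  then show "u t = u 0 * C t + u' 0 * S t" using wronskian by simp
  have "u 0 * C' t + u' 0 * S' t = (C t * S' t - S t * C' t) * u' t"
    unfolding solution_representation[OF du du', of t, symmetric] by (simp add: algebra_simps)
  then show "u' t = u 0 * C' t + u' 0 * S' t" using wronskian by simp
qed

lemma D_diag [simp]: "D a a = 0" "D1 a a = - 1" "D2 a a = 1"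
  using wronskian[of a] by (auto simp: D_def D1_def D2_def algebra_simps)

lemma D_has_derivative:
  assumes x: "(x has_real_derivative x') (at t)" and y: "(y has_real_derivative y') (at t)"
  shows "((\<lambda>t. D (x t) (y t)) has_real_derivative D1 (x t) (y t) * x' + D2 (x t) (y t) * y') (at t)"
    and "((\<lambda>t. D1 (x t) (y t)) has_real_derivative - \<kappa> (x t) * D (x t) (y t) * x' + D12 (x t) (y t) * y') (at t)"
    and "((\<lambda>t. D2 (x t) (y t)) has_real_derivative D12 (x t) (y t) * x' - \<kappa> (y t) * D (x t) (y t) * y') (at t)"
proof -
  note d = DERIV_chain2[OF dC x] DERIV_chain2[OF dC' x] DERIV_chain2[OF dS x]
      DERIV_chain2[OF dS' x] DERIV_chain2[OF dC y] DERIV_chain2[OF dC' y] DERIV_chain2[OF dS y]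
      DERIV_chain2[OF dS' y]
  show "((\<lambda>t. D (x t) (y t)) has_real_derivative D1 (x t) (y t) * x' + D2 (x t) (y t) * y') (at t)"
    unfolding D_def D1_def D2_def
    by (rule derivative_eq_intros d refl)+ (simp add: algebra_simps)
  show "((\<lambda>t. D1 (x t) (y t)) has_real_derivative - \<kappa> (x t) * D (x t) (y t) * x' + D12 (x t) (y t) * y') (at t)"
    unfolding D_def D1_def D12_def
    by (rule derivative_eq_intros d refl)+ (simp add: algebra_simps)
  show "((\<lambda>t. D2 (x t) (y t)) has_real_derivative D12 (x t) (y t) * x' - \<kappa> (y t) * D (x t) (y t) * y') (at t)"
    unfolding D_def D2_def D12_def
    by (rule derivative_eq_intros d refl)+ (simp add: algebra_simps)
qed

lemma dD_right: "((\<lambda>t. D a t) has_real_derivative D2 a t) (at t)"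
  using D_has_derivative(1)[OF DERIV_const[of a] DERIV_ident, of t] by simp

lemma dD2_right: "((\<lambda>t. D2 a t) has_real_derivative - \<kappa> t * D a t) (at t)"
  using D_has_derivative(3)[OF DERIV_const[of a] DERIV_ident, of t] by simp

lemma dD_left: "((\<lambda>t. D t b) has_real_derivative D1 t b) (at t)"
  using D_has_derivative(1)[OF DERIV_ident DERIV_const[of b], of t] by simp

lemma dD1_left: "((\<lambda>t. D1 t b) has_real_derivative - \<kappa> t * D t b) (at t)"
  using D_has_derivative(2)[OF DERIV_ident DERIV_const[of b], of t] by simp

text \<open>The left-hand side is minus the product of the Wronskians of \<open>C\<close> and
  \<open>S\<close> at \<open>a\<close> and at \<open>b\<close>. At a conjugate point it forces
  \<open>D1\<close> and \<open>D2\<close> to have opposite signs; elsewhere it serves to eliminate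
  \<open>D12\<close>.\<close>

lemma D_identity: "D1 a b * D2 a b - D a b * D12 a b = - 1"
proof -
  have "D1 a b * D2 a b - D a b * D12 a b =
      - ((C a * S' a - S a * C' a) * (C b * S' b - S b * C' b))"
    unfolding D_def D1_def D2_def D12_def by (simp add: algebra_simps)
  then show ?thesis by (simp add: wronskian)
qed

text \<open>Each line is a Wronskian of two solutions: of \<open>D a\<close> and the solution
  vanishing at \<open>b\<close>, taken at \<open>c\<close>; of \<open>D a\<close> and
  \<open>D c\<close>, taken at \<open>b\<close>; and of the solutions vanishing at \<open>b\<close>
  and \<open>c\<close>, taken at \<open>a\<close>.\<close>

lemma D_three_points:
  "D c b * D2 a c - D a c * D1 c b = D a b"
  "D a b * D2 c b - D c b * D2 a b = D a c"
  "D a c * D1 a b - D a b * D1 a c = D c b"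
proof -
  have "D c b * D2 a c - D a c * D1 c b = (C c * S' c - S c * C' c) * D a b"
    unfolding D_def D1_def D2_def by (simp add: algebra_simps)
  then show "D c b * D2 a c - D a c * D1 c b = D a b" by (simp add: wronskian)
  have "D a b * D2 c b - D c b * D2 a b = (C b * S' b - S b * C' b) * D a c"
    unfolding D_def D2_def by (simp add: algebra_simps)
  then show "D a b * D2 c b - D c b * D2 a b = D a c" by (simp add: wronskian)
  have "D a c * D1 a b - D a b * D1 a c = (C a * S' a - S a * C' a) * D c b"
    unfolding D_def D1_def by (simp add: algebra_simps)
  then show "D a c * D1 a b - D a b * D1 a c = D c b" by (simp add: wronskian)
qed

text \<open>Translation by \<open>L\<close> acts on the pair \<open>C\<close>, \<open>S\<close> by
  the monodromy matrix. Its determinant is the Wronskian, that is 1, and \<open>D\<close>,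
  \<open>D1\<close>, \<open>D2\<close> are determinants in this pair.\<close>

lemma D_periodic:
  "D (a + L) (b + L) = D a b" "D1 (a + L) (b + L) = D1 a b" "D2 (a + L) (b + L) = D2 a b"
proof -
  have sh: "((\<lambda>t. f (t + L)) has_real_derivative f' (t + L)) (at t)"
    if "\<And>t. (f has_real_derivative f' t) (at t)" for f f' t
    by (rule DERIV_shift[THEN iffD1, OF that])
  have C: "C (t + L) = C L * C t + C' L * S t" "C' (t + L) = C L * C' t + C' L * S' t"
    and S: "S (t + L) = S L * C t + S' L * S t" "S' (t + L) = S L * C' t + S' L * S' t" for t
    using solution_eq[of "\<lambda>t. C (t + L)" "\<lambda>t. C' (t + L)" t] sh[OF dC] sh[OF dC']
      solution_eq[of "\<lambda>t. S (t + L)" "\<lambda>t. S' (t + L)" t] sh[OF dS] sh[OF dS']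
    by (auto simp: \<kappa>_periodic)
  have "D (a + L) (b + L) = (C L * S' L - S L * C' L) * D a b"
    "D1 (a + L) (b + L) = (C L * S' L - S L * C' L) * D1 a b"
    "D2 (a + L) (b + L) = (C L * S' L - S L * C' L) * D2 a b"
    unfolding D_def D1_def D2_def C S by (simp_all add: algebra_simps)
  then show "D (a + L) (b + L) = D a b" "D1 (a + L) (b + L) = D1 a b" "D2 (a + L) (b + L) = D2 a b"
    by (simp_all add: wronskian)
qed

section \<open>End slopes and energy of a gap, with their derivatives\<close>

definition p :: "real \<Rightarrow> real \<Rightarrow> real" where "p a b = (1 + D1 a b) / D a b"
definition q :: "real \<Rightarrow> real \<Rightarrow> real" where "q a b = (D2 a b - 1) / D a b"
text \<open>\<open>p\<close> and \<open>q\<close> are the slopes at \<open>a\<close> and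
  \<open>b\<close> of the solution with value 1 at both ends, and \<open>q - p\<close> is the
  boundary term left when its energy is integrated by parts. \<open>E1\<close> to \<open>E22\<close>
  are the partial derivatives of \<open>E\<close> of orders one and two.\<close>

definition E :: "real \<Rightarrow> real \<Rightarrow> real" where "E a b = q a b - p a b"
definition E1 :: "real \<Rightarrow> real \<Rightarrow> real" where "E1 a b = (p a b)\<^sup>2 + \<kappa> a"
definition E2 :: "real \<Rightarrow> real \<Rightarrow> real" where "E2 a b = - ((q a b)\<^sup>2 + \<kappa> b)"
definition E11 :: "real \<Rightarrow> real \<Rightarrow> real" where
  "E11 a b = deriv \<kappa> a - 2 * p a b * (\<kappa> a + p a b * D1 a b / D a b)"
definition E12 :: "real \<Rightarrow> real \<Rightarrow> real" where "E12 a b = - 2 * p a b * q a b / D a b"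
definition E22 :: "real \<Rightarrow> real \<Rightarrow> real" where
  "E22 a b = 2 * q a b * (\<kappa> b + q a b * D2 a b / D a b) - deriv \<kappa> b"

text \<open>Division by zero yields 0, which is also the limit of \<open>E\<close> at the diagonal:
  a degenerate gap costs nothing.\<close>

lemma E_diag [simp]: "E a a = 0"
  by (simp add: E_def p_def q_def)

lemma E_periodic: "E (a + L) (b + L) = E a b"
  by (simp add: E_def p_def q_def D_periodic)

text \<open>The quotient rule produces \<open>D * D12\<close>, which \<open>D_identity\<close> turns
  into \<open>1 + D1 * D2\<close>; after cancellation the mixed derivatives are just
  \<open>- q / D\<close> and \<open>p / D\<close>.\<close>

lemma pq_has_derivative:
  assumes x: "(x has_real_derivative x') (at t)" and y: "(y has_real_derivative y') (at t)"
    and nz: "D (x t) (y t) \<noteq> 0"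
  shows "((\<lambda>t. p (x t) (y t)) has_real_derivative
      - (\<kappa> (x t) + p (x t) (y t) * D1 (x t) (y t) / D (x t) (y t)) * x'
      - q (x t) (y t) / D (x t) (y t) * y') (at t)"
    and "((\<lambda>t. q (x t) (y t)) has_real_derivative
      p (x t) (y t) / D (x t) (y t) * x'
      - (\<kappa> (y t) + q (x t) (y t) * D2 (x t) (y t) / D (x t) (y t)) * y') (at t)"
proof -
  let ?a = "x t" and ?b = "y t"
  note id = D_identity[of ?a ?b]
  have "(- \<kappa> ?a * D ?a ?b * x' + D12 ?a ?b * y') * D ?a ?b - (1 + D1 ?a ?b) * (D1 ?a ?b * x' + D2 ?a ?b * y')
     - ((- \<kappa> ?a * D ?a ?b * D ?a ?b - (1 + D1 ?a ?b) * D1 ?a ?b) * x' + (1 - D2 ?a ?b) * y')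
     = - y' * (D1 ?a ?b * D2 ?a ?b - D ?a ?b * D12 ?a ?b + 1)"
    by (simp add: algebra_simps)
  then have "(- \<kappa> ?a * D ?a ?b * x' + D12 ?a ?b * y') * D ?a ?b - (1 + D1 ?a ?b) * (D1 ?a ?b * x' + D2 ?a ?b * y')
     = (- \<kappa> ?a * D ?a ?b * D ?a ?b - (1 + D1 ?a ?b) * D1 ?a ?b) * x' + (1 - D2 ?a ?b) * y'"
    using id by simp
  then show "((\<lambda>t. p (x t) (y t)) has_real_derivative
      - (\<kappa> (x t) + p (x t) (y t) * D1 (x t) (y t) / D (x t) (y t)) * x'
      - q (x t) (y t) / D (x t) (y t) * y') (at t)"
    unfolding p_def q_def using nz
    by (auto intro!: derivative_eq_intros D_has_derivative[OF x y] simp: field_simps)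
  have "(D12 ?a ?b * x' - \<kappa> ?b * D ?a ?b * y') * D ?a ?b - (D2 ?a ?b - 1) * (D1 ?a ?b * x' + D2 ?a ?b * y')
     - ((1 + D1 ?a ?b) * x' - (\<kappa> ?b * D ?a ?b * D ?a ?b + (D2 ?a ?b - 1) * D2 ?a ?b) * y')
     = - x' * (D1 ?a ?b * D2 ?a ?b - D ?a ?b * D12 ?a ?b + 1)"
    by (simp add: algebra_simps)
  then have "(D12 ?a ?b * x' - \<kappa> ?b * D ?a ?b * y') * D ?a ?b - (D2 ?a ?b - 1) * (D1 ?a ?b * x' + D2 ?a ?b * y')
     = (1 + D1 ?a ?b) * x' - (\<kappa> ?b * D ?a ?b * D ?a ?b + (D2 ?a ?b - 1) * D2 ?a ?b) * y'"
    using id by simp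
  then show "((\<lambda>t. q (x t) (y t)) has_real_derivative
      p (x t) (y t) / D (x t) (y t) * x'
      - (\<kappa> (y t) + q (x t) (y t) * D2 (x t) (y t) / D (x t) (y t)) * y') (at t)"
    unfolding p_def q_def using nz
    by (auto intro!: derivative_eq_intros D_has_derivative[OF x y] simp: field_simps)
qed

lemma E_has_derivative:
  assumes x: "(x has_real_derivative x') (at t)" and y: "(y has_real_derivative y') (at t)"
    and nz: "D (x t) (y t) \<noteq> 0"
  shows "((\<lambda>t. E (x t) (y t)) has_real_derivative E1 (x t) (y t) * x' + E2 (x t) (y t) * y') (at t)"
    and "((\<lambda>t. E1 (x t) (y t)) has_real_derivative E11 (x t) (y t) * x' + E12 (x t) (y t) * y') (at t)"
    and "((\<lambda>t. E2 (x t) (y t)) has_real_derivative E12 (x t) (y t) * x' + E22 (x t) (y t) * y') (at t)"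
proof -
  let ?a = "x t" and ?b = "y t"
  note d = pq_has_derivative[OF x y nz]
  \<comment> \<open>By the definitions of \<open>p\<close> and \<open>q\<close>; this is how the
    first derivatives of \<open>E\<close> become squares of slopes.\<close>
  have "p ?a ?b / D ?a ?b + p ?a ?b * D1 ?a ?b / D ?a ?b = (p ?a ?b)\<^sup>2"
    "q ?a ?b / D ?a ?b - q ?a ?b * D2 ?a ?b / D ?a ?b = - (q ?a ?b)\<^sup>2"
    by (simp_all add: p_def q_def power2_eq_square add_divide_distrib diff_divide_distrib
        algebra_simps)
  then have e: "p ?a ?b / D ?a ?b = (p ?a ?b)\<^sup>2 - p ?a ?b * D1 ?a ?b / D ?a ?b"
    "q ?a ?b / D ?a ?b = q ?a ?b * D2 ?a ?b / D ?a ?b - (q ?a ?b)\<^sup>2"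
    by linarith+
  show "((\<lambda>t. E (x t) (y t)) has_real_derivative E1 (x t) (y t) * x' + E2 (x t) (y t) * y') (at t)"
    unfolding E_def E1_def E2_def
    by (rule DERIV_cong[OF DERIV_diff[OF d(2,1)]]) (simp only: e, simp add: algebra_simps)
  show "((\<lambda>t. E1 (x t) (y t)) has_real_derivative E11 (x t) (y t) * x' + E12 (x t) (y t) * y') (at t)"
    unfolding E1_def E11_def E12_def
    by (rule derivative_eq_intros d(1) DERIV_chain2[OF d\<kappa> x] refl)+ (simp add: algebra_simps)
  show "((\<lambda>t. E2 (x t) (y t)) has_real_derivative E12 (x t) (y t) * x' + E22 (x t) (y t) * y') (at t)"
    unfolding E2_def E22_def E12_def
    by (rule derivative_eq_intros d(2) DERIV_chain2[OF d\<kappa> y] refl)+ (simp add: algebra_simps)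
qed

text \<open>With \<open>E = (D2 - D1 - 2) / D\<close> and the denominators cleared, the two sides
  differ by a combination of the three relations in \<open>D_three_points\<close>.\<close>

lemma E_split:
  assumes "D a b \<noteq> 0" "D a c \<noteq> 0" "D c b \<noteq> 0"
  shows "E a c + E c b - E a b = (D a b - D a c - D c b)\<^sup>2 / (D a b * D a c * D c b)"
proof -
  have E: "E a b = (D2 a b - D1 a b - 2) / D a b" for a b
    by (simp add: E_def p_def q_def diff_divide_distrib[symmetric])
  have "D c b * D a b * (D2 a c - D1 a c - 2) + D a c * D a b * (D2 c b - D1 c b - 2)
      - D a c * D c b * (D2 a b - D1 a b - 2) - (D a b - D a c - D c b)\<^sup>2
      = D a b * (D c b * D2 a c - D a c * D1 c b - D a b)
      + D a c * (D a b * D2 c b - D c b * D2 a b - D a c)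
      + D c b * (D a c * D1 a b - D a b * D1 a c - D c b)"
    by (simp add: algebra_simps power2_eq_square)
  also have "\<dots> = 0"
    by (simp add: D_three_points)
  finally have "D c b * D a b * (D2 a c - D1 a c - 2) + D a c * D a b * (D2 c b - D1 c b - 2)
      - D a c * D c b * (D2 a b - D1 a b - 2) = (D a b - D a c - D c b)\<^sup>2"
    by simp
  then show ?thesis unfolding E using assms by (simp add: field_simps)
qed

end


section \<open>Intervals without conjugate points\<close>

context jacobi
begin

text \<open>Absence of conjugate points, expressed by a positive solution on the closed interval.
  This form is visibly inherited by subintervals and stable under small changes of the ends;
  \<open>adm_iff\<close> relates it to \<open>D\<close>. Degenerate intervals are included.\<close>

definition adm :: "real \<Rightarrow> real \<Rightarrow> bool" where
  "adm a b \<longleftrightarrow> a \<le> b \<and> (\<exists>\<alpha> \<beta>. \<forall>t\<in>{a..b}. 0 < \<alpha> * C t + \<beta> * S t)"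

lemma adm_le: "adm a b \<Longrightarrow> a \<le> b"
  by (simp add: adm_def)

lemma adm_subset: "adm a b \<Longrightarrow> a \<le> c \<Longrightarrow> c \<le> d \<Longrightarrow> d \<le> b \<Longrightarrow> adm c d"
  unfolding adm_def by (metis atLeastAtMost_iff order_trans)

text \<open>For a positive solution \<open>w\<close>, the quotient \<open>D x t / w t\<close> is 0
  at \<open>t = x\<close> and has the derivative \<open>w x / (w t)^2 > 0\<close>.\<close>

lemma D_pos:
  assumes "adm a b" "a \<le> x" "x < y" "y \<le> b"
  shows "0 < D x y"
proof -
  obtain \<alpha> \<beta> where "\<forall>t\<in>{a..b}. 0 < \<alpha> * C t + \<beta> * S t"
    using assms(1) unfolding adm_def by blast
  then have pos: "\<And>t. a \<le> t \<Longrightarrow> t \<le> b \<Longrightarrow> 0 < \<alpha> * C t + \<beta> * S t" by simp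
  define w where "w t = \<alpha> * C t + \<beta> * S t" for t
  define w' where "w' t = \<alpha> * C' t + \<beta> * S' t" for t
  have dw: "(w has_real_derivative w' t) (at t)" for t
    unfolding w_def w'_def by (auto intro!: derivative_eq_intros dC dS)
  have id: "D2 x t * w t - D x t * w' t = w x" for t
  proof -
    have "D2 x t * w t - D x t * w' t = w x * (C t * S' t - S t * C' t)"
      unfolding D_def D2_def w_def w'_def by (simp add: algebra_simps)
    then show ?thesis by (simp add: wronskian)
  qed
  have "D x x / w x < D x y / w y"
  proof (rule DERIV_pos_imp_increasing[OF \<open>x < y\<close>])
    fix t assume t: "x \<le> t" "t \<le> y"
    then have "w t > 0" "w x > 0" using assms pos unfolding w_def by auto
    then have "((\<lambda>t. D x t / w t) has_real_derivative (D2 x t * w t - D x t * w' t) / (w t * w t)) (at t)"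
      by (intro DERIV_divide dD_right dw) auto
    then show "\<exists>z. ((\<lambda>t. D x t / w t) has_real_derivative z) (at t) \<and> 0 < z"
      unfolding id using \<open>w t > 0\<close> \<open>w x > 0\<close> by (metis divide_pos_pos mult_pos_pos)
  qed
  moreover have "w y > 0" using assms pos unfolding w_def by auto
  ultimately show ?thesis by (simp add: zero_less_divide_iff)
qed

lemma admI:
  assumes "a \<le> b" "\<And>x. a < x \<Longrightarrow> x \<le> b \<Longrightarrow> 0 < D a x"
  shows "adm a b"
proof (cases "a = b")
  case True
  have "C a \<noteq> 0 \<or> S a \<noteq> 0" using wronskian[of a] by auto
  then have "0 < C a * C a + S a * S a"
    by (metis sum_squares_gt_zero_iff)
  then have "\<forall>t\<in>{a..b}. 0 < C a * C t + S a * S t" by (simp add: True)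
  then show ?thesis unfolding adm_def using assms(1) by blast
next
  case False
  then have ab: "a < b" using assms(1) by simp
  \<comment> \<open>The quotient of the solutions vanishing at \<open>b\<close> and at
    \<open>a\<close> has the derivative \<open>- D a b / (D a x)^2 < 0\<close>, so it decreases to
    its value 0 at \<open>b\<close>.\<close>
  have right: "0 < D t b" if "a < t" "t < b" for t
  proof -
    have "D b b / D a b < D t b / D a t"
    proof (rule DERIV_neg_imp_decreasing[OF \<open>t < b\<close>])
      fix x assume x: "t \<le> x" "x \<le> b"
      then have "D a x > 0" using assms(2) that by auto
      moreover have "D a b > 0" using assms(2) ab by auto
      ultimately have "((\<lambda>x. D x b / D a x) has_real_derivative
          (D1 x b * D a x - D x b * D2 a x) / (D a x * D a x)) (at x)"
        by (intro DERIV_divide dD_right dD_left) auto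
      moreover have "D1 x b * D a x - D x b * D2 a x = - D a b"
        using D_three_points(1)[where a = a and b = b and c = x] by (simp add: algebra_simps)
      ultimately show "\<exists>z. ((\<lambda>x. D x b / D a x) has_real_derivative z) (at x) \<and> z < 0"
        using \<open>D a x > 0\<close> \<open>D a b > 0\<close> by (metis divide_neg_pos mult_pos_pos neg_less_0_iff_less)
    qed
    moreover have "D a t > 0" using assms(2) that by auto
    ultimately show ?thesis by (simp add: zero_less_divide_iff)
  qed
  \<comment> \<open>The witness is the sum of the solutions vanishing at the two ends: each is
    positive in the interior and at the other end.\<close>
  have "0 < (S b - S a) * C t + (C a - C b) * S t" if "a \<le> t" "t \<le> b" for t
  proof -
    have "(S b - S a) * C t + (C a - C b) * S t = D a t + D t b"
      by (simp add: D_def algebra_simps)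
    moreover have "D a b > 0" using assms(2) ab by auto
    ultimately show ?thesis
      using that right[of t] assms(2)[of t] by (cases "t = a"; cases "t = b") auto
  qed
  then have "\<forall>t\<in>{a..b}. 0 < (S b - S a) * C t + (C a - C b) * S t" by simp
  then show ?thesis unfolding adm_def using assms(1) by blast
qed

lemma adm_iff: "adm a b \<longleftrightarrow> a \<le> b \<and> (\<forall>x. a < x \<longrightarrow> x \<le> b \<longrightarrow> 0 < D a x)"
  using admI D_pos[of a b a] adm_le by blast

lemma adm_refl: "adm a a"
  by (rule admI) auto

lemma adm_periodic: "adm (a + L) (b + L) \<longleftrightarrow> adm a b"
proof -
  have "(\<forall>x. a + L < x \<longrightarrow> x \<le> b + L \<longrightarrow> 0 < D (a + L) x) \<longleftrightarrow> (\<forall>x. a < x \<longrightarrow> x \<le> b \<longrightarrow> 0 < D a x)"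
    (is "?l \<longleftrightarrow> ?r")
  proof
    assume ?l
    show ?r
    proof (intro allI impI)
      fix x assume "a < x" "x \<le> b"
      then show "0 < D a x" using \<open>?l\<close>[rule_format, of "x + L"] by (simp add: D_periodic)
    qed
  next
    assume ?r
    show ?l
    proof (intro allI impI)
      fix x assume "a + L < x" "x \<le> b + L"
      then show "0 < D (a + L) x"
        using \<open>?r\<close>[rule_format, of "x - L"] D_periodic(1)[of a "x - L"] by simp
    qed
  qed
  then show ?thesis unfolding adm_iff by simp
qed

text \<open>The same positive solution works: inside the old interval by assumption, and beyond its
  ends by continuity.\<close>

lemma adm_open:
  assumes "adm a b"
  shows "\<exists>\<epsilon>>0. \<forall>x y. \<bar>x - a\<bar> < \<epsilon> \<longrightarrow> \<bar>y - b\<bar> < \<epsilon> \<longrightarrow> x \<le> y \<longrightarrow> adm x y"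
proof -
  obtain \<alpha> \<beta> where "\<forall>t\<in>{a..b}. 0 < \<alpha> * C t + \<beta> * S t" and "a \<le> b"
    using assms unfolding adm_def by blast
  then have pos: "\<And>t. a \<le> t \<Longrightarrow> t \<le> b \<Longrightarrow> 0 < \<alpha> * C t + \<beta> * S t" by simp
  define w where "w t = \<alpha> * C t + \<beta> * S t" for t
  have "isCont w t" for t
    unfolding w_def by (intro continuous_intros DERIV_isCont[OF dC] DERIV_isCont[OF dS])
  have near: "\<exists>\<epsilon>>0. \<forall>x. \<bar>x - t\<bar> < \<epsilon> \<longrightarrow> 0 < w x" if "w t > 0" for t
  proof -
    have "continuous_on UNIV w"
      using \<open>\<And>t. isCont w t\<close> by (simp add: continuous_at_imp_continuous_on)
    then have "open {x. 0 < w x}" by (intro open_Collect_less continuous_on_const)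
    then show ?thesis using that unfolding open_real by auto
  qed
  obtain e1 where e1: "e1 > 0" "\<And>x. \<bar>x - a\<bar> < e1 \<Longrightarrow> 0 < w x"
    using near[of a] pos[of a] \<open>a \<le> b\<close> by (auto simp: w_def)
  obtain e2 where e2: "e2 > 0" "\<And>x. \<bar>x - b\<bar> < e2 \<Longrightarrow> 0 < w x"
    using near[of b] pos[of b] \<open>a \<le> b\<close> by (auto simp: w_def)
  show ?thesis
  proof (intro exI[of _ "min e1 e2"] conjI allI impI)
    fix x y assume xy: "\<bar>x - a\<bar> < min e1 e2" "\<bar>y - b\<bar> < min e1 e2" "x \<le> y"
    have "0 < w t" if "x \<le> t" "t \<le> y" for t
    proof -
      consider "t < a" | "a \<le> t" "t \<le> b" | "b < t" by linarith
      then show ?thesis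
        by cases (use e1(2)[of t] e2(2)[of t] pos[of t] xy that in \<open>auto simp: w_def\<close>)
    qed
    then have "\<forall>t\<in>{x..y}. 0 < \<alpha> * C t + \<beta> * S t" by (simp add: w_def)
    then show "adm x y" unfolding adm_def using xy(3) by blast
  qed (use e1 e2 in auto)
qed

text \<open>\<open>low\<close> is a lower bound on the energy multiplied by \<open>D a b\<close>, so
  that it makes sense before \<open>D a b\<close> is known to be nonzero. An interior zero of
  \<open>D a\<close> would be a minimum, hence a double zero, against \<open>D_identity\<close>. The
  end point needs \<open>low\<close>.\<close>

lemma adm_limit:
  assumes "a < b" "\<And>x. a \<le> x \<Longrightarrow> x \<le> b \<Longrightarrow> 0 \<le> D a x"
    and low: "- M * D a b \<le> D2 a b - D1 a b - 2"
  shows "adm a b"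
proof (rule admI)
  have id: "D1 a x * D2 a x = - 1" if "D a x = 0" for x
    using D_identity[of a x] that by simp
  have inner: "0 < D a x" if "a < x" "x < b" for x
  proof (rule ccontr)
    assume "\<not> 0 < D a x"
    then have z: "D a x = 0" using assms(2)[of x] that by auto
    have "D2 a x = 0"
    proof (rule DERIV_local_min[OF dD_right])
      show "0 < min (x - a) (b - x)" using that by simp
      show "\<forall>y. \<bar>x - y\<bar> < min (x - a) (b - x) \<longrightarrow> D a x \<le> D a y"
        unfolding z using assms(2) by (auto simp: abs_less_iff)
    qed
    then show False using id[OF z] by simp
  qed
  have "D a b \<noteq> 0"
  proof
    assume z: "D a b = 0"
    have "\<not> 0 < D2 a b"
    proof
      assume "0 < D2 a b"
      then obtain d where d: "d > 0" "\<And>h. 0 < h \<Longrightarrow> h < d \<Longrightarrow> D a (b - h) < D a b"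
        using DERIV_pos_inc_left[OF dD_right] by blast
      define h where "h = min (d / 2) (b - a)"
      have "0 < h" "h < d" "h \<le> b - a" using d(1) assms(1) by (auto simp: h_def)
      then show False using d(2)[of h] assms(2)[of "b - h"] z by auto
    qed
    moreover have "D2 a b \<noteq> 0" using id[OF z] by auto
    \<comment> \<open>Now \<open>D1 a b > 0\<close>, as the product is -1. The right-hand side of
      \<open>low\<close> is then below -2, while its left-hand side is 0.\<close>
    ultimately have "D2 a b < 0" by simp
    then have "0 < D1 a b"
      using id[OF z] mult_nonpos_nonpos[of "D1 a b" "D2 a b"] by linarith
    then show False using low z \<open>D2 a b < 0\<close> by simp
  qed
  then show "0 < D a x" if "a < x" "x \<le> b" for x
    using inner[of x] that assms(2)[of b] assms(1) by (cases "x = b") auto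
qed (use assms in simp)

section \<open>The minimiser of a gap: the solution with value 1 at both ends\<close>

definition phi :: "real \<Rightarrow> real \<Rightarrow> real \<Rightarrow> real" where "phi a b t = (D a t + D t b) / D a b"
definition phi' :: "real \<Rightarrow> real \<Rightarrow> real \<Rightarrow> real" where "phi' a b t = (D2 a t + D1 t b) / D a b"

lemma dphi: "(phi a b has_real_derivative phi' a b t) (at t)"
  unfolding phi_def[abs_def] phi'_def by (intro DERIV_cdivide DERIV_add dD_right dD_left)

lemma dphi': "(phi' a b has_real_derivative - \<kappa> t * phi a b t) (at t)"
proof -
  have "(phi' a b has_real_derivative (- \<kappa> t * D a t + - \<kappa> t * D t b) / D a b) (at t)"
    unfolding phi'_def[abs_def] by (intro DERIV_cdivide DERIV_add dD2_right dD1_left)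
  then show ?thesis by (simp add: phi_def distrib_left diff_divide_distrib)
qed

lemma phi_ends:
  assumes "D a b \<noteq> 0"
  shows "phi a b a = 1" "phi a b b = 1" "phi' a b a = p a b" "phi' a b b = q a b"
  using assms by (auto simp: phi_def phi'_def p_def q_def)

lemma phi_periodic: "phi (a + L) (b + L) (t + L) = phi a b t"
  by (simp add: phi_def D_periodic)

lemma phi_pos:
  assumes "adm a b" "a < b" "a \<le> t" "t \<le> b"
  shows "0 < phi a b t"
proof -
  have "0 < D a b" using D_pos[OF assms(1)] assms(2) by auto
  moreover have "0 < D a t + D t b"
  proof (cases "t = a \<or> t = b")
    case False
    then have "0 < D a t" "0 < D t b" using D_pos[OF assms(1)] assms by auto
    then show ?thesis by simp
  qed (use \<open>0 < D a b\<close> in auto)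
  ultimately show ?thesis by (simp add: phi_def)
qed

lemma phi'_decreasing:
  assumes "adm a b" "a < b" "a \<le> x" "x < y" "y \<le> b"
  shows "phi' a b y < phi' a b x"
proof (rule DERIV_neg_imp_decreasing[OF \<open>x < y\<close>])
  fix t assume "x \<le> t" "t \<le> y"
  then have "0 < \<kappa> t * phi a b t" using assms phi_pos[of a b t] \<kappa>_pos[of t] by simp
  then have "- \<kappa> t * phi a b t < 0" by simp
  then show "\<exists>z. (phi' a b has_real_derivative z) (at t) \<and> z < 0"
    using dphi'[of a b t] by blast
qed

text \<open>The slope vanishes somewhere inside by the mean value theorem and is strictly
  decreasing, so it is positive before that point and negative after it.\<close>

lemma phi_bounce:
  assumes "adm a b" "a < b"
  shows "0 < p a b" "q a b < 0" "\<And>t. a < t \<Longrightarrow> t < b \<Longrightarrow> 1 < phi a b t"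
proof -
  have nz: "D a b \<noteq> 0" using D_pos[OF assms(1), of a b] assms(2) by auto
  have "\<exists>l z. a < z \<and> z < b \<and> DERIV (phi a b) z :> l \<and> phi a b b - phi a b a = (b - a) * l"
    by (rule MVT[OF \<open>a < b\<close>])
       (auto intro!: continuous_at_imp_continuous_on DERIV_isCont[OF dphi] intro: dphi simp: real_differentiable_def)
  then obtain z where z: "a < z" "z < b" "phi' a b z = 0"
    using phi_ends[OF nz] DERIV_unique[OF dphi] assms(2) by force
  show "0 < p a b"
    using phi'_decreasing[OF assms, of a z] z phi_ends[OF nz] by auto
  show "q a b < 0"
    using phi'_decreasing[OF assms, of z b] z phi_ends[OF nz] by auto
  fix t assume t: "a < t" "t < b"
  show "1 < phi a b t"
  proof (cases "t \<le> z")
    case True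
    have "phi a b a < phi a b t"
    proof (rule DERIV_pos_imp_increasing_open[OF t(1)])
      fix x assume x: "a < x" "x < t"
      then have "0 < phi' a b x" using phi'_decreasing[OF assms, of x z] z True by auto
      then show "\<exists>y. (phi a b has_real_derivative y) (at x) \<and> 0 < y" using dphi by blast
    qed (auto intro!: continuous_at_imp_continuous_on DERIV_isCont[OF dphi])
    then show ?thesis using phi_ends[OF nz] by simp
  next
    case False
    have "phi a b b < phi a b t"
    proof (rule DERIV_neg_imp_decreasing_open[OF t(2)])
      fix x assume x: "t < x" "x < b"
      then have "phi' a b x < 0" using phi'_decreasing[OF assms, of z x] z False by auto
      then show "\<exists>y. (phi a b has_real_derivative y) (at x) \<and> y < 0" using dphi by blast
    qed (auto intro!: continuous_at_imp_continuous_on DERIV_isCont[OF dphi])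
    then show ?thesis using phi_ends[OF nz] by simp
  qed
qed

lemma E_nonpos: "adm a b \<Longrightarrow> E a b \<le> 0"
  using phi_bounce[of a b] adm_le[of a b] by (cases "a = b") (auto simp: E_def)

text \<open>\<open>phi a b c > 1\<close> says that \<open>D a c + D c b\<close> exceeds
  \<open>D a b\<close>, so the square in \<open>E_split\<close> is not 0.\<close>

lemma E_split_less:
  assumes "adm a b" "a < c" "c < b"
  shows "E a b < E a c + E c b"
proof -
  have pos: "0 < D a b" "0 < D a c" "0 < D c b" using D_pos[OF assms(1)] assms by auto
  have "1 < phi a b c" using phi_bounce(3)[OF assms(1)] assms by auto
  then have "D a b < D a c + D c b" using pos by (simp add: phi_def)
  then have "0 < (D a b - D a c - D c b)\<^sup>2 / (D a b * D a c * D c b)" using pos by simp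
  then show ?thesis using E_split[of a b c] pos by simp
qed

text \<open>Sturm comparison with u'' = - k u by a Picone identity:
  \<open>G = D D' - D^2 w'/w\<close> is nondecreasing, vanishes at \<open>a\<close> and at any zero
  of \<open>D a\<close>, but starts with a positive slope.\<close>

lemma adm_comparison:
  assumes "a < b" "\<And>t. \<kappa> t \<le> k" "(b - a)\<^sup>2 * k < pi\<^sup>2"
  shows "adm a b"
proof (rule admI)
  show "a \<le> b" using assms by simp
  have k: "0 < k" using \<kappa>_pos[of 0] assms(2)[of 0] by simp
  define \<mu> where "\<mu> = sqrt k"
  have \<mu>: "0 < \<mu>" "\<mu> * \<mu> = k" using k by (auto simp: \<mu>_def)
  have "(\<mu> * (b - a))\<^sup>2 = (b - a)\<^sup>2 * k"
    unfolding \<mu>(2)[symmetric] by (simp add: power2_eq_square mult_ac)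
  then have "(\<mu> * (b - a))\<^sup>2 < pi\<^sup>2" using assms(3) by simp
  then have lt: "\<mu> * (b - a) < pi" by (rule power2_less_imp_less) simp
  \<comment> \<open>Half of the slack below pi: the shifted sine is then positive on the closed
    interval, including its left end.\<close>
  define \<delta> where "\<delta> = (pi - \<mu> * (b - a)) / 2"
  have \<delta>: "0 < \<delta>" "\<mu> * (b - a) + \<delta> < pi" using lt by (auto simp: \<delta>_def field_simps)
  define w where "w t = sin (\<mu> * (t - a) + \<delta>)" for t
  define w' where "w' t = \<mu> * cos (\<mu> * (t - a) + \<delta>)" for t
  have dw: "(w has_real_derivative w' t) (at t)" for t
    unfolding w_def w'_def by (auto intro!: derivative_eq_intros)
  have dw': "(w' has_real_derivative - k * w t) (at t)" for t
    unfolding w_def w'_def \<mu>(2)[symmetric] by (auto intro!: derivative_eq_intros)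
  have w: "0 < w t" if "a \<le> t" "t \<le> b" for t
  proof -
    have "0 \<le> \<mu> * (t - a)" "\<mu> * (t - a) \<le> \<mu> * (b - a)" using that \<mu> by auto
    then show ?thesis unfolding w_def using \<delta> by (intro sin_gt_zero) auto
  qed
  obtain d where d: "d > 0" "\<And>h. 0 < h \<Longrightarrow> h < d \<Longrightarrow> D a a < D a (a + h)"
    using DERIV_pos_inc_right[OF dD_right[of a a]] by auto
  have nz: "D a x \<noteq> 0" if x: "a < x" "x \<le> b" for x
  proof
    assume z: "D a x = 0"
    define G where "G t = D a t * D2 a t - (D a t)\<^sup>2 * (w' t / w t)" for t
    have dG: "(G has_real_derivative (D2 a t - D a t * w' t / w t)\<^sup>2 + (k - \<kappa> t) * (D a t)\<^sup>2) (at t)"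
      if "a \<le> t" "t \<le> b" for t
    proof -
      have "w t \<noteq> 0" using w[OF that] by simp
      have "(G has_real_derivative (D2 a t * D2 a t + - \<kappa> t * D a t * D a t)
          - (2 * D2 a t * D a t * (w' t / w t) + (- k * w t * w t - w' t * w' t) / (w t * w t) * (D a t)\<^sup>2)) (at t)"
        unfolding G_def using \<open>w t \<noteq> 0\<close>
        by (intro DERIV_diff DERIV_mult DERIV_divide dD_right dD2_right dw dw')
           (rule DERIV_cong[OF DERIV_power[OF dD_right]], simp)
      then show ?thesis
        by (rule DERIV_cong) (use \<open>w t \<noteq> 0\<close> in \<open>simp add: field_simps power2_eq_square\<close>)
    qed
    have mono: "G s \<le> G t" if "a \<le> s" "s \<le> t" "t \<le> x" for s t
    proof (rule DERIV_nonneg_imp_nondecreasing[OF \<open>s \<le> t\<close>])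
      fix r assume "s \<le> r" "r \<le> t"
      then have "a \<le> r" "r \<le> b" using that x by auto
      moreover have "0 \<le> (D2 a r - D a r * w' r / w r)\<^sup>2 + (k - \<kappa> r) * (D a r)\<^sup>2"
        using assms(2)[of r] by simp
      ultimately show "\<exists>y. (G has_real_derivative y) (at r) \<and> 0 \<le> y"
        using dG by blast
    qed
    have "G a = 0" "G x = 0" using z by (auto simp: G_def)
    \<comment> \<open>The slope of \<open>G\<close> at \<open>a\<close> is 1, because
      \<open>D a a = 0\<close> and \<open>D2 a a = 1\<close>.\<close>
    have "0 < (D2 a a - D a a * w' a / w a)\<^sup>2 + (k - \<kappa> a) * (D a a)\<^sup>2" by simp
    from DERIV_pos_inc_right[OF dG this] obtain e where
      e: "e > 0" "\<And>h. 0 < h \<Longrightarrow> h < e \<Longrightarrow> G a < G (a + h)" using assms(1) by auto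
    define h where "h = min (e / 2) (x - a)"
    have "0 < h" "h < e" "a + h \<le> x" using e(1) x by (auto simp: h_def)
    then show False using e(2)[of h] mono[of "a + h" x] \<open>G a = 0\<close> \<open>G x = 0\<close> by auto
  qed
  show "0 < D a x" if x: "a < x" "x \<le> b" for x
  proof (rule ccontr)
    assume "\<not> 0 < D a x"
    define h where "h = min (d / 2) (x - a)"
    have h: "0 < h" "h < d" "a + h \<le> x" using d(1) x by (auto simp: h_def)
    then have "D a (a + h) > 0" using d(2) by simp
    moreover have "D a x \<le> 0" using \<open>\<not> 0 < D a x\<close> by simp
    moreover have "continuous_on {a + h..x} (D a)"
      by (auto intro!: continuous_at_imp_continuous_on DERIV_isCont[OF dD_right])
    ultimately obtain y where "a + h \<le> y" "y \<le> x" "D a y = 0"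
      using IVT2'[of "D a" x 0 "a + h"] h by auto
    then show False using nz[of y] h x by auto
  qed
qed

end


section \<open>The energy of a gap\<close>

context jacobi
begin

lemma \<kappa>_continuous: "continuous_on A \<kappa>"
  using smooth_on_continuous[OF \<kappa>_smooth] continuous_on_subset by blast

lemma \<kappa>_bounded_on: "\<exists>B. \<forall>x\<in>{a..b}. \<kappa> x \<le> B"
proof -
  have "bounded (\<kappa> ` {a..b})"
    by (intro compact_imp_bounded compact_continuous_image \<kappa>_continuous) auto
  then obtain B where "\<forall>x\<in>{a..b}. \<bar>\<kappa> x\<bar> \<le> B" by (auto simp: bounded_iff)
  then show ?thesis by (auto simp: abs_le_iff)
qed

text \<open>Bootstrapping: each of \<open>u\<close> and \<open>u'\<close> gains an order from the
  other, the second through the smooth factor \<kappa>.\<close>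

lemma solution_smooth:
  assumes du: "\<And>t. (u has_real_derivative u' t) (at t)"
    and du': "\<And>t. (u' has_real_derivative - \<kappa> t * u t) (at t)"
  shows "smooth_on UNIV u"
proof -
  have "times_differentiable_on k UNIV u \<and> times_differentiable_on k UNIV u'" for k
  proof (induction k)
    case 0
    show ?case
      by (auto intro!: continuous_at_imp_continuous_on DERIV_isCont[OF du] DERIV_isCont[OF du'])
  next
    case (Suc k)
    have "times_differentiable_on (Suc k) UNIV u"
      by (rule times_differentiable_real_SucI[OF open_UNIV du]) (use Suc in simp)
    moreover have "times_differentiable_on (Suc k) UNIV u'"
      by (rule times_differentiable_real_SucI[OF open_UNIV du'])
         (intro times_differentiable_mult[OF open_UNIV] times_differentiable_uminus[OF open_UNIV] smooth_on_imp_times_differentiable[OF \<kappa>_smooth] Suc[THEN conjunct1])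
    ultimately show ?case by blast
  qed
  then show ?thesis by (simp add: smooth_on_def)
qed

lemma phi_smooth: "smooth_on UNIV (phi a b)"
  by (rule solution_smooth[OF dphi dphi'])

lemma phi_continuous: "continuous_on A (phi a b)" "continuous_on A (phi' a b)"
  by (auto intro!: continuous_at_imp_continuous_on DERIV_isCont[OF dphi] DERIV_isCont[OF dphi'])

lemma energy_phi:
  assumes "a < b" "D a b \<noteq> 0"
  shows "(LINT x|lebesgue_on {a<..<b}. (phi' a b x)\<^sup>2 - \<kappa> x * (phi a b x)\<^sup>2) = E a b"
proof -
  have "(LINT x|lebesgue_on {a<..<b}. (phi' a b x)\<^sup>2 - \<kappa> x * (phi a b x)\<^sup>2) =
      phi a b b * phi' a b b - phi a b a * phi' a b a"
  proof (rule integral_Ioo_FTC)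
    show "continuous_on {a..b} (\<lambda>x. (phi' a b x)\<^sup>2 - \<kappa> x * (phi a b x)\<^sup>2)"
      by (intro continuous_intros phi_continuous \<kappa>_continuous)
    show "((\<lambda>x. phi a b x * phi' a b x) has_real_derivative (phi' a b x)\<^sup>2 - \<kappa> x * (phi a b x)\<^sup>2) (at x)" for x
      by (rule DERIV_cong[OF DERIV_mult[OF dphi dphi']]) (simp add: power2_eq_square algebra_simps)
  qed (use assms in simp)
  then show ?thesis by (simp add: phi_ends[OF assms(2)] E_def)
qed

text \<open>Calibration: with \<open>h = f - phi\<close> and \<open>w = phi\<close>, the integrand minus the square
  \<open>(h' - h w' / w)\<^sup>2\<close> is the derivative of \<open>2 h phi' + phi phi' + h\<^sup>2 w' / w\<close>.\<close>

lemma energy_lower_bound: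
  assumes ad: "adm a b" and ab: "a < b"
    and df: "\<And>t. (f has_real_derivative f' t) (at t)" and cf': "continuous_on UNIV f'"
    and ends: "f a = 1" "f b = 1"
  shows "E a b \<le> (LINT x|lebesgue_on {a<..<b}. (f' x)\<^sup>2 - \<kappa> x * (f x)\<^sup>2)"
proof -
  have nz: "D a b \<noteq> 0" using D_pos[OF ad, of a b] ab by auto
  define G where "G t = 2 * (f t - phi a b t) * phi' a b t + phi a b t * phi' a b t
      + (f t - phi a b t)\<^sup>2 * (phi' a b t / phi a b t)" for t
  define r where "r t = ((f' t - phi' a b t) - (f t - phi a b t) * phi' a b t / phi a b t)\<^sup>2" for t
  have cf: "continuous_on A f" for A
    by (auto intro!: continuous_at_imp_continuous_on DERIV_isCont[OF df])
  have cf'': "continuous_on A f'" for A using cf' continuous_on_subset by blast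
  have pos: "phi a b t \<noteq> 0" if "a \<le> t" "t \<le> b" for t using phi_pos[OF ad ab that] by simp
  have dG: "(G has_real_derivative (f' t)\<^sup>2 - \<kappa> t * (f t)\<^sup>2 - r t) (at t)" if t: "a \<le> t" "t \<le> b" for t
  proof -
    note nz = pos[OF t]
    have "(G has_real_derivative
        (2 * (f' t - phi' a b t) * phi' a b t + - \<kappa> t * phi a b t * (2 * (f t - phi a b t)))
        + (phi' a b t * phi' a b t + - \<kappa> t * phi a b t * phi a b t)
        + (2 * (f' t - phi' a b t) * (f t - phi a b t) * (phi' a b t / phi a b t)
          + (- \<kappa> t * phi a b t * phi a b t - phi' a b t * phi' a b t) / (phi a b t * phi a b t)
            * (f t - phi a b t)\<^sup>2)) (at t)"
      unfolding G_def[abs_def] using nz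
      by (intro DERIV_add DERIV_mult DERIV_divide DERIV_cmult DERIV_diff dphi dphi' df)
         (rule DERIV_cong[OF DERIV_power[OF DERIV_diff[OF df dphi]]], simp)
    then show ?thesis
      by (rule DERIV_cong) (use nz in \<open>simp add: r_def field_simps power2_eq_square\<close>)
  qed
  have "continuous_on {a..b} r"
    unfolding r_def[abs_def] by (intro continuous_intros cf cf'' phi_continuous) (auto simp: pos)
  note c = this
  have c2: "continuous_on {a..b} (\<lambda>t. (f' t)\<^sup>2 - \<kappa> t * (f t)\<^sup>2)"
    by (intro continuous_intros cf cf'' \<kappa>_continuous)
  have "(LINT x|lebesgue_on {a<..<b}. (f' x)\<^sup>2 - \<kappa> x * (f x)\<^sup>2 - r x) = G b - G a"
    by (rule integral_Ioo_FTC[OF less_imp_le[OF ab] _ dG]) (intro continuous_on_diff c c2)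
  also have "\<dots> = E a b"
    unfolding G_def by (simp add: ends phi_ends[OF nz] E_def)
  finally have "(LINT x|lebesgue_on {a<..<b}. (f' x)\<^sup>2 - \<kappa> x * (f x)\<^sup>2)
      - (LINT x|lebesgue_on {a<..<b}. r x) = E a b"
    by (subst Bochner_Integration.integral_diff[symmetric]) (auto intro: integrable_on_Ioo c c2)
  moreover have "0 \<le> (LINT x|lebesgue_on {a<..<b}. r x)"
    by (rule integral_nonneg_AE) (simp add: r_def)
  ultimately show ?thesis by linarith
qed

text \<open>Pointwise comparison of the energies of a test function and of its limit. The cross
  terms are absorbed into factors close to 1 and a multiple of the squared H^1 distance, so the
  integrals can be compared by first sending that distance and then \<epsilon> to 0.\<close>

lemma energy_perturbation:
  fixes u v \<psi> \<psi>' k B \<epsilon> :: real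
  assumes "0 < \<epsilon>" "0 \<le> k" "k \<le> B"
  shows "\<psi>'\<^sup>2 - k * (1 + \<psi>)\<^sup>2 \<le> (1 + \<epsilon>) * v\<^sup>2 - inverse (1 + \<epsilon>) * (k * (1 + u)\<^sup>2)
    + (1 + 1 / \<epsilon> + B / \<epsilon>) * ((\<psi> - u)\<^sup>2 + (\<psi>' - v)\<^sup>2)"
proof -
  have young: "(x + y)\<^sup>2 \<le> (1 + \<epsilon>) * x\<^sup>2 + (1 + 1 / \<epsilon>) * y\<^sup>2" for x y :: real
  proof -
    have "(1 + \<epsilon>) * x\<^sup>2 + (1 + 1 / \<epsilon>) * y\<^sup>2 - (x + y)\<^sup>2 = (\<epsilon> * x - y)\<^sup>2 / \<epsilon>"
      using assms(1) by (simp add: field_simps power2_eq_square)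
    also have "\<dots> \<ge> 0" using assms(1) by simp
    finally show ?thesis by simp
  qed
  have 1: "\<psi>'\<^sup>2 \<le> (1 + \<epsilon>) * v\<^sup>2 + (1 + 1 / \<epsilon>) * (\<psi>' - v)\<^sup>2" using young[of v "\<psi>' - v"] by simp
  \<comment> \<open>Young's inequality for \<open>1 + u = (1 + \<psi>) + (u - \<psi>)\<close>.
    Dividing by \<open>1 + \<epsilon>\<close> leaves the coefficient \<open>1 / \<epsilon>\<close>,
    since \<open>(1 + 1 / \<epsilon>) / (1 + \<epsilon>) = 1 / \<epsilon>\<close>.\<close>
  have "(1 + u)\<^sup>2 \<le> (1 + \<epsilon>) * (1 + \<psi>)\<^sup>2 + (1 + 1 / \<epsilon>) * (u - \<psi>)\<^sup>2"
    using young[of "1 + \<psi>" "u - \<psi>"] by (simp add: algebra_simps)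
  then have "inverse (1 + \<epsilon>) * (1 + u)\<^sup>2 \<le> inverse (1 + \<epsilon>) * ((1 + \<epsilon>) * (1 + \<psi>)\<^sup>2 + (1 + 1 / \<epsilon>) * (u - \<psi>)\<^sup>2)"
    using assms(1) by (intro mult_left_mono) auto
  also have "\<dots> = (1 + \<psi>)\<^sup>2 + (\<psi> - u)\<^sup>2 / \<epsilon>"
  proof -
    have "inverse (1 + \<epsilon>) * ((1 + \<epsilon>) * x + (1 + \<epsilon>) * y) = x + y" for x y
      using assms(1) by (simp add: distrib_left[symmetric])
    from this[of "(1 + \<psi>)\<^sup>2" "(\<psi> - u)\<^sup>2 / \<epsilon>"] show ?thesis
      using assms(1) by (simp add: power2_commute[of u] add_divide_distrib distrib_right add.commute)
  qed
  finally have "k * (inverse (1 + \<epsilon>) * (1 + u)\<^sup>2) \<le> k * ((1 + \<psi>)\<^sup>2 + (\<psi> - u)\<^sup>2 / \<epsilon>)"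
    using assms(2) by (rule mult_left_mono)
  moreover have "k * ((\<psi> - u)\<^sup>2 / \<epsilon>) \<le> B * ((\<psi> - u)\<^sup>2 / \<epsilon>)"
    using assms by (intro mult_right_mono) auto
  moreover have "0 \<le> (1 + 1 / \<epsilon>) * (\<psi> - u)\<^sup>2" "0 \<le> B / \<epsilon> * (\<psi>' - v)\<^sup>2" using assms by auto
  ultimately show ?thesis using 1 by (simp add: algebra_simps)
qed

text \<open>The function \<open>phi\<close> attains the value. For the lower bound,
  \<open>energy_lower_bound\<close> handles competitors that are 1 plus a test function, and a
  general competitor is approximated by these, as the definition of \<open>H10\<close>
  provides.\<close>

lemma gap_energy_eq:
  assumes ad: "adm a b" and ab: "a < b"
  shows "gap_energy \<kappa> a b = ereal (E a b)"
proof (rule antisym)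
  let ?M = "lebesgue_on {a<..<b}"
  have nz: "D a b \<noteq> 0" using D_pos[OF ad, of a b] ab by auto
  have "H10 {a<..<b} (\<lambda>x. phi a b x - 1) (deriv (\<lambda>x. phi a b x - 1))"
  proof (rule H10_smooth[OF ab])
    show "smooth_on UNIV (\<lambda>x. phi a b x - 1)"
      unfolding smooth_on_def by (intro allI times_differentiable_diff times_differentiable_const open_UNIV smooth_on_imp_times_differentiable phi_smooth)
  qed (simp_all add: phi_ends[OF nz])
  moreover have "deriv (\<lambda>x. phi a b x - 1) = phi' a b"
    by (intro ext DERIV_imp_deriv) (auto intro!: derivative_eq_intros dphi)
  ultimately have H: "H10 {a<..<b} (\<lambda>x. phi a b x - 1) (phi' a b)" by simp
  show "gap_energy \<kappa> a b \<le> ereal (E a b)"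
    unfolding gap_energy_def energy_phi[OF ab nz, symmetric]
    by (rule INF_lower2[of "(phi a b, phi' a b)"]) (use H in auto)
  show "ereal (E a b) \<le> gap_energy \<kappa> a b"
    unfolding gap_energy_def
  proof (rule INF_greatest, safe)
    fix \<phi> v assume H: "H10 {a<..<b} (\<lambda>x. \<phi> x - 1) v"
    define u where "u x = \<phi> x - 1" for x
    have \<phi>: "\<phi> x = 1 + u x" for x by (simp add: u_def)
    have mu: "u \<in> borel_measurable ?M" and iu: "integrable ?M (\<lambda>x. (u x)\<^sup>2)"
      and mv: "v \<in> borel_measurable ?M" and iv: "integrable ?M (\<lambda>x. (v x)\<^sup>2)"
      using H unfolding H10_def square_integrable_on_def u_def[abs_def] by auto
    obtain \<psi> where test: "\<And>k::nat. test_function {a<..<b} (\<psi> k)"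
      and lim: "(\<lambda>k. LINT x|?M. (\<psi> k x - u x)\<^sup>2 + (deriv (\<psi> k) x - v x)\<^sup>2) \<longlonglongrightarrow> 0"
      using H unfolding H10_def u_def by blast
    obtain B where B: "\<And>x. x \<in> {a..b} \<Longrightarrow> \<kappa> x \<le> B" using \<kappa>_bounded_on by blast
    have m\<kappa>: "\<kappa> \<in> borel_measurable ?M"
      by (intro borel_measurable_integrable integrable_on_Ioo \<kappa>_continuous)
    have i\<kappa>: "integrable ?M (\<lambda>x. \<kappa> x * (1 + u x)\<^sup>2)"
    proof (rule Bochner_Integration.integrable_bound)
      show "integrable ?M (\<lambda>x. 2 * B + 2 * B * (u x)\<^sup>2)"
        by (intro Bochner_Integration.integrable_add integrable_one_Ioo integrable_mult_right iu)
      show "(\<lambda>x. \<kappa> x * (1 + u x)\<^sup>2) \<in> borel_measurable ?M" using m\<kappa> mu by measurable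
      show "AE x in ?M. norm (\<kappa> x * (1 + u x)\<^sup>2) \<le> norm (2 * B + 2 * B * (u x)\<^sup>2)"
      proof (rule AE_lebesgue_on_I)
        fix x assume "x \<in> {a<..<b}"
        then have k: "0 < \<kappa> x" "\<kappa> x \<le> B" using \<kappa>_pos B by auto
        have "(1 + u x)\<^sup>2 \<le> 2 + 2 * (u x)\<^sup>2"
          using zero_le_power2[of "1 - u x"] by (simp add: power2_eq_square algebra_simps)
        then have "\<kappa> x * (1 + u x)\<^sup>2 \<le> B * (2 + 2 * (u x)\<^sup>2)"
          using k by (intro mult_mono) auto
        then show "norm (\<kappa> x * (1 + u x)\<^sup>2) \<le> norm (2 * B + 2 * B * (u x)\<^sup>2)"
          using k by (simp add: algebra_simps)
      qed simp
    qed
    have bound: "E a b \<le> (1 + \<epsilon>) * (LINT x|?M. (v x)\<^sup>2) - inverse (1 + \<epsilon>) * (LINT x|?M. \<kappa> x * (1 + u x)\<^sup>2)"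
      if \<epsilon>: "0 < \<epsilon>" for \<epsilon>
    proof -
      let ?R = "(1 + \<epsilon>) * (LINT x|?M. (v x)\<^sup>2) - inverse (1 + \<epsilon>) * (LINT x|?M. \<kappa> x * (1 + u x)\<^sup>2)"
      define K where "K = 1 + 1 / \<epsilon> + B / \<epsilon>"
      define \<delta> where "\<delta> k = (LINT x|?M. (\<psi> k x - u x)\<^sup>2 + (deriv (\<psi> k) x - v x)\<^sup>2)" for k
      have "E a b \<le> ?R + K * \<delta> k" for k
      proof -
        have sm: "smooth_on UNIV (\<psi> k)" using test by (simp add: test_function_def)
        note d = smooth_on_deriv(2)[OF open_UNIV sm, OF UNIV_I]
        have c: "continuous_on A (\<psi> k)" "continuous_on A (deriv (\<psi> k))" for A
          using smooth_on_continuous[OF sm] smooth_on_continuous[OF smooth_on_deriv(1)[OF open_UNIV sm]]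
          by (auto intro: continuous_on_subset)
        have m: "\<psi> k \<in> borel_measurable ?M" "deriv (\<psi> k) \<in> borel_measurable ?M"
          by (intro borel_measurable_integrable integrable_on_Ioo c)+
        have diff: "integrable ?M (\<lambda>x. (f x - g x)\<^sup>2)"
          if "continuous_on {a..b} f" "g \<in> borel_measurable ?M" "integrable ?M (\<lambda>x. (g x)\<^sup>2)"
          for f g :: "real \<Rightarrow> real"
        proof (rule Bochner_Integration.integrable_bound)
          show "integrable ?M (\<lambda>x. 2 * (f x)\<^sup>2 + 2 * (g x)\<^sup>2)"
            by (intro Bochner_Integration.integrable_add integrable_mult_right that integrable_on_Ioo continuous_intros)
          have "f \<in> borel_measurable ?M" by (intro borel_measurable_integrable integrable_on_Ioo that)
          then show "(\<lambda>x. (f x - g x)\<^sup>2) \<in> borel_measurable ?M" using that(2) by measurable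
          have "(f x - g x)\<^sup>2 \<le> 2 * (f x)\<^sup>2 + 2 * (g x)\<^sup>2" for x
            using zero_le_power2[of "f x + g x"] by (simp add: power2_eq_square algebra_simps)
          then show "AE x in ?M. norm ((f x - g x)\<^sup>2) \<le> norm (2 * (f x)\<^sup>2 + 2 * (g x)\<^sup>2)" by simp
        qed
        have i\<delta>: "integrable ?M (\<lambda>x. (\<psi> k x - u x)\<^sup>2 + (deriv (\<psi> k) x - v x)\<^sup>2)"
          by (intro Bochner_Integration.integrable_add diff c mu mv iu iv)
        have "E a b \<le> (LINT x|?M. (deriv (\<psi> k) x)\<^sup>2 - \<kappa> x * (1 + \<psi> k x)\<^sup>2)"
          by (rule energy_lower_bound[OF ad ab])
             (auto intro!: derivative_eq_intros d c simp: test_function_vanishes[OF test])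
        also have "\<dots> \<le> (LINT x|?M. (1 + \<epsilon>) * (v x)\<^sup>2 - inverse (1 + \<epsilon>) * (\<kappa> x * (1 + u x)\<^sup>2)
            + K * ((\<psi> k x - u x)\<^sup>2 + (deriv (\<psi> k) x - v x)\<^sup>2))"
        proof (rule integral_mono_AE)
          show "integrable ?M (\<lambda>x. (deriv (\<psi> k) x)\<^sup>2 - \<kappa> x * (1 + \<psi> k x)\<^sup>2)"
            by (intro integrable_on_Ioo continuous_intros c \<kappa>_continuous)
          show "integrable ?M (\<lambda>x. (1 + \<epsilon>) * (v x)\<^sup>2 - inverse (1 + \<epsilon>) * (\<kappa> x * (1 + u x)\<^sup>2)
              + K * ((\<psi> k x - u x)\<^sup>2 + (deriv (\<psi> k) x - v x)\<^sup>2))"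
            by (intro Bochner_Integration.integrable_add Bochner_Integration.integrable_diff integrable_mult_right iv i\<kappa> i\<delta>)
          show "AE x in ?M. (deriv (\<psi> k) x)\<^sup>2 - \<kappa> x * (1 + \<psi> k x)\<^sup>2 \<le> (1 + \<epsilon>) * (v x)\<^sup>2
              - inverse (1 + \<epsilon>) * (\<kappa> x * (1 + u x)\<^sup>2) + K * ((\<psi> k x - u x)\<^sup>2 + (deriv (\<psi> k) x - v x)\<^sup>2)"
          proof (rule AE_lebesgue_on_I)
            fix x assume "x \<in> {a<..<b}"
            then have "0 \<le> \<kappa> x" "\<kappa> x \<le> B" using \<kappa>_pos[of x] B by auto
            from energy_perturbation[OF \<epsilon> this]
            show "(deriv (\<psi> k) x)\<^sup>2 - \<kappa> x * (1 + \<psi> k x)\<^sup>2 \<le> (1 + \<epsilon>) * (v x)\<^sup>2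
              - inverse (1 + \<epsilon>) * (\<kappa> x * (1 + u x)\<^sup>2) + K * ((\<psi> k x - u x)\<^sup>2 + (deriv (\<psi> k) x - v x)\<^sup>2)"
              unfolding K_def .
          qed simp
        qed
        also have "\<dots> = ?R + K * \<delta> k"
          unfolding \<delta>_def
          by (simp add: Bochner_Integration.integral_add Bochner_Integration.integral_diff iv i\<kappa> i\<delta>)
        finally show ?thesis .
      qed
      moreover have "(\<lambda>k. ?R + K * \<delta> k) \<longlonglongrightarrow> ?R + K * 0"
        unfolding \<delta>_def by (intro tendsto_intros lim)
      ultimately show ?thesis
        using LIMSEQ_le_const by (metis (no_types, lifting) add.right_neutral mult_zero_right)
    qed
    let ?A = "LINT x|?M. (v x)\<^sup>2" and ?B = "LINT x|?M. \<kappa> x * (1 + u x)\<^sup>2"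
    \<comment> \<open>The approximating sequence has been sent to its limit for each fixed
      \<epsilon>; now \<epsilon> tends to 0.\<close>
    have "((\<lambda>\<epsilon>. (1 + \<epsilon>) * ?A - inverse (1 + \<epsilon>) * ?B) \<longlongrightarrow> (1 + 0) * ?A - inverse (1 + 0) * ?B) (at_right 0)"
      by (intro tendsto_intros) auto
    moreover have "\<forall>\<^sub>F \<epsilon> in at_right 0. E a b \<le> (1 + \<epsilon>) * ?A - inverse (1 + \<epsilon>) * ?B"
      using bound by (auto simp: eventually_at_filter)
    ultimately have "E a b \<le> (1 + 0) * ?A - inverse (1 + 0) * ?B"
      by (intro tendsto_lowerbound) auto
    also have "\<dots> = (LINT x|?M. (v x)\<^sup>2 - \<kappa> x * (\<phi> x)\<^sup>2)"
      unfolding \<phi> by (simp add: Bochner_Integration.integral_diff[OF iv i\<kappa>])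
    finally show "ereal (E a b) \<le> ereal (LINT x|?M. (v x)\<^sup>2 - \<kappa> x * (\<phi> x)\<^sup>2)" by simp
  qed
qed

end


section \<open>Maximisers of the total energy\<close>

lemma bounded_coordinates_subsequence:
  fixes \<sigma> :: "nat \<Rightarrow> nat \<Rightarrow> real"
  assumes "\<And>k j. j \<in> {1..n} \<Longrightarrow> \<sigma> k j \<in> {c..d}"
  shows "\<exists>r s. strict_mono (r :: nat \<Rightarrow> nat) \<and> (\<forall>j\<in>{1..n}. (\<lambda>k. \<sigma> (r k) j) \<longlonglongrightarrow> s j)"
  using assms
proof (induction n)
  case 0
  then show ?case by (auto intro: exI[of _ id] simp: strict_mono_def)
next
  case (Suc n)
  then obtain r s where r: "strict_mono (r :: nat \<Rightarrow> nat)" "\<forall>j\<in>{1..n}. (\<lambda>k. \<sigma> (r k) j) \<longlonglongrightarrow> s j"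
    by force
  have "seq_compact {c..d}" by (simp add: compact_imp_seq_compact)
  moreover have "\<forall>k. \<sigma> (r k) (Suc n) \<in> {c..d}" using Suc.prems[of "Suc n"] by simp
  ultimately obtain l r' where r': "strict_mono (r' :: nat \<Rightarrow> nat)" "((\<lambda>k. \<sigma> (r k) (Suc n)) \<circ> r') \<longlonglongrightarrow> l"
    by (rule seq_compactE)
  then have r'': "(\<lambda>k. \<sigma> (r (r' k)) (Suc n)) \<longlonglongrightarrow> l" by (simp add: o_def)
  have "(\<lambda>k. \<sigma> (r (r' k)) j) \<longlonglongrightarrow> s j" if "j \<in> {1..n}" for j
    using LIMSEQ_subseq_LIMSEQ[OF r(2)[rule_format, OF that] r'(1)] by (simp add: o_def)
  then have "(\<lambda>k. \<sigma> (r (r' k)) j) \<longlonglongrightarrow> (s(Suc n := l)) j" if "j \<in> {1..Suc n}" for j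
    using that r'' by (cases "j = Suc n") auto
  moreover have "strict_mono (\<lambda>k. r (r' k))"
    using strict_mono_o[OF r(1) r'(1)] by (simp add: o_def)
  ultimately show ?case
    by (intro exI[of _ "\<lambda>k. r (r' k)"] exI[of _ "s(Suc n := l)"]) simp
qed

text \<open>The result type is arbitrary, so that this serves predicates such as \<open>adm\<close>
  as well as functions such as \<open>E\<close>.\<close>

lemma periodic_int:
  fixes P :: "real \<Rightarrow> real \<Rightarrow> 'b"
  assumes "\<And>a b. P (a + L) (b + L) = P a b"
  shows "P (a + of_int m * L) (b + of_int m * L) = P a b"
proof (induction m rule: int_induct[of _ 0])
  case (step1 i)
  then show ?case using assms[of "a + of_int i * L" "b + of_int i * L"] by (simp add: algebra_simps)
next
  case (step2 i)
  then show ?case using assms[of "a + of_int (i - 1) * L" "b + of_int (i - 1) * L"] by (simp add: algebra_simps)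
qed simp

context jacobi
begin

section \<open>Cyclic configurations and their total energy\<close>

definition nxt :: "nat \<Rightarrow> (nat \<Rightarrow> real) \<Rightarrow> nat \<Rightarrow> real" where
  "nxt n s j = (if j = n then s 1 + L else s (Suc j))"

definition H :: "nat \<Rightarrow> (nat \<Rightarrow> real) \<Rightarrow> real" where
  "H n s = (\<Sum>j\<in>{1..n}. E (s j) (nxt n s j))"

text \<open>Coinciding neighbours are allowed, because \<open>adm\<close> admits degenerate
  intervals. Only so can limits of configurations be configurations again.\<close>

definition config :: "nat \<Rightarrow> (nat \<Rightarrow> real) \<Rightarrow> bool" where
  "config n s \<longleftrightarrow> (\<forall>j\<in>{1..n}. adm (s j) (nxt n s j))"

definition maximal :: "nat \<Rightarrow> (nat \<Rightarrow> real) \<Rightarrow> bool" where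
  "maximal n s \<longleftrightarrow> config n s \<and> (\<forall>s'. config n s' \<longrightarrow> H n s' \<le> H n s)"

lemma config_mono:
  assumes "config n s" "1 \<le> i" "i \<le> j" "j \<le> n"
  shows "s i \<le> s j"
  using assms(3,4)
proof (induction j rule: dec_induct)
  case (step m)
  then have "adm (s m) (nxt n s m)" using assms(1,2) by (simp add: config_def)
  then show ?case using step adm_le[of "s m" "nxt n s m"] by (simp add: nxt_def)
qed simp

lemma config_last: "config n s \<Longrightarrow> 1 \<le> n \<Longrightarrow> s n \<le> s 1 + L"
  unfolding config_def by (drule bspec[of _ _ n]) (auto simp: nxt_def dest: adm_le)

lemma H_nonpos: "config n s \<Longrightarrow> H n s \<le> 0"
  unfolding H_def config_def by (intro sum_nonpos E_nonpos) auto

lemma config_shift: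
  "config n (\<lambda>j. s j + of_int m * L) \<longleftrightarrow> config n s"
  "H n (\<lambda>j. s j + of_int m * L) = H n s"
proof -
  have "nxt n (\<lambda>j. s j + of_int m * L) j = nxt n s j + of_int m * L" for j
    by (simp add: nxt_def)
  then show "config n (\<lambda>j. s j + of_int m * L) \<longleftrightarrow> config n s"
    "H n (\<lambda>j. s j + of_int m * L) = H n s"
    using periodic_int[of adm, OF adm_periodic] periodic_int[of E, OF E_periodic]
    by (auto simp: config_def H_def)
qed

lemma config_normalize:
  "\<exists>m. 0 \<le> s 1 + of_int m * L \<and> s 1 + of_int m * L < L"
proof (rule exI[of _ "- \<lfloor>s 1 / L\<rfloor>"])
  show "0 \<le> s 1 + of_int (- \<lfloor>s 1 / L\<rfloor>) * L \<and> s 1 + of_int (- \<lfloor>s 1 / L\<rfloor>) * L < L"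
    using floor_divide_lower[OF L_pos, of "s 1"] floor_divide_upper[OF L_pos, of "s 1"]
    by (simp add: algebra_simps)
qed

section \<open>Compactness of maximising sequences\<close>

lemma D_tendsto:
  assumes "(a \<longlongrightarrow> a0) F" "(b \<longlongrightarrow> b0) F"
  shows "((\<lambda>k. D (a k) (b k)) \<longlongrightarrow> D a0 b0) F"
    and "((\<lambda>k. D1 (a k) (b k)) \<longlongrightarrow> D1 a0 b0) F"
    and "((\<lambda>k. D2 (a k) (b k)) \<longlongrightarrow> D2 a0 b0) F"
  unfolding D_def D1_def D2_def
  by (intro tendsto_intros isCont_tendsto_compose[OF DERIV_isCont[OF dC]]
      isCont_tendsto_compose[OF DERIV_isCont[OF dC']] isCont_tendsto_compose[OF DERIV_isCont[OF dS]]
      isCont_tendsto_compose[OF DERIV_isCont[OF dS']] assms)+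

text \<open>Upper semicontinuity of the gap energy, phrased with a convergent majorant
  \<open>e\<close>. If the gap closes up, the constant 0 is a majorant by \<open>E_nonpos\<close>
  and equals the limit energy. Otherwise the lower bound excludes a conjugate point at the limit,
  and the energies themselves converge.\<close>

lemma gap_limit:
  fixes a b :: "nat \<Rightarrow> real"
  assumes a: "a \<longlonglongrightarrow> a0" and b: "b \<longlonglongrightarrow> b0"
    and ad: "\<And>k. adm (a k) (b k)" and low: "\<And>k. - M \<le> E (a k) (b k)"
  shows "adm a0 b0" "\<exists>e. e \<longlonglongrightarrow> E a0 b0 \<and> (\<forall>k. E (a k) (b k) \<le> e k)"
proof -
  have le: "a0 \<le> b0" by (rule LIMSEQ_le[OF a b]) (use adm_le[OF ad] in auto)
  have "adm a0 b0 \<and> (\<exists>e. e \<longlonglongrightarrow> E a0 b0 \<and> (\<forall>k. E (a k) (b k) \<le> e k))"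
  proof (cases "a0 = b0")
    case True
    then show ?thesis using E_nonpos[OF ad] adm_refl by (intro conjI exI[of _ "\<lambda>_. 0"]) auto
  next
    case False
    then have ab: "a0 < b0" using le by simp
    have Dk: "0 \<le> D (a k) (b k)" for k
      using D_pos[OF ad, of k "a k" "b k"] adm_le[OF ad, of k] by (cases "a k = b k") auto
    \<comment> \<open>Multiplied by \<open>D\<close>, the bound survives the limit even if
      \<open>D\<close> tends to 0. For a degenerate gap both sides are 0.\<close>
    have Nk: "- M * D (a k) (b k) \<le> D2 (a k) (b k) - D1 (a k) (b k) - 2" for k
    proof (cases "a k = b k")
      case False
      then have pos: "0 < D (a k) (b k)"
        using D_pos[OF ad, of k "a k" "b k"] adm_le[OF ad, of k] by auto
      have "E (a k) (b k) = (D2 (a k) (b k) - D1 (a k) (b k) - 2) / D (a k) (b k)"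
        by (simp add: E_def p_def q_def diff_divide_distrib[symmetric])
      then show ?thesis using low[of k] pos by (simp add: pos_le_divide_eq)
    qed simp
    have "0 \<le> D a0 x" if x: "a0 \<le> x" "x \<le> b0" for x
    proof -
      consider "x = a0" | "x = b0" | "a0 < x" "x < b0" using x by linarith
      then show ?thesis
      proof cases
        case 1
        then show ?thesis by simp
      next
        case 2
        show ?thesis unfolding 2
          by (rule tendsto_lowerbound[OF D_tendsto(1)[OF a b]]) (use Dk in auto)
      next
        case 3
        have "\<forall>\<^sub>F k in sequentially. a k < x" "\<forall>\<^sub>F k in sequentially. x < b k"
          using order_tendstoD(2)[OF a 3(1)] order_tendstoD(1)[OF b 3(2)] .
        then have "\<forall>\<^sub>F k in sequentially. 0 \<le> D (a k) x"
        proof eventually_elim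
          case (elim k)
          then show ?case using D_pos[OF ad, of k "a k" x] by simp
        qed
        then show ?thesis
          by (rule tendsto_lowerbound[OF D_tendsto(1)[OF a tendsto_const]]) simp
      qed
    qed
    moreover have "- M * D a0 b0 \<le> D2 a0 b0 - D1 a0 b0 - 2"
    proof (rule LIMSEQ_le)
      show "(\<lambda>k. - M * D (a k) (b k)) \<longlonglongrightarrow> - M * D a0 b0"
        by (intro tendsto_intros D_tendsto a b)
      show "(\<lambda>k. D2 (a k) (b k) - D1 (a k) (b k) - 2) \<longlonglongrightarrow> D2 a0 b0 - D1 a0 b0 - 2"
        by (intro tendsto_intros D_tendsto a b)
    qed (use Nk in blast)
    ultimately have ad0: "adm a0 b0" by (rule adm_limit[OF ab])
    then have "D a0 b0 \<noteq> 0" using D_pos[of a0 b0 a0 b0] ab by auto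
    then have "(\<lambda>k. E (a k) (b k)) \<longlonglongrightarrow> E a0 b0"
      unfolding E_def p_def q_def by (intro tendsto_intros D_tendsto a b)
    then show ?thesis using ad0 by blast
  qed
  then show "adm a0 b0" "\<exists>e. e \<longlonglongrightarrow> E a0 b0 \<and> (\<forall>k. E (a k) (b k) \<le> e k)" by auto
qed

text \<open>Translation by periods brings the first point into [0, L), and the last one is at most
  \<open>L\<close> further, so all points lie in [0, 2 L] and a subsequence converges.\<close>

lemma maximal_exists:
  assumes n: "1 \<le> n" and ex: "config n s0"
  shows "\<exists>s. maximal n s"
proof -
  define A where "A = H n ` {s. config n s}"
  have bdd: "bdd_above A" unfolding A_def using H_nonpos by (auto intro!: bdd_aboveI[of _ 0])
  have ne: "A \<noteq> {}" unfolding A_def using ex by auto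
  define m where "m = Sup A"
  have up: "H n s \<le> m" if "config n s" for s
    unfolding m_def by (rule cSup_upper[OF _ bdd]) (use that in \<open>auto simp: A_def\<close>)
  have "\<exists>s. config n s \<and> m - inverse (real (Suc k)) < H n s \<and> 0 \<le> s 1 \<and> s 1 < L" for k
  proof -
    have "m - inverse (real (Suc k)) < Sup A" unfolding m_def by simp
    then obtain s where s: "config n s" "m - inverse (real (Suc k)) < H n s"
      unfolding less_cSup_iff[OF ne bdd] by (auto simp: A_def)
    obtain i where "0 \<le> s 1 + of_int i * L" "s 1 + of_int i * L < L" using config_normalize by blast
    then show ?thesis using s config_shift[of n s i]
      by (intro exI[of _ "\<lambda>j. s j + of_int i * L"]) auto
  qed
  then obtain \<sigma> where \<sigma>: "\<And>k. config n (\<sigma> k)" "\<And>k. m - inverse (real (Suc k)) < H n (\<sigma> k)"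
    "\<And>k. 0 \<le> \<sigma> k 1" "\<And>k. \<sigma> k 1 < L"
    by metis
  have "\<sigma> k j \<in> {0..2 * L}" if "j \<in> {1..n}" for k j
    using config_mono[OF \<sigma>(1), of 1 j k] config_mono[OF \<sigma>(1), of j n k] config_last[OF \<sigma>(1) n, of k]
      \<sigma>(3,4)[of k] that by auto
  from bounded_coordinates_subsequence[of n \<sigma>, OF this]
  obtain r s where r: "strict_mono (r :: nat \<Rightarrow> nat)" and s: "\<And>j. j \<in> {1..n} \<Longrightarrow> (\<lambda>k. \<sigma> (r k) j) \<longlonglongrightarrow> s j"
    by blast
  have s': "(\<lambda>k. nxt n (\<sigma> (r k)) j) \<longlonglongrightarrow> nxt n s j" if "j \<in> {1..n}" for j
    unfolding nxt_def using that n by (auto intro!: tendsto_intros s)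
  \<comment> \<open>The other gap energies are at most 0, so the total, which is at least
    \<open>m - 1\<close> along the sequence, bounds each of them from below.\<close>
  have low: "- (1 - m) \<le> E (\<sigma> (r k) j) (nxt n (\<sigma> (r k)) j)" if j: "j \<in> {1..n}" for j k
  proof -
    have "inverse (real (Suc (r k))) \<le> 1" by (simp add: inverse_le_1_iff)
    then have "m - 1 \<le> H n (\<sigma> (r k))" using \<sigma>(2)[of "r k"] by linarith
    also have "\<dots> = E (\<sigma> (r k) j) (nxt n (\<sigma> (r k)) j)
        + (\<Sum>i\<in>{1..n} - {j}. E (\<sigma> (r k) i) (nxt n (\<sigma> (r k)) i))"
      unfolding H_def by (rule sum.remove) (use j in auto)
    also have "\<dots> \<le> E (\<sigma> (r k) j) (nxt n (\<sigma> (r k)) j) + 0"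
      using \<sigma>(1)[of "r k"] by (intro add_left_mono sum_nonpos E_nonpos) (auto simp: config_def)
    finally show ?thesis by simp
  qed
  have ad: "adm (\<sigma> (r k) j) (nxt n (\<sigma> (r k)) j)" if "j \<in> {1..n}" for j k
    using \<sigma>(1) that by (auto simp: config_def)
  note g = gap_limit[OF s s' ad low]
  have cs: "config n s" using g(1) by (simp add: config_def)
  have "\<forall>j\<in>{1..n}. \<exists>e. e \<longlonglongrightarrow> E (s j) (nxt n s j) \<and> (\<forall>k. E (\<sigma> (r k) j) (nxt n (\<sigma> (r k)) j) \<le> e k)"
    using g(2) by blast
  then obtain e where e: "\<And>j. j \<in> {1..n} \<Longrightarrow> e j \<longlonglongrightarrow> E (s j) (nxt n s j)"
    "\<And>j k. j \<in> {1..n} \<Longrightarrow> E (\<sigma> (r k) j) (nxt n (\<sigma> (r k)) j) \<le> e j k"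
    by (metis bchoice)
  have "m \<le> H n s"
  proof (rule LIMSEQ_le)
    show "(\<lambda>k. \<Sum>j\<in>{1..n}. e j k) \<longlonglongrightarrow> H n s"
      unfolding H_def by (intro tendsto_sum e)
    have "(\<lambda>k. m - inverse (real (Suc (r k)))) \<longlonglongrightarrow> m - 0"
      using LIMSEQ_subseq_LIMSEQ[OF LIMSEQ_inverse_real_of_nat r]
      by (intro tendsto_intros) (simp add: o_def)
    then show "(\<lambda>k. m - inverse (real (Suc (r k)))) \<longlonglongrightarrow> m" by simp
    have "m - inverse (real (Suc (r k))) \<le> (\<Sum>j\<in>{1..n}. e j k)" for k
      using \<sigma>(2)[of "r k"] sum_mono[of "{1..n}" "\<lambda>j. E (\<sigma> (r k) j) (nxt n (\<sigma> (r k)) j)" "\<lambda>j. e j k"] e(2)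
      unfolding H_def by fastforce
    then show "\<exists>N. \<forall>k\<ge>N. m - inverse (real (Suc (r k))) \<le> (\<Sum>j\<in>{1..n}. e j k)" by blast
  qed
  then show ?thesis using cs up unfolding maximal_def by (meson order_trans)
qed

text \<open>If a gap is degenerate, some point lies at one end of the interval between its two neighbours,
  which is not degenerate; moving it to the midpoint increases \<open>H\<close>.\<close>

lemma maximal_gaps_pos:
  assumes n: "1 \<le> n" and max: "maximal n s" and j0: "j0 \<in> {1..n}"
  shows "s j0 < nxt n s j0"
proof (rule ccontr)
  assume no: "\<not> s j0 < nxt n s j0"
  have c: "config n s" using max by (simp add: maximal_def)
  have ad: "adm (s j) (nxt n s j)" if "j \<in> {1..n}" for j using c that by (simp add: config_def)
  define z where "z j \<longleftrightarrow> s j < nxt n s j" for j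
  have nz: "s j = nxt n s j" if "j \<in> {1..n}" "\<not> z j" for j
    using adm_le[OF ad[OF that(1)]] that(2) by (simp add: z_def)
  \<comment> \<open>Otherwise all gaps would be degenerate like that of \<open>j0\<close>. All
    points would then coincide, against the last gap, which ends at \<open>s 1 + L\<close>.\<close>
  have "\<exists>i. 1 \<le> i \<and> i < n \<and> z i \<noteq> z (Suc i)"
  proof (rule ccontr)
    assume "\<not> ?thesis"
    then have st: "z (Suc i) = z i" if "1 \<le> i" "i < n" for i using that by blast
    have zz: "z j = z 1" if "1 \<le> j" "j \<le> n" for j
      using that by (induction j rule: dec_induct) (auto simp: st)
    have "\<not> z j0" using no by (simp add: z_def)
    then have nzall: "\<not> z j" if "j \<in> {1..n}" for j
      using zz[of j] zz[of j0] j0 that by simp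
    have ss: "s j = s 1" if "1 \<le> j" "j \<le> n" for j
      using that
    proof (induction j rule: dec_induct)
      case (step i)
      then show ?case using nz[of i] nzall[of i] by (auto simp: nxt_def)
    qed simp
    show False using ss[of n] nz[of n] nzall[of n] n L_pos by (simp add: nxt_def)
  qed
  then obtain i where i: "1 \<le> i" "i < n" "z i \<noteq> z (Suc i)" by blast
  define a x b where "a = s i" and "x = s (Suc i)" and "b = nxt n s (Suc i)"
  have nx: "nxt n s i = x" using i by (simp add: nxt_def x_def)
  have ax: "adm a x" and xb: "adm x b"
    using ad[of i] ad[of "Suc i"] i nx by (auto simp: a_def x_def b_def)
  have "(a < x \<and> x = b) \<or> (a = x \<and> x < b)"
  proof -
    have zi: "z i \<longleftrightarrow> a < x" "z (Suc i) \<longleftrightarrow> x < b"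
      using i nx by (simp_all add: z_def a_def x_def b_def)
    then show ?thesis using adm_le[OF ax] adm_le[OF xb] i(3) by auto
  qed
  then have ab: "a < b" "adm a b" "E a x + E x b = E a b" using ax xb by auto
  define c where "c = (a + b) / 2"
  have acb: "a < c" "c < b" using ab by (auto simp: c_def)
  define s' where "s' = s(Suc i := c)"
  have s'i: "s' i = a" "nxt n s' i = c" "s' (Suc i) = c" "nxt n s' (Suc i) = b"
    using i by (auto simp: s'_def nxt_def a_def b_def)
  have s'o: "s' j = s j" "nxt n s' j = nxt n s j" if "j \<in> {1..n} - {i} - {Suc i}" for j
    using that i by (auto simp: s'_def nxt_def)
  have "config n s'"
    unfolding config_def
  proof
    fix j assume j: "j \<in> {1..n}"
    show "adm (s' j) (nxt n s' j)"
    proof (cases "j = i \<or> j = Suc i")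
      case True
      then show ?thesis using s'i adm_subset[OF ab(2)] acb by auto
    next
      case False
      then show ?thesis using s'o[of j] ad[OF j] j by simp
    qed
  qed
  have split: "H n t = E (t i) (nxt n t i) + (E (t (Suc i)) (nxt n t (Suc i))
      + (\<Sum>j\<in>{1..n} - {i} - {Suc i}. E (t j) (nxt n t j)))" for t
  proof -
    have "i \<in> {1..n}" "Suc i \<in> {1..n} - {i}" using i by auto
    then show ?thesis unfolding H_def by (simp only: sum.remove finite_atLeastAtMost finite_Diff)
  qed
  have rest: "(\<Sum>j\<in>{1..n} - {i} - {Suc i}. E (s' j) (nxt n s' j))
      = (\<Sum>j\<in>{1..n} - {i} - {Suc i}. E (s j) (nxt n s j))"
    by (intro sum.cong refl) (simp only: s'o)
  have "H n s' - H n s = E a c + E c b - E a b"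
    unfolding split[of s] split[of s'] s'i rest nx ab(3)[symmetric]
    by (simp add: a_def x_def b_def)
  then have "H n s < H n s'" using E_split_less[OF ab(2) acb] by simp
  then show False using max \<open>config n s'\<close> by (auto simp: maximal_def)
qed

text \<open>While the last point is at least \<open>L\<close>, it is moved back by one period and
  becomes the first one. The gaps are only permuted, up to a translation by \<open>L\<close>, and
  each such rotation lowers the number of points beyond \<open>L\<close>.\<close>

lemma maximal_normalize:
  assumes n: "1 \<le> n" and "maximal n s" "0 \<le> s 1" "s 1 < L"
  shows "\<exists>s'. maximal n s' \<and> (\<forall>j\<in>{1..n}. 0 \<le> s' j \<and> s' j < L)"
  using assms(2-4)
proof (induction "card {j\<in>{1..n}. L \<le> s j}" arbitrary: s rule: less_induct)
  case less
  have c: "config n s" using less.prems by (simp add: maximal_def)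
  show ?case
  proof (cases "s n < L")
    case True
    have "0 \<le> s j \<and> s j < L" if "j \<in> {1..n}" for j
      using config_mono[OF c, of 1 j] config_mono[OF c, of j n] that True less.prems by auto
    then show ?thesis using less.prems by blast
  next
    case False
    define t where "t j = (if j = 1 then s n - L else s (j - 1))" for j
    have nt: "nxt n t j = s j" if "j \<in> {1..n}" for j
      using that n by (auto simp: nxt_def t_def)
    have t1: "adm (t 1) (s 1) \<longleftrightarrow> adm (s n) (nxt n s n)" "E (t 1) (s 1) = E (s n) (nxt n s n)"
      using adm_periodic[of "s n - L" "s 1"] E_periodic[of "s n - L" "s 1"] by (auto simp: t_def nxt_def)
    have tj: "t (Suc j) = s j" "nxt n s j = s (Suc j)" if "j \<in> {1..<n}" for j
      using that by (auto simp: t_def nxt_def)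
    have "config n t"
      unfolding config_def
    proof
      fix j assume j: "j \<in> {1..n}"
      show "adm (t j) (nxt n t j)"
      proof (cases "j = 1")
        case True
        then show ?thesis using t1 c n nt[OF j] by (auto simp: config_def)
      next
        case False
        then obtain i where "j = Suc i" "i \<in> {1..<n}" using j by (cases j) auto
        moreover from this have "adm (s i) (nxt n s i)" using c by (simp add: config_def)
        ultimately show ?thesis using tj[of i] nt[OF j] by simp
      qed
    qed
    moreover have "H n t = H n s"
    proof -
      obtain m where m: "n = Suc m" using n by (cases n) auto
      have "H n t = (\<Sum>j\<in>{1..n}. E (t j) (s j))"
        unfolding H_def by (intro sum.cong refl) (simp add: nt)
      also have "\<dots> = E (t 1) (s 1) + (\<Sum>j\<in>{Suc 1..Suc m}. E (t j) (s j))"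
        unfolding m by (rule sum.atLeast_Suc_atMost) simp
      also have "(\<Sum>j\<in>{Suc 1..Suc m}. E (t j) (s j)) = (\<Sum>j\<in>{1..m}. E (t (Suc j)) (s (Suc j)))"
        by (rule sum.shift_bounds_cl_Suc_ivl)
      also have "\<dots> = (\<Sum>j\<in>{1..m}. E (s j) (nxt n s j))"
        by (intro sum.cong refl) (simp add: tj m nxt_def)
      finally show ?thesis unfolding t1(2) H_def m by (simp add: add.commute)
    qed
    ultimately have mt: "maximal n t" using less.prems by (simp add: maximal_def)
    have t1b: "0 \<le> t 1" "t 1 < L" using False config_last[OF c n] less.prems by (auto simp: t_def)
    \<comment> \<open>The new first point lies below \<open>L\<close>, and every other point of
      \<open>t\<close> is one of \<open>s\<close> with index raised by 1; the old last point has
      left the set.\<close>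
    have "{j\<in>{1..n}. L \<le> t j} \<subseteq> Suc ` ({j\<in>{1..n}. L \<le> s j} - {n})"
    proof
      fix j assume j: "j \<in> {j\<in>{1..n}. L \<le> t j}"
      then have "j \<noteq> 1" using t1b by auto
      then obtain i where "j = Suc i" "i \<in> {1..<n}" using j by (cases j) auto
      then show "j \<in> Suc ` ({j\<in>{1..n}. L \<le> s j} - {n})" using j tj[of i] by auto
    qed
    then have "card {j\<in>{1..n}. L \<le> t j} \<le> card ({j\<in>{1..n}. L \<le> s j} - {n})"
      using card_mono[of "Suc ` ({j\<in>{1..n}. L \<le> s j} - {n})" "{j\<in>{1..n}. L \<le> t j}"]
        card_image_le[of "{j\<in>{1..n}. L \<le> s j} - {n}" Suc] by simp
    also have "\<dots> < card {j\<in>{1..n}. L \<le> s j}"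
      by (rule card_Diff1_less) (use False n in auto)
    finally show ?thesis by (rule less.hyps[OF _ mt t1b])
  qed
qed

lemma equidistant_config:
  assumes n: "1 \<le> n" and "\<And>t. \<kappa> t \<le> k" "L\<^sup>2 * k < pi\<^sup>2 * (real n)\<^sup>2"
  shows "config n (\<lambda>j. real j * (L / real n))"
  unfolding config_def
proof
  fix j assume j: "j \<in> {1..n}"
  have "nxt n (\<lambda>j. real j * (L / real n)) j = real j * (L / real n) + L / real n"
    using n by (auto simp: nxt_def algebra_simps add_divide_distrib)
  moreover have "adm (real j * (L / real n)) (real j * (L / real n) + L / real n)"
  proof (rule adm_comparison[OF _ assms(2)])
    have "(L / real n)\<^sup>2 * k < pi\<^sup>2" using assms(3) n by (simp add: power_divide divide_simps)
    then show "(real j * (L / real n) + L / real n - real j * (L / real n))\<^sup>2 * k < pi\<^sup>2" by simp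
  qed (use L_pos n in auto)
  ultimately show "adm (real j * (L / real n)) (nxt n (\<lambda>j. real j * (L / real n)) j)" by simp
qed

theorem normalized_maximal_exists:
  assumes n: "1 \<le> n" and "\<And>t. \<kappa> t \<le> k" "L\<^sup>2 * k < pi\<^sup>2 * (real n)\<^sup>2"
  obtains s where "maximal n s" "\<And>j. j \<in> {1..n} \<Longrightarrow> 0 \<le> s j" "\<And>j. j \<in> {1..n} \<Longrightarrow> s j < L"
proof -
  obtain s where s: "maximal n s"
    using maximal_exists[OF n equidistant_config[OF assms]] by blast
  obtain m where m: "0 \<le> s 1 + of_int m * L" "s 1 + of_int m * L < L" using config_normalize by blast
  have "maximal n (\<lambda>j. s j + of_int m * L)"
    using s by (simp add: maximal_def config_shift)
  from maximal_normalize[OF n this m] show thesis using that by blast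
qed

end


section \<open>The Hessian at a maximiser\<close>

lemma sum_of_bool_mult:
  fixes w :: "nat \<Rightarrow> real"
  assumes "a \<in> {1..n}"
  shows "(\<Sum>k\<in>{1..n}. of_bool (a = k) * w k) = w a"
proof -
  have "(\<Sum>k\<in>{1..n}. of_bool (a = k) * w k) = (\<Sum>k\<in>{1..n}. if a = k then w k else 0)"
    by (intro sum.cong refl) simp
  then show ?thesis using assms by simp
qed

context jacobi
begin

text \<open>Separates the index from the translation in \<open>nxt\<close>: as the translation is
  constant, the right end of gap \<open>j\<close> moves with velocity
  \<open>v (nx n j)\<close>.\<close>

definition nx :: "nat \<Rightarrow> nat \<Rightarrow> nat" where "nx n j = (if j = n then 1 else Suc j)"

definition nondeg :: "nat \<Rightarrow> (nat \<Rightarrow> real) \<Rightarrow> bool" where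
  "nondeg n s \<longleftrightarrow> (\<forall>j\<in>{1..n}. adm (s j) (nxt n s j) \<and> s j < nxt n s j)"

text \<open>\<open>grad_H\<close> and \<open>hess_H\<close> are the first and second derivatives of
  \<open>H\<close> as forms in the directions \<open>v\<close> and \<open>w\<close>. For n = 1 both
  ends of the gap move with the same coordinate, which the chain rule covers without a separate
  case.\<close>

definition grad_H :: "nat \<Rightarrow> (nat \<Rightarrow> real) \<Rightarrow> (nat \<Rightarrow> real) \<Rightarrow> real" where
  "grad_H n s v = (\<Sum>j\<in>{1..n}. E1 (s j) (nxt n s j) * v j + E2 (s j) (nxt n s j) * v (nx n j))"

definition hess_H :: "nat \<Rightarrow> (nat \<Rightarrow> real) \<Rightarrow> (nat \<Rightarrow> real) \<Rightarrow> (nat \<Rightarrow> real) \<Rightarrow> real" where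
  "hess_H n s v w = (\<Sum>j\<in>{1..n}.
     (E11 (s j) (nxt n s j) * v j + E12 (s j) (nxt n s j) * v (nx n j)) * w j
     + (E12 (s j) (nxt n s j) * v j + E22 (s j) (nxt n s j) * v (nx n j)) * w (nx n j))"

lemma nx_in: "1 \<le> n \<Longrightarrow> j \<in> {1..n} \<Longrightarrow> nx n j \<in> {1..n}"
  by (auto simp: nx_def)

lemma nxt_nx: "nxt n s j = s (nx n j) + (if j = n then L else 0)"
  by (simp add: nxt_def nx_def)

lemma nondeg_config: "nondeg n s \<Longrightarrow> config n s"
  by (simp add: nondeg_def config_def)

lemma nondeg_D: "nondeg n s \<Longrightarrow> j \<in> {1..n} \<Longrightarrow> D (s j) (nxt n s j) \<noteq> 0"
  using D_pos[of "s j" "nxt n s j" "s j" "nxt n s j"] by (auto simp: nondeg_def)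

lemma nxt_has_derivative:
  assumes "1 \<le> n" "j \<in> {1..n}"
    and "\<And>j. j \<in> {1..n} \<Longrightarrow> ((\<lambda>t. \<sigma> t j) has_real_derivative v j) (at t)"
  shows "((\<lambda>t. nxt n (\<sigma> t) j) has_real_derivative v (nx n j)) (at t)"
  unfolding nxt_nx using DERIV_add[OF assms(3)[OF nx_in[OF assms(1,2)]] DERIV_const] by simp

text \<open>Stated along arbitrary differentiable curves: coordinate lines give the entries of the
  Hessian matrix, straight lines the conditions at a maximum.\<close>

lemma H_has_derivative:
  assumes n: "1 \<le> n" and d: "\<And>j. j \<in> {1..n} \<Longrightarrow> ((\<lambda>t. \<sigma> t j) has_real_derivative v j) (at t)"
    and nd: "nondeg n (\<sigma> t)"
  shows "((\<lambda>t. H n (\<sigma> t)) has_real_derivative grad_H n (\<sigma> t) v) (at t)"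
    and "((\<lambda>t. grad_H n (\<sigma> t) w) has_real_derivative hess_H n (\<sigma> t) v w) (at t)"
proof -
  note E' = E_has_derivative[OF d nxt_has_derivative[OF n _ d] nondeg_D[OF nd]]
  show "((\<lambda>t. H n (\<sigma> t)) has_real_derivative grad_H n (\<sigma> t) v) (at t)"
    unfolding H_def grad_H_def by (intro DERIV_sum E'(1))
  show "((\<lambda>t. grad_H n (\<sigma> t) w) has_real_derivative hess_H n (\<sigma> t) v w) (at t)"
    unfolding grad_H_def hess_H_def
    by (intro DERIV_sum DERIV_add DERIV_cmult_right E'(2,3))
qed

lemma nondeg_open:
  assumes n: "1 \<le> n" and nd: "nondeg n s"
  shows "\<exists>\<epsilon>>0. \<forall>s'. (\<forall>j\<in>{1..n}. \<bar>s' j - s j\<bar> < \<epsilon>) \<longrightarrow> nondeg n s'"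
proof -
  have "\<exists>\<epsilon>>0. \<forall>x y. \<bar>x - s j\<bar> < \<epsilon> \<longrightarrow> \<bar>y - nxt n s j\<bar> < \<epsilon> \<longrightarrow> adm x y \<and> x < y"
    if j: "j \<in> {1..n}" for j
  proof -
    have ad: "adm (s j) (nxt n s j)" and lt: "s j < nxt n s j" using nd j by (auto simp: nondeg_def)
    obtain e where e: "e > 0" "\<And>x y. \<bar>x - s j\<bar> < e \<Longrightarrow> \<bar>y - nxt n s j\<bar> < e \<Longrightarrow> x \<le> y \<Longrightarrow> adm x y"
      using adm_open[OF ad] by metis
    \<comment> \<open>Each end may move by less than half the gap, which keeps the left end below
      the right one.\<close>
    define e' where "e' = min e ((nxt n s j - s j) / 2)"
    have e': "0 < e'" "e' \<le> e" using e(1) lt by (auto simp: e'_def)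
    have e'2: "e' \<le> (nxt n s j - s j) / 2" unfolding e'_def by (rule min.cobounded2)
    show ?thesis
    proof (intro exI[of _ e'] conjI allI impI e')
      fix x y assume xy: "\<bar>x - s j\<bar> < e'" "\<bar>y - nxt n s j\<bar> < e'"
      then show "x < y" using e'2 by (auto simp: abs_less_iff field_simps)
      then show "adm x y" using e(2)[of x y] xy e'(2) by auto
    qed
  qed
  then obtain e where e: "\<And>j. j \<in> {1..n} \<Longrightarrow> 0 < e j"
    "\<And>j x y. j \<in> {1..n} \<Longrightarrow> \<bar>x - s j\<bar> < e j \<Longrightarrow> \<bar>y - nxt n s j\<bar> < e j \<Longrightarrow> adm x y \<and> x < y"
    by metis
  define \<epsilon> where "\<epsilon> = Min (e ` {1..n})"
  have \<epsilon>: "0 < \<epsilon>" "\<And>j. j \<in> {1..n} \<Longrightarrow> \<epsilon> \<le> e j"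
    unfolding \<epsilon>_def using n e(1) by (auto simp: Min_gr_iff)
  show ?thesis
  proof (intro exI[of _ \<epsilon>] conjI allI impI \<epsilon>(1))
    fix s' assume s': "\<forall>j\<in>{1..n}. \<bar>s' j - s j\<bar> < \<epsilon>"
    show "nondeg n s'"
      unfolding nondeg_def
    proof
      fix j assume j: "j \<in> {1..n}"
      have "\<bar>s' j - s j\<bar> < e j" "\<bar>nxt n s' j - nxt n s j\<bar> < e j"
        using s' \<epsilon>(2)[OF j] j nx_in[OF n j] unfolding nxt_nx by (auto intro: less_le_trans)
      then show "adm (s' j) (nxt n s' j) \<and> s' j < nxt n s' j" using e(2)[OF j] by blast
    qed
  qed
qed

lemma nondeg_near_curve:
  fixes \<sigma> :: "real \<Rightarrow> nat \<Rightarrow> real"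
  assumes n: "1 \<le> n" and nd: "nondeg n (\<sigma> t0)"
    and c: "\<And>j. j \<in> {1..n} \<Longrightarrow> isCont (\<lambda>t. \<sigma> t j) t0"
  shows "\<exists>\<delta>>0. \<forall>t. \<bar>t - t0\<bar> < \<delta> \<longrightarrow> nondeg n (\<sigma> t)"
proof -
  obtain \<epsilon> where \<epsilon>: "0 < \<epsilon>" "\<And>s'. (\<forall>j\<in>{1..n}. \<bar>s' j - \<sigma> t0 j\<bar> < \<epsilon>) \<Longrightarrow> nondeg n s'"
    using nondeg_open[OF n nd] by blast
  have "\<forall>\<^sub>F t in nhds t0. \<bar>\<sigma> t j - \<sigma> t0 j\<bar> < \<epsilon>" if "j \<in> {1..n}" for j
    using tendstoD[OF c[OF that, unfolded isCont_def] \<epsilon>(1)] \<epsilon>(1)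
    by (simp add: eventually_nhds_conv_at dist_real_def)
  then have "\<forall>\<^sub>F t in nhds t0. \<forall>j\<in>{1..n}. \<bar>\<sigma> t j - \<sigma> t0 j\<bar> < \<epsilon>"
    by (intro eventually_ball_finite) auto
  then have "\<forall>\<^sub>F t in nhds t0. nondeg n (\<sigma> t)"
    by (rule eventually_mono) (rule \<epsilon>(2))
  then show ?thesis by (auto simp: eventually_nhds_metric dist_real_def)
qed

lemma Hn_eq: "nondeg n s \<Longrightarrow> real_of_ereal (Hn \<kappa> L n s) = H n s"
proof -
  assume nd: "nondeg n s"
  have "Hn \<kappa> L n s = (\<Sum>j\<in>{1..n}. ereal (E (s j) (nxt n s j)))"
    unfolding Hn_def by (intro sum.cong refl) (use nd in \<open>simp add: nondeg_def gap_energy_eq nxt_def[symmetric]\<close>)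
  then show ?thesis by (simp add: H_def)
qed

lemma coordinate_curve:
  "((\<lambda>t. (s(i := t)) j) has_real_derivative of_bool (j = i)) (at t)"
  by (cases "j = i") auto

lemma nondeg_coordinate_near:
  assumes n: "1 \<le> n" and nd: "nondeg n s"
  shows "\<exists>\<delta>>0. \<forall>t. \<bar>t - s i\<bar> < \<delta> \<longrightarrow> nondeg n (s(i := t))"
  by (rule nondeg_near_curve[OF n]) (use nd DERIV_isCont[OF coordinate_curve] in auto)

lemma partial_deriv_H:
  assumes n: "1 \<le> n" and nd: "nondeg n s"
  shows "partial_deriv i (\<lambda>s. real_of_ereal (Hn \<kappa> L n s)) s = grad_H n s (\<lambda>j. of_bool (j = i))"
proof -
  obtain \<delta> where \<delta>: "0 < \<delta>" "\<And>t. \<bar>t - s i\<bar> < \<delta> \<Longrightarrow> nondeg n (s(i := t))"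
    using nondeg_coordinate_near[OF n nd] by blast
  have "((\<lambda>t. H n (s(i := t))) has_real_derivative grad_H n (s(i := s i)) (\<lambda>j. of_bool (j = i))) (at (s i))"
    by (rule H_has_derivative(1)[OF n coordinate_curve]) (use nd in simp)
  then have "((\<lambda>t. real_of_ereal (Hn \<kappa> L n (s(i := t)))) has_real_derivative grad_H n (s(i := s i)) (\<lambda>j. of_bool (j = i))) (at (s i))"
    by (rule has_field_derivative_transform_within_open[of _ _ _ "ball (s i) \<delta>"])
       (use \<delta> in \<open>auto simp: Hn_eq dist_real_def abs_minus_commute\<close>)
  then show ?thesis unfolding partial_deriv_def by (simp add: DERIV_imp_deriv)
qed

text \<open>The formula for the first partial derivatives holds at all nearby points of the
  coordinate line, which stay nondegenerate, so it can be differentiated once more.\<close>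

lemma partial_deriv_partial_deriv_H:
  assumes n: "1 \<le> n" and nd: "nondeg n s"
  shows "partial_deriv i (partial_deriv k (\<lambda>s. real_of_ereal (Hn \<kappa> L n s))) s =
    hess_H n s (\<lambda>j. of_bool (j = i)) (\<lambda>j. of_bool (j = k))"
proof -
  obtain \<delta> where \<delta>: "0 < \<delta>" "\<And>t. \<bar>t - s i\<bar> < \<delta> \<Longrightarrow> nondeg n (s(i := t))"
    using nondeg_coordinate_near[OF n nd] by blast
  have "((\<lambda>t. grad_H n (s(i := t)) (\<lambda>j. of_bool (j = k))) has_real_derivative
      hess_H n (s(i := s i)) (\<lambda>j. of_bool (j = i)) (\<lambda>j. of_bool (j = k))) (at (s i))"
    by (rule H_has_derivative(2)[OF n coordinate_curve]) (use nd in simp)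
  then have "((\<lambda>t. partial_deriv k (\<lambda>s. real_of_ereal (Hn \<kappa> L n s)) (s(i := t))) has_real_derivative
      hess_H n (s(i := s i)) (\<lambda>j. of_bool (j = i)) (\<lambda>j. of_bool (j = k))) (at (s i))"
    by (rule has_field_derivative_transform_within_open[of _ _ _ "ball (s i) \<delta>"])
       (use \<delta> in \<open>auto simp: partial_deriv_H[OF n] dist_real_def abs_minus_commute\<close>)
  then show ?thesis unfolding partial_deriv_def[of i] by (simp add: DERIV_imp_deriv)
qed

lemma hess_H_symmetric: "hess_H n s v w = hess_H n s w v"
  unfolding hess_H_def by (intro sum.cong refl) (simp add: algebra_simps)

text \<open>Expansion in coordinate vectors, proved in the second slot and carried over to the first
  by symmetry.\<close>

lemma hess_H_quadratic:
  assumes n: "1 \<le> n"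
  shows "(\<Sum>i\<in>{1..n}. \<Sum>k\<in>{1..n}. x i * hess_H n s (\<lambda>j. of_bool (j = i)) (\<lambda>j. of_bool (j = k)) * x k)
    = hess_H n s x x"
proof -
  have lin1: "hess_H n s v w = (\<Sum>k\<in>{1..n}. hess_H n s v (\<lambda>j. of_bool (j = k)) * w k)" for v w
  proof -
    note d = sum_of_bool_mult[where w = w]
    have "(\<Sum>k\<in>{1..n}. hess_H n s v (\<lambda>j. of_bool (j = k)) * w k)
      = (\<Sum>j\<in>{1..n}. \<Sum>k\<in>{1..n}. (E11 (s j) (nxt n s j) * v j + E12 (s j) (nxt n s j) * v (nx n j)) * (of_bool (j = k) * w k)
        + (E12 (s j) (nxt n s j) * v j + E22 (s j) (nxt n s j) * v (nx n j)) * (of_bool (nx n j = k) * w k))"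
      unfolding hess_H_def sum_distrib_right
      by (subst sum.swap) (intro sum.cong refl, simp only: distrib_right mult.assoc)
    also have "\<dots> = hess_H n s v w"
      unfolding hess_H_def sum.distrib sum_distrib_left[symmetric]
      by (intro arg_cong2[where f = "(+)"] sum.cong refl) (simp_all only: d nx_in[OF n])
    finally show ?thesis by simp
  qed
  have "hess_H n s x x = (\<Sum>i\<in>{1..n}. hess_H n s x (\<lambda>j. of_bool (j = i)) * x i)" by (rule lin1)
  also have "\<dots> = (\<Sum>i\<in>{1..n}. (\<Sum>k\<in>{1..n}. hess_H n s (\<lambda>j. of_bool (j = i)) (\<lambda>j. of_bool (j = k)) * x k) * x i)"
    by (subst hess_H_symmetric, subst lin1) simp
  also have "\<dots> = (\<Sum>i\<in>{1..n}. \<Sum>k\<in>{1..n}. x i * hess_H n s (\<lambda>j. of_bool (j = i)) (\<lambda>j. of_bool (j = k)) * x k)"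
    unfolding sum_distrib_right by (intro sum.cong refl) simp
  finally show ?thesis by simp
qed

section \<open>First and second order conditions at a maximiser\<close>

lemma maximal_nondeg: "1 \<le> n \<Longrightarrow> maximal n s \<Longrightarrow> nondeg n s"
  using maximal_gaps_pos by (auto simp: nondeg_def maximal_def config_def)

lemma line_curve: "((\<lambda>t. s j + t * v j) has_real_derivative v j) (at t)" for s v :: "nat \<Rightarrow> real"
  by (auto intro!: derivative_eq_intros)

lemma maximal_second_order:
  assumes n: "1 \<le> n" and max: "maximal n s"
  shows "grad_H n s v = 0" "hess_H n s v v \<le> 0"
proof -
  define \<sigma> where "\<sigma> t j = s j + t * v j" for t j
  have s0: "\<sigma> 0 = s" by (simp add: \<sigma>_def fun_eq_iff)
  have d: "((\<lambda>t. \<sigma> t j) has_real_derivative v j) (at t)" for j t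
    unfolding \<sigma>_def by (rule line_curve)
  obtain \<delta> where \<delta>: "0 < \<delta>" "\<And>t. \<bar>t\<bar> < \<delta> \<Longrightarrow> nondeg n (\<sigma> t)"
    using nondeg_near_curve[OF n, of \<sigma> 0] maximal_nondeg[OF n max] DERIV_isCont[OF d] s0 by auto
  have dH: "((\<lambda>t. H n (\<sigma> t)) has_real_derivative grad_H n (\<sigma> t) v) (at t)"
    and dG: "((\<lambda>t. grad_H n (\<sigma> t) v) has_real_derivative hess_H n (\<sigma> t) v v) (at t)"
    if "\<bar>t\<bar> < \<delta>" for t
    using H_has_derivative[OF n d \<delta>(2)[OF that]] by auto
  have le: "H n (\<sigma> t) \<le> H n (\<sigma> 0)" if "\<bar>t\<bar> < \<delta>" for t
    using max nondeg_config[OF \<delta>(2)[OF that]] by (simp add: maximal_def s0)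
  have "grad_H n (\<sigma> 0) v = 0"
    by (rule DERIV_local_max[OF dH \<delta>(1)]) (use \<delta>(1) le in auto)
  then show g0: "grad_H n s v = 0" by (simp add: s0)
  show "hess_H n s v v \<le> 0"
  proof (rule ccontr)
    \<comment> \<open>The gradient along the line vanishes at 0 and would become positive just after
      it, so \<open>H\<close> would increase.\<close>
    assume "\<not> hess_H n s v v \<le> 0"
    then have "0 < hess_H n (\<sigma> 0) v v" by (simp add: s0)
    from DERIV_pos_inc_right[OF dG this] \<delta>(1) obtain d where
      d: "0 < d" "\<And>h. 0 < h \<Longrightarrow> h < d \<Longrightarrow> 0 < grad_H n (\<sigma> h) v"
      using g0 s0 by auto
    define h where "h = min d \<delta> / 2"
    have h: "0 < h" "h < d" "h < \<delta>" using d(1) \<delta>(1) by (auto simp: h_def)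
    have "H n (\<sigma> 0) < H n (\<sigma> h)"
    proof (rule DERIV_pos_imp_increasing_open[OF h(1)])
      fix t assume t: "0 < t" "t < h"
      then have "0 < grad_H n (\<sigma> t) v" using d(2) h by simp
      then show "\<exists>y. ((\<lambda>t. H n (\<sigma> t)) has_real_derivative y) (at t) \<and> 0 < y"
        using dH[of t] t h by auto
    next
      show "continuous_on {0..h} (\<lambda>t. H n (\<sigma> t))"
        by (rule continuous_at_imp_continuous_on) (use h in \<open>auto intro!: DERIV_isCont[OF dH]\<close>)
    qed
    then show False using le[of h] h by simp
  qed
qed

theorem maximal_nullity_index:
  assumes n: "1 \<le> n" and max: "maximal n s"
  shows "bjf_nullity \<kappa> L n s + bjf_index \<kappa> L n s = n"
proof -
  let ?A = "hessian_Hn \<kappa> L n s"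
  have nd: "nondeg n s" by (rule maximal_nondeg[OF n max])
  have A: "?A \<in> carrier_mat n n" by (simp add: hessian_Hn_def hessian_def)
  have Aij: "?A $$ (i, j) = hess_H n s (\<lambda>k. of_bool (k = Suc i)) (\<lambda>k. of_bool (k = Suc j))"
    if "i < n" "j < n" for i j
    using that unfolding hessian_Hn_def hessian_def by (simp add: partial_deriv_partial_deriv_H[OF n nd])
  have sym: "\<forall>i<n. \<forall>j<n. ?A $$ (i, j) = ?A $$ (j, i)"
    using Aij hess_H_symmetric by metis
  have "(\<Sum>i<n. \<Sum>j<n. x i * ?A $$ (i, j) * x j) \<le> 0" for x
  proof -
    define y where "y k = x (k - 1)" for k :: nat
    have "(\<Sum>i<n. \<Sum>j<n. x i * ?A $$ (i, j) * x j)
        = (\<Sum>i<n. \<Sum>j<n. y (Suc i) * hess_H n s (\<lambda>k. of_bool (k = Suc i)) (\<lambda>k. of_bool (k = Suc j)) * y (Suc j))"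
      by (intro sum.cong refl) (simp add: Aij y_def)
    also have "\<dots> = hess_H n s y y"
      unfolding hess_H_quadratic[OF n, symmetric] by (simp add: sum.atLeast1_atMost_eq)
    also have "\<dots> \<le> 0" by (rule maximal_second_order(2)[OF n max])
    finally show ?thesis .
  qed
  from negative_semidefinite_nullity_plus_index[OF A sym this]
  show ?thesis by (simp add: bjf_nullity_def bjf_index_def Let_def)
qed

end


section \<open>Bouncing fields from critical configurations\<close>

context jacobi
begin

section \<open>All minimum points on the line as a sequence indexed by the integers\<close>

definition idx :: "nat \<Rightarrow> int \<Rightarrow> nat" where "idx n i = Suc (nat (i mod int n))"

text \<open>The quotient of \<open>i\<close> by \<open>n\<close> counts periods and the remainder
  selects the point. Index 0 is \<open>s 1\<close>, so \<open>s j\<close> has index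
  \<open>j - 1\<close>. Consecutive terms bound a gap, without an exception at the end of a
  period.\<close>

definition unroll :: "nat \<Rightarrow> (nat \<Rightarrow> real) \<Rightarrow> int \<Rightarrow> real" where
  "unroll n s i = s (idx n i) + of_int (i div int n) * L"

lemma idx_in: "1 \<le> n \<Longrightarrow> idx n i \<in> {1..n}"
  by (auto simp: idx_def Suc_le_eq nat_less_iff)

lemma idx_eq: "1 \<le> n \<Longrightarrow> j < n \<Longrightarrow> idx n (int n * m + int j) = Suc j"
  by (simp add: idx_def)

lemma unroll_eq: "1 \<le> n \<Longrightarrow> j < n \<Longrightarrow> unroll n s (int n * m + int j) = s (Suc j) + of_int m * L"
  by (simp add: unroll_def idx_eq)

lemma idx_step:
  assumes n: "1 \<le> n"
  shows "idx n (i + 1) = nx n (idx n i)"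
    and "(i + 1) div int n = i div int n + (if idx n i = n then 1 else 0)"
proof -
  define q r where "q = i div int n" and "r = i mod int n"
  have i: "i = int n * q + r" and r: "0 \<le> r" "r < int n"
    using n by (auto simp: q_def r_def)
  have *: "idx n (i + 1) = nx n (idx n i) \<and> (i + 1) div int n = q + (if idx n i = n then 1 else 0)"
  proof (cases "r + 1 = int n")
    case True
    have e: "i + 1 = int n * (q + 1) + 0" unfolding i using True by (simp add: algebra_simps)
    have "(i + 1) div int n = q + 1" "(i + 1) mod int n = 0"
      using int_div_pos_eq[OF e] int_mod_pos_eq[OF e] n by auto
    moreover have "idx n i = n" using True r(1) by (simp add: idx_def r_def[symmetric])
    ultimately show ?thesis by (simp add: idx_def nx_def)
  next
    case False
    have e: "i + 1 = int n * q + (r + 1)" unfolding i by simp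
    have "(i + 1) div int n = q" "(i + 1) mod int n = r + 1"
      using int_div_pos_eq[OF e] int_mod_pos_eq[OF e] r False by auto
    moreover have "idx n i \<noteq> n" using False r by (auto simp: idx_def r_def[symmetric])
    moreover have "nat (i mod int n) = nat r" by (simp add: r_def)
    ultimately show ?thesis using r(1) by (simp add: idx_def nx_def nat_add_distrib)
  qed
  then show "idx n (i + 1) = nx n (idx n i)"
    "(i + 1) div int n = i div int n + (if idx n i = n then 1 else 0)"
    by (auto simp: q_def)
qed

lemma unroll_step:
  assumes n: "1 \<le> n"
  shows "unroll n s (i + 1) = nxt n s (idx n i) + of_int (i div int n) * L"
  unfolding unroll_def nxt_nx idx_step[OF n] by (simp add: distrib_right)

lemma unroll_periodic:
  assumes "1 \<le> n"
  shows "unroll n s (i + int n) = unroll n s i + L"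
  using assms by (simp add: unroll_def idx_def algebra_simps)

lemma unroll_gap:
  assumes n: "1 \<le> n" and nd: "nondeg n s"
  shows "adm (unroll n s i) (unroll n s (i + 1))" "unroll n s i < unroll n s (i + 1)"
    and "p (unroll n s i) (unroll n s (i + 1)) = p (s (idx n i)) (nxt n s (idx n i))"
    and "q (unroll n s i) (unroll n s (i + 1)) = q (s (idx n i)) (nxt n s (idx n i))"
  unfolding unroll_step[OF n] unfolding unroll_def
  using nd idx_in[OF n, of i] periodic_int[of adm, OF adm_periodic]
    periodic_int[of p] periodic_int[of q]
  by (auto simp: nondeg_def p_def q_def D_periodic)

lemma nx_inj: "j \<in> {1..n} \<Longrightarrow> k \<in> {1..n} \<Longrightarrow> nx n j = nx n k \<longleftrightarrow> j = k"
  by (auto simp: nx_def split: if_splits)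

text \<open>Moving a single point changes only the gap that ends there and the gap that starts
  there. The two curvature terms cancel by periodicity, so the squares of the slopes agree, and
  \<open>phi_bounce\<close> gives the signs.\<close>

lemma critical_reflection:
  assumes n: "1 \<le> n" and nd: "nondeg n s" and crit: "\<And>v. grad_H n s v = 0" and j: "j \<in> {1..n}"
  shows "q (s j) (nxt n s j) = - p (s (nx n j)) (nxt n s (nx n j))"
proof -
  let ?i = "nx n j"
  have i: "?i \<in> {1..n}" by (rule nx_in[OF n j])
  have "0 = grad_H n s (\<lambda>k. of_bool (?i = k))" by (simp only: crit)
  also have "\<dots> = (\<Sum>k\<in>{1..n}. of_bool (?i = k) * E1 (s k) (nxt n s k))
      + (\<Sum>k\<in>{1..n}. of_bool (j = k) * E2 (s k) (nxt n s k))"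
    unfolding grad_H_def sum.distrib[symmetric]
  proof (intro sum.cong refl)
    fix k assume "k \<in> {1..n}"
    then have "(?i = nx n k) = (j = k)" by (rule nx_inj[OF j])
    then show "E1 (s k) (nxt n s k) * of_bool (?i = k) + E2 (s k) (nxt n s k) * of_bool (?i = nx n k)
        = of_bool (?i = k) * E1 (s k) (nxt n s k) + of_bool (j = k) * E2 (s k) (nxt n s k)"
      by (simp only: mult.commute)
  qed
  also have "\<dots> = E1 (s ?i) (nxt n s ?i) + E2 (s j) (nxt n s j)"
    by (simp only: sum_of_bool_mult[OF i] sum_of_bool_mult[OF j])
  finally have "(p (s ?i) (nxt n s ?i))\<^sup>2 + \<kappa> (s ?i) = (q (s j) (nxt n s j))\<^sup>2 + \<kappa> (nxt n s j)"
    by (simp add: E1_def E2_def)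
  moreover have "\<kappa> (nxt n s j) = \<kappa> (s ?i)" unfolding nxt_nx by (simp add: \<kappa>_periodic)
  ultimately have "(p (s ?i) (nxt n s ?i))\<^sup>2 = (- q (s j) (nxt n s j))\<^sup>2" by simp
  moreover have "0 < p (s ?i) (nxt n s ?i)"
    using nd i phi_bounce(1)[of "s ?i" "nxt n s ?i"] unfolding nondeg_def by blast
  moreover have "q (s j) (nxt n s j) < 0"
    using nd j phi_bounce(2)[of "s j" "nxt n s j"] unfolding nondeg_def by blast
  ultimately have "p (s ?i) (nxt n s ?i) = - q (s j) (nxt n s j)"
    by (metis less_imp_le neg_0_le_iff_le power2_eq_imp_eq)
  then show ?thesis by simp
qed

section \<open>Gluing the minimisers of the gaps\<close>

definition gap_index :: "nat \<Rightarrow> (nat \<Rightarrow> real) \<Rightarrow> real \<Rightarrow> int" where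
  "gap_index n s t = (THE i. unroll n s i \<le> t \<and> t < unroll n s (i + 1))"

definition bounce_field :: "nat \<Rightarrow> (nat \<Rightarrow> real) \<Rightarrow> real \<Rightarrow> real" where
  "bounce_field n s t = (let i = gap_index n s t in phi (unroll n s i) (unroll n s (i + 1)) t)"

lemma unroll_less:
  assumes n: "1 \<le> n" and nd: "nondeg n s" and "i < k"
  shows "unroll n s i < unroll n s k"
  using assms(3)
proof (induction k rule: int_gr_induct)
  case base
  then show ?case by (rule unroll_gap(2)[OF n nd])
next
  case (step k)
  then show ?case using unroll_gap(2)[OF n nd, of k] by simp
qed

lemma unroll_less_iff:
  assumes "1 \<le> n" "nondeg n s"
  shows "unroll n s i < unroll n s k \<longleftrightarrow> i < k"
  using unroll_less[OF assms, of i k] unroll_less[OF assms, of k i] by (cases i k rule: linorder_cases) auto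

lemma gap_exists:
  assumes n: "1 \<le> n" and nd: "nondeg n s"
  shows "\<exists>i. unroll n s i \<le> t \<and> t < unroll n s (i + 1)"
proof -
  define m where "m = \<lfloor>(t - s 1) / L\<rfloor>"
  have m: "of_int m * L \<le> t - s 1" "t - s 1 < (of_int m + 1) * L"
    using floor_divide_lower[OF L_pos, of "t - s 1"] floor_divide_upper[OF L_pos, of "t - s 1"]
    by (simp_all add: m_def)
  have u0: "unroll n s (int n * m) \<le> t" using unroll_eq[OF n, of 0 s m] n m(1) by simp
  have "unroll n s (int n * m + int n) = s 1 + of_int m * L + L"
    using unroll_periodic[OF n] unroll_eq[OF n, of 0 s m] n by simp
  then have u1: "t < unroll n s (int n * m + int n)" using m(2) by (simp add: algebra_simps)
  \<comment> \<open>The first minimum point beyond \<open>t\<close>, counted from the start of the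
    period of \<open>t\<close>; its predecessor opens the gap that contains
    \<open>t\<close>.\<close>
  define k where "k = (LEAST k. t < unroll n s (int n * m + int k))"
  have k: "t < unroll n s (int n * m + int k)" unfolding k_def by (rule LeastI[of _ n]) (rule u1)
  then have "k \<noteq> 0" using u0 by (intro notI) simp
  then obtain l where l: "k = Suc l" by (cases k) auto
  have "\<not> t < unroll n s (int n * m + int l)"
    by (rule not_less_Least[of l "\<lambda>k. t < unroll n s (int n * m + int k)", folded k_def]) (simp add: l)
  then show ?thesis using k l by (intro exI[of _ "int n * m + int l"]) (auto simp: algebra_simps)
qed

lemma gap_index_eq:
  assumes n: "1 \<le> n" and nd: "nondeg n s" and "unroll n s i \<le> t" "t < unroll n s (i + 1)"
  shows "gap_index n s t = i"
  unfolding gap_index_def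
proof (rule the_equality)
  fix k assume k: "unroll n s k \<le> t \<and> t < unroll n s (k + 1)"
  then have "unroll n s k < unroll n s (i + 1)" "unroll n s i < unroll n s (k + 1)" using assms by auto
  then show "k = i" unfolding unroll_less_iff[OF n nd] by simp
qed (use assms in simp)

lemma unroll_D: "1 \<le> n \<Longrightarrow> nondeg n s \<Longrightarrow> D (unroll n s i) (unroll n s (i + 1)) \<noteq> 0"
  using D_pos[OF unroll_gap(1)[of n s i], of "unroll n s i" "unroll n s (i + 1)"] unroll_gap(2)[of n s i] by simp

text \<open>Valid on the closed gap: at the right end \<open>gap_index\<close> already selects the
  next gap, but both minimisers have the value 1 there.\<close>

lemma bounce_field_eq:
  assumes n: "1 \<le> n" and nd: "nondeg n s" and t: "unroll n s i \<le> t" "t \<le> unroll n s (i + 1)"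
  shows "bounce_field n s t = phi (unroll n s i) (unroll n s (i + 1)) t"
proof (cases "t = unroll n s (i + 1)")
  case True
  then have "gap_index n s t = i + 1"
    using unroll_gap(2)[OF n nd, of "i + 1"] by (intro gap_index_eq[OF n nd]) auto
  then show ?thesis
    using phi_ends(1)[OF unroll_D[OF n nd, of "i + 1"]] phi_ends(2)[OF unroll_D[OF n nd, of i]]
    by (simp add: bounce_field_def Let_def True)
next
  case False
  then have "gap_index n s t = i" using t by (intro gap_index_eq[OF n nd]) auto
  then show ?thesis by (simp add: bounce_field_def Let_def)
qed

lemma bounce_field_periodic:
  assumes n: "1 \<le> n" and nd: "nondeg n s"
  shows "bounce_field n s (t + L) = bounce_field n s t"
proof -
  obtain i where i: "unroll n s i \<le> t" "t < unroll n s (i + 1)" using gap_exists[OF n nd] by blast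
  have e: "unroll n s (i + int n) = unroll n s i + L" "unroll n s (i + int n + 1) = unroll n s (i + 1) + L"
    using unroll_periodic[OF n, of s i] unroll_periodic[OF n, of s "i + 1"] by (simp_all add: algebra_simps)
  have "bounce_field n s (t + L) = phi (unroll n s i + L) (unroll n s (i + 1) + L) (t + L)"
    using bounce_field_eq[OF n nd, of "i + int n" "t + L"] i unfolding e by simp
  also have "\<dots> = bounce_field n s t" using bounce_field_eq[OF n nd, of i t] i by (simp add: phi_periodic)
  finally show ?thesis .
qed

lemma bounce_field_continuous:
  assumes n: "1 \<le> n" and nd: "nondeg n s"
  shows "continuous_on UNIV (bounce_field n s)"
proof (rule continuous_at_imp_continuous_on, rule)
  fix t
  obtain i where i: "unroll n s i \<le> t" "t < unroll n s (i + 1)" using gap_exists[OF n nd] by blast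
  have c: "continuous_on {unroll n s i..unroll n s (i + 1)} (bounce_field n s)" for i
    by (rule continuous_on_eq[OF phi_continuous(1)[where a = "unroll n s i" and b = "unroll n s (i + 1)"]])
       (simp add: bounce_field_eq[OF n nd, of i])
  \<comment> \<open>The point may be the left end of its gap, so the preceding gap is included to
    obtain an open neighbourhood.\<close>
  have "continuous_on ({unroll n s (i - 1)..unroll n s i} \<union> {unroll n s i..unroll n s (i + 1)}) (bounce_field n s)"
    using c[of "i - 1"] c[of i] by (intro continuous_on_closed_Un) auto
  then have "continuous_on {unroll n s (i - 1)<..<unroll n s (i + 1)} (bounce_field n s)"
    by (rule continuous_on_subset) auto
  moreover have "unroll n s (i - 1) < t" using unroll_gap(2)[OF n nd, of "i - 1"] i by simp
  ultimately show "isCont (bounce_field n s) t"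
    using i(2) by (simp add: continuous_on_eq_continuous_at)
qed

lemma bounce_field_deriv:
  assumes n: "1 \<le> n" and nd: "nondeg n s" and t: "unroll n s i < t" "t < unroll n s (i + 1)"
  shows "deriv (bounce_field n s) t = phi' (unroll n s i) (unroll n s (i + 1)) t"
proof (rule DERIV_imp_deriv)
  show "(bounce_field n s has_real_derivative phi' (unroll n s i) (unroll n s (i + 1)) t) (at t)"
    by (rule has_field_derivative_transform_within_open[OF dphi, of "{unroll n s i<..<unroll n s (i + 1)}"])
       (use t in \<open>auto simp: bounce_field_eq[OF n nd, of i]\<close>)
qed

theorem critical_bouncing_jacobi_field:
  assumes n: "1 \<le> n" and nd: "nondeg n s" and crit: "\<And>v. grad_H n s v = 0"
    and range: "\<And>j. j \<in> {1..n} \<Longrightarrow> 0 \<le> s j" "\<And>j. j \<in> {1..n} \<Longrightarrow> s j < L"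
  shows "bouncing_jacobi_field \<kappa> L n (bounce_field n s) s"
proof -
  let ?u = "unroll n s" and ?\<Phi> = "bounce_field n s"
  have u: "?u (int j - 1) = s j" if "j \<in> {1..n}" for j
  proof -
    have "j - 1 < n" using that by auto
    from unroll_eq[OF n this, of s 0] show ?thesis using that by (simp add: of_nat_diff)
  qed
  have smono: "strict_mono_on {1..n} s"
    by (rule strict_mono_onI) (metis u unroll_less[OF n nd] diff_strict_right_mono of_nat_less_iff)
  define G where "G = - {s j + of_int m * L | j m. j \<in> {1..n}}"
  have G: "\<exists>i. ?u i < t \<and> t < ?u (i + 1)" if "t \<in> G" for t
  proof -
    obtain i where i: "?u i \<le> t" "t < ?u (i + 1)" using gap_exists[OF n nd] by blast
    have "?u i \<noteq> t" using that idx_in[OF n, of i] unfolding G_def unroll_def by blast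
    then show ?thesis using i by (intro exI[of _ i]) simp
  qed
  have sm: "smooth_on G ?\<Phi>"
    unfolding smooth_on_def
  proof (intro allI times_differentiable_local)
    fix k t assume "t \<in> G"
    then obtain i where i: "?u i < t" "t < ?u (i + 1)" using G by blast
    have "times_differentiable_on k {?u i<..<?u (i + 1)} ?\<Phi>"
    proof (rule times_differentiable_cong)
      show "times_differentiable_on k {?u i<..<?u (i + 1)} (phi (?u i) (?u (i + 1)))"
        by (rule times_differentiable_subset[OF _ smooth_on_imp_times_differentiable[OF phi_smooth]]) simp
    qed (auto simp: bounce_field_eq[OF n nd, of i])
    then show "\<exists>U. open U \<and> t \<in> U \<and> times_differentiable_on k U ?\<Phi>"
      using i by (intro exI[of _ "{?u i<..<?u (i + 1)}"]) auto
  qed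
  have jac: "jacobi_operator \<kappa> ?\<Phi> t = 0 \<and> 1 < ?\<Phi> t" if tG: "t \<in> G" for t
  proof -
    obtain i where i: "?u i < t" "t < ?u (i + 1)" using G[OF tG] by blast
    have \<Phi>: "?\<Phi> t = phi (?u i) (?u (i + 1)) t" using i by (intro bounce_field_eq[OF n nd]) auto
    have "(deriv ?\<Phi> has_real_derivative - \<kappa> t * phi (?u i) (?u (i + 1)) t) (at t)"
      by (rule has_field_derivative_transform_within_open[OF dphi', of "{?u i<..<?u (i + 1)}"])
         (use i in \<open>auto simp: bounce_field_deriv[OF n nd, of i]\<close>)
    then have "deriv (deriv ?\<Phi>) t = - \<kappa> t * phi (?u i) (?u (i + 1)) t" by (rule DERIV_imp_deriv)
    then show ?thesis
      unfolding jacobi_operator_def \<Phi> using phi_bounce(3)[OF unroll_gap(1,2)[OF n nd] i] by simp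
  qed
  have bounce: "?\<Phi> (s j) = 1 \<and> (\<exists>d>0. (deriv ?\<Phi> \<longlongrightarrow> d) (at_right (s j)) \<and> (deriv ?\<Phi> \<longlongrightarrow> - d) (at_left (s j)))"
    if j: "j \<in> {1..n}" for j
  proof -
    define i where "i = int j - 1"
    have ui: "?u i = s j" using u[OF j] by (simp add: i_def)
    note ends = phi_ends[OF unroll_D[OF n nd]]
    have "?\<Phi> (?u i) = 1"
      using bounce_field_eq[OF n nd, of i "?u i"] unroll_gap(2)[OF n nd, of i] ends(1)[of i] by simp
    define d where "d = p (?u i) (?u (i + 1))"
    have "0 < d" unfolding d_def by (rule phi_bounce(1)[OF unroll_gap(1,2)[OF n nd]])
    \<comment> \<open>The law of reflection for the gap that ends at \<open>s j\<close>, read off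
      for the unrolled sequence.\<close>
    have q: "q (?u (i - 1)) (?u i) = - d"
      using critical_reflection[OF n nd crit idx_in[OF n], of "i - 1"] unroll_gap(3)[OF n nd, of i]
        unroll_gap(4)[OF n nd, of "i - 1"] idx_step(1)[OF n, of "i - 1"] by (simp add: d_def)
    have "(phi' (?u i) (?u (i + 1)) \<longlongrightarrow> d) (at_right (?u i))"
      using DERIV_isCont[OF dphi'[where a = "?u i" and b = "?u (i + 1)" and t = "?u i"]] ends(3)[of i]
      by (simp add: isCont_def d_def filterlim_at_split)
    moreover have "\<forall>\<^sub>F t in at_right (?u i). phi' (?u i) (?u (i + 1)) t = deriv ?\<Phi> t"
      using unroll_gap(2)[OF n nd, of i]
      by (auto simp: eventually_at_right[OF unroll_gap(2)[OF n nd, of i]] bounce_field_deriv[OF n nd, of i]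
          intro!: exI[of _ "?u (i + 1)"])
    ultimately have right: "(deriv ?\<Phi> \<longlongrightarrow> d) (at_right (?u i))"
      by (rule Lim_transform_eventually)
    have lt: "?u (i - 1) < ?u i" using unroll_gap(2)[OF n nd, of "i - 1"] by simp
    have "(phi' (?u (i - 1)) (?u i) \<longlongrightarrow> - d) (at_left (?u i))"
      using DERIV_isCont[OF dphi'[where a = "?u (i - 1)" and b = "?u i" and t = "?u i"]] ends(4)[of "i - 1"] q
      by (simp add: isCont_def filterlim_at_split)
    moreover have "\<forall>\<^sub>F t in at_left (?u i). phi' (?u (i - 1)) (?u i) t = deriv ?\<Phi> t"
      using lt bounce_field_deriv[OF n nd, of "i - 1"]
      by (auto simp: eventually_at_left[OF lt] intro!: exI[of _ "?u (i - 1)"])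
    ultimately have left: "(deriv ?\<Phi> \<longlongrightarrow> - d) (at_left (?u i))"
      by (rule Lim_transform_eventually)
    show ?thesis using \<open>?\<Phi> (?u i) = 1\<close> \<open>0 < d\<close> left right unfolding ui by blast
  qed
  show ?thesis
    unfolding bouncing_jacobi_field_def Let_def G_def[symmetric]
    using range smono bounce_field_periodic[OF n nd] bounce_field_continuous[OF n nd] sm jac bounce by blast
qed

end


section \<open>Existence of the bouncing Jacobi field\<close>

lemma periodic_bounded:
  fixes f :: "real \<Rightarrow> real"
  assumes "0 < L" "\<And>t. f (t + L) = f t" "continuous_on UNIV f"
  shows "\<exists>B. \<forall>t. \<bar>f t\<bar> \<le> B"
proof -
  have "bounded (f ` {0..L})"
    by (intro compact_imp_bounded compact_continuous_image continuous_on_subset[OF assms(3)]) auto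
  then obtain B where B: "\<forall>x\<in>{0..L}. \<bar>f x\<bar> \<le> B" by (auto simp: bounded_iff)
  have per: "f (t + of_int m * L) = f t" for t m
    using periodic_int[of "\<lambda>a b. f a" L t m] assms(2) by simp
  have "\<bar>f t\<bar> \<le> B" for t
  proof -
    have "t + of_int (- \<lfloor>t / L\<rfloor>) * L \<in> {0..L}"
      using floor_divide_lower[OF assms(1), of t] floor_divide_upper[OF assms(1), of t]
      by (simp add: algebra_simps)
    then show ?thesis using B per[of t "- \<lfloor>t / L\<rfloor>"] by metis
  qed
  then show ?thesis by blast
qed

theorem theorem1p4:
  fixes X :: "'a topology" and A :: "'a chart set" and g :: "'a metric_coeffs"
    and K :: "'a \<Rightarrow> real" and \<gamma> :: "real \<Rightarrow> 'a" and L :: real and n :: nat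
  assumes "compact_riemannian_surface X A g"
    and "is_gauss_curvature A g K"
    and "closed_embedded_geodesic X A g L \<gamma>"
    and "n \<ge> 1"
    and "\<And>p. p \<in> range \<gamma> \<Longrightarrow> K p > 0"
    and "L\<^sup>2 * (SUP p\<in>range \<gamma>. K p) < pi\<^sup>2 * (real n)\<^sup>2"
  shows "\<exists>\<Phi> s. bouncing_jacobi_field (K \<circ> \<gamma>) L n \<Phi> s \<and>
           bjf_nullity (K \<circ> \<gamma>) L n s + bjf_index (K \<circ> \<gamma>) L n s = n"
proof -
  let ?\<kappa> = "K \<circ> \<gamma>"
  have L: "0 < L" and per: "\<And>s. \<gamma> (s + L) = \<gamma> s"
    using assms(3) unfolding closed_embedded_geodesic_def by auto
  have sm: "smooth_on UNIV ?\<kappa>"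
    by (rule smooth_on_curvature_along_geodesic[OF assms(1-3)])
  note cont = smooth_on_continuous[OF sm]
  obtain B where B: "\<And>t. \<bar>?\<kappa> t\<bar> \<le> B"
    using periodic_bounded[OF L _ cont] per by auto
  \<comment> \<open>The supremum of a set of reals bounds its elements only if the set is bounded
    above; here this follows from continuity and periodicity.\<close>
  have le: "?\<kappa> t \<le> (SUP p\<in>range \<gamma>. K p)" for t
    using B by (auto intro!: cSUP_upper bdd_aboveI[of _ B] simp: abs_le_iff)
  obtain C C' where C: "C 0 = 1" "C' 0 = 0" "\<And>t. (C has_real_derivative C' t) (at t)"
    "\<And>t. (C' has_real_derivative - ?\<kappa> t * C t) (at t)"
    using jacobi_equation_solvable[OF cont B, of 1 0] by blast
  obtain S S' where S: "S 0 = 0" "S' 0 = 1" "\<And>t. (S has_real_derivative S' t) (at t)"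
    "\<And>t. (S' has_real_derivative - ?\<kappa> t * S t) (at t)"
    using jacobi_equation_solvable[OF cont B, of 0 1] by blast
  interpret jacobi ?\<kappa> L C C' S S'
    by unfold_locales (use L sm C S assms(5) per in auto)
  obtain s where s: "maximal n s" "\<And>j. j \<in> {1..n} \<Longrightarrow> 0 \<le> s j" "\<And>j. j \<in> {1..n} \<Longrightarrow> s j < L"
    using normalized_maximal_exists[OF assms(4) le assms(6)] by blast
  have "bouncing_jacobi_field ?\<kappa> L n (bounce_field n s) s"
    by (rule critical_bouncing_jacobi_field[OF assms(4) maximal_nondeg[OF assms(4) s(1)]
        maximal_second_order(1)[OF assms(4) s(1)] s(2,3)])
  then show ?thesis using maximal_nullity_index[OF assms(4) s(1)] by blast
qed

end
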